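(* There is an absolute constant $C_3$ such that for every integer $n\ge1$ and every $\sigma>0$ the estimator $\hat M$ of the minimum (constructed in the context) satisfies $$\mathbb E_f|\hat M-M(f)|\le C_3\,\tilde R_{m,n}(\sigma;f)\qquad\text{for all } f\in\mathcal F.$$
   Context: $\mathcal F$ is the collection of convex functions $f:[0,1]\to\mathbb R$ with a unique minimizer $Z(f)=\arg\min_{0\le t\le1}f(t)$; $M(f)=f(Z(f))$ is the minimum value. Nonparametric regression model: one observes $y_i=f(x_i)+\sigma z_i$, $i=0,1,\dots,n$, with $x_i=i/n$, $z_i$ i.i.d. $N(0,1)$ and $\sigma>0$ known; $\mathbb E_f$ is expectation under $f$ (including auxiliary randomness). Benchmark: $\tilde R_{m,n}(\sigma;f)=\sup_{g\in\mathcal F}\inf_{\hat M}\max_{h\in\{f,g\}}\mathbb E_h|\hat M-M(h)|$, infimum over all estimators based on $y_0,\dots,y_n$ (the value $+\infty$ is allowed). Construction of $\hat M$. Data splitting: let $z_{1,0},\dots,z_{1,n},z_{2,0},\dots,z_{2,n}$ be i.i.d. $N(0,1)$, independent of the data. For $i=0,\dots,n$ set $y_{l,i}=y_i+\frac{\sqrt2}{2}\sigma z_{1,i}+\frac{\sqrt6}{2}\sigma z_{2,i}$, $y_{s,i}=y_i+\frac{\sqrt2}{2}\sigma z_{1,i}-\frac{\sqrt6}{2}\sigma z_{2,i}$, $y_{e,i}=y_i-\sqrt2\,\sigma z_{1,i}$; set $y_{l,i}=y_{s,i}=y_{e,i}=+\infty$ for $i\notin\{0,\dots,n\}$. Blocks: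 let $J=\lfloor\log_2(n+1)\rfloor$. For $0\le j\le J$ the $i$-th block at level $j$ is $\{x_{(i-1)2^{J-j}},\dots,x_{i2^{J-j}-1}\}$. For $u\in\{l,s,e\}$ let $Y_{j,i,u}=\sum_{k=(i-1)2^{J-j}}^{i2^{J-j}-1}y_{u,k}$, which is $+\infty$ whenever the block is not entirely contained in the sample, i.e. whenever $i\notin\{1,\dots,\lfloor(n+1)/2^{J-j}\rfloor\}$. Localization: $\hat i_0=1$ and for $j=1,\dots,J$, $\hat i_j=\arg\min Y_{j,i,l}$ over $\max\{2\hat i_{j-1}-2,1\}\le i\le\min\{2\hat i_{j-1}+1,\lfloor(n+1)/2^{J-j}\rfloor\}$. Stopping: $T_j=\min\{Y_{j,\hat i_j+6,s}-Y_{j,\hat i_j+5,s},\ Y_{j,\hat i_j-6,s}-Y_{j,\hat i_j-5,s}\}$ (with $+\infty-x=+\infty$ for all $x\le+\infty$), $\tilde\sigma_j^2=6\cdot2^{J-j}\sigma^2$. Let $\check j=\min\{j\in\{0,\dots,J\}:T_j\le2\tilde\sigma_j\}$ if this set is nonempty and $\check j=\infty$ otherwise; $\hat j=\min\{J,\check j\}$. Estimator: let $$\Delta=\mathbf 1\{Y_{\hat j,\hat i_{\hat j}+6,s}-Y_{\hat j,\hat i_{\hat j}+5,s}\le2\sqrt6\,\sigma\sqrt{2^{J-\hat j}}\}-\mathbf 1\{Y_{\hat j,\hat i_{\hat j}-6,s}-Y_{\hat j,\hat i_{\hat j}-5,s}\le2\sqrt6\,\sigma\sqrt{2^{J-\hat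 j}}\},$$ $\tilde i_{\hat j}=\hat i_{\hat j}+2\Delta$ if $\check j<\infty$, and $\tilde i_{\hat j}=\arg\min_{\hat i_{\hat j}-2\le i\le\hat i_{\hat j}+2}y_{e,i-1}$ if $\check j=\infty$. Then $\hat M=2^{-(J-\hat j)}\,Y_{\hat j,\tilde i_{\hat j},e}$. *)

theory Defs
  imports "HOL-Probability.Probability"
begin

section \<open>Convex functions with a unique minimizer\<close>

text \<open>
  A function on the unit interval is represented by a total function on the reals; everything
  below depends only on its values on the unit interval.
\<close>

definition conv_fun :: "(real \<Rightarrow> real) set" where
  "conv_fun = {f. convex_on {0..1} f \<and> (\<exists>!t. is_arg_min f (\<lambda>t. t \<in> {0..1}) t)}"

definition minimizer :: "(real \<Rightarrow> real) \<Rightarrow> real" where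
  "minimizer f = arg_min_on f {0..1}"

definition min_value :: "(real \<Rightarrow> real) \<Rightarrow> real" where
  "min_value f = f (minimizer f)"

section \<open>The regression model and the benchmark\<close>

definition noise :: "nat \<Rightarrow> (nat \<Rightarrow> real) measure" where
  "noise n = PiM {0..n} (\<lambda>_. density lborel std_normal_density)"

definition observation :: "nat \<Rightarrow> real \<Rightarrow> (real \<Rightarrow> real) \<Rightarrow> (nat \<Rightarrow> real) \<Rightarrow> nat \<Rightarrow> real" where
  "observation n \<sigma> f z = (\<lambda>i\<in>{0..n}. f (real i / real n) + \<sigma> * z i)"

definition data :: "nat \<Rightarrow> real \<Rightarrow> (real \<Rightarrow> real) \<Rightarrow> (nat \<Rightarrow> real) measure" where
  "data n \<sigma> f = distr (noise n) (PiM {0..n} (\<lambda>_. borel)) (observation n \<sigma> f)"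

text \<open>
  Estimators may use auxiliary randomness: an estimator maps the data to the conditional law of
  the estimate, that is, it is a Markov kernel.  A non-randomized estimator m is the kernel
  sending y to the Dirac measure at m y.
\<close>

definition estimators :: "nat \<Rightarrow> ((nat \<Rightarrow> real) \<Rightarrow> real measure) set" where
  "estimators n = PiM {0..n} (\<lambda>_. borel) \<rightarrow>\<^sub>M prob_algebra borel"

definition risk ::
  "nat \<Rightarrow> real \<Rightarrow> ((nat \<Rightarrow> real) \<Rightarrow> real measure) \<Rightarrow> (real \<Rightarrow> real) \<Rightarrow> ennreal" where
  "risk n \<sigma> \<delta> h = (\<integral>\<^sup>+ y. (\<integral>\<^sup>+ a. ennreal \<bar>a - min_value h\<bar> \<partial>\<delta> y) \<partial>data n \<sigma> h)"

definition benchmark :: "nat \<Rightarrow> real \<Rightarrow> (real \<Rightarrow> real) \<Rightarrow> ennreal" where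
  "benchmark n \<sigma> f =
    (SUP g\<in>conv_fun. INF \<delta>\<in>estimators n. max (risk n \<sigma> \<delta> f) (risk n \<sigma> \<delta> g))"

section \<open>The estimator of the minimum\<close>

definition sample_l ::
  "real \<Rightarrow> (nat \<Rightarrow> real) \<Rightarrow> (nat \<Rightarrow> real) \<Rightarrow> (nat \<Rightarrow> real) \<Rightarrow> nat \<Rightarrow> real" where
  "sample_l \<sigma> y z1 z2 i = y i + sqrt 2 / 2 * \<sigma> * z1 i + sqrt 6 / 2 * \<sigma> * z2 i"

definition sample_s ::
  "real \<Rightarrow> (nat \<Rightarrow> real) \<Rightarrow> (nat \<Rightarrow> real) \<Rightarrow> (nat \<Rightarrow> real) \<Rightarrow> nat \<Rightarrow> real" where
  "sample_s \<sigma> y z1 z2 i = y i + sqrt 2 / 2 * \<sigma> * z1 i - sqrt 6 / 2 * \<sigma> * z2 i"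

definition sample_e :: "real \<Rightarrow> (nat \<Rightarrow> real) \<Rightarrow> (nat \<Rightarrow> real) \<Rightarrow> nat \<Rightarrow> real" where
  "sample_e \<sigma> y z1 i = y i - sqrt 2 * \<sigma> * z1 i"

definition extended :: "nat \<Rightarrow> (nat \<Rightarrow> real) \<Rightarrow> int \<Rightarrow> ereal" where
  "extended n v i = (if i \<in> {0..int n} then ereal (v (nat i)) else \<infinity>)"

definition finest :: "nat \<Rightarrow> nat" where
  "finest n = nat \<lfloor>log 2 (real (n + 1))\<rfloor>"

text \<open>
  Blocks are indexed by integers.  A block not contained in the sample has sum infinity, because
  one of its summands is infinite and none is minus infinity.
\<close>

definition block_sum :: "nat \<Rightarrow> (nat \<Rightarrow> real) \<Rightarrow> nat \<Rightarrow> int \<Rightarrow> ereal" where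
  "block_sum n v j i =
    (\<Sum>k = (i - 1) * 2 ^ (finest n - j) .. i * 2 ^ (finest n - j) - 1. extended n v k)"

definition block_count :: "nat \<Rightarrow> nat \<Rightarrow> int" where
  "block_count n j = \<lfloor>real (n + 1) / 2 ^ (finest n - j)\<rfloor>"

text \<open>
  In the remaining definitions \<^term>\<open>l\<close>, \<^term>\<open>s\<close> and \<^term>\<open>e\<close> stand for the three samples used
  for localization, stopping and estimation.  The minimizers below are almost surely unique;
  ties are left to \<^const>\<open>arg_min_on\<close>.
\<close>

fun loc_index :: "nat \<Rightarrow> (nat \<Rightarrow> real) \<Rightarrow> nat \<Rightarrow> int" where
  "loc_index n l 0 = 1"
| "loc_index n l (Suc j) =
    arg_min_on (block_sum n l (Suc j))
      {max (2 * loc_index n l j - 2) 1 .. min (2 * loc_index n l j + 1) (block_count n (Suc j))}"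

text \<open>
  Subtraction on \<^typ>\<open>ereal\<close> satisfies \<^prop>\<open>(\<infinity>::ereal) - x = \<infinity>\<close> for all \<^term>\<open>x\<close>, including infinity.
\<close>

definition right_diff :: "nat \<Rightarrow> (nat \<Rightarrow> real) \<Rightarrow> (nat \<Rightarrow> real) \<Rightarrow> nat \<Rightarrow> ereal" where
  "right_diff n l s j =
    block_sum n s j (loc_index n l j + 6) - block_sum n s j (loc_index n l j + 5)"

definition left_diff :: "nat \<Rightarrow> (nat \<Rightarrow> real) \<Rightarrow> (nat \<Rightarrow> real) \<Rightarrow> nat \<Rightarrow> ereal" where
  "left_diff n l s j =
    block_sum n s j (loc_index n l j - 6) - block_sum n s j (loc_index n l j - 5)"

definition stop_stat :: "nat \<Rightarrow> (nat \<Rightarrow> real) \<Rightarrow> (nat \<Rightarrow> real) \<Rightarrow> nat \<Rightarrow> ereal" where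
  "stop_stat n l s j = min (right_diff n l s j) (left_diff n l s j)"

definition stop_sd :: "nat \<Rightarrow> real \<Rightarrow> nat \<Rightarrow> real" where
  "stop_sd n \<sigma> j = sqrt (6 * 2 ^ (finest n - j) * \<sigma>\<^sup>2)"

text \<open>The infimum of the empty set is infinity.\<close>

definition j_check :: "nat \<Rightarrow> real \<Rightarrow> (nat \<Rightarrow> real) \<Rightarrow> (nat \<Rightarrow> real) \<Rightarrow> enat" where
  "j_check n \<sigma> l s =
    Inf (enat ` {j \<in> {0..finest n}. stop_stat n l s j \<le> ereal (2 * stop_sd n \<sigma> j)})"

definition j_hat :: "nat \<Rightarrow> real \<Rightarrow> (nat \<Rightarrow> real) \<Rightarrow> (nat \<Rightarrow> real) \<Rightarrow> nat" where
  "j_hat n \<sigma> l s = the_enat (min (enat (finest n)) (j_check n \<sigma> l s))"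

definition shift :: "nat \<Rightarrow> real \<Rightarrow> (nat \<Rightarrow> real) \<Rightarrow> (nat \<Rightarrow> real) \<Rightarrow> int" where
  "shift n \<sigma> l s =
    (let j = j_hat n \<sigma> l s; c = ereal (2 * sqrt 6 * \<sigma> * sqrt (2 ^ (finest n - j))) in
      of_bool (right_diff n l s j \<le> c) - of_bool (left_diff n l s j \<le> c))"

definition final_index ::
  "nat \<Rightarrow> real \<Rightarrow> (nat \<Rightarrow> real) \<Rightarrow> (nat \<Rightarrow> real) \<Rightarrow> (nat \<Rightarrow> real) \<Rightarrow> int" where
  "final_index n \<sigma> l s e =
    (let i = loc_index n l (j_hat n \<sigma> l s) in
      if j_check n \<sigma> l s < \<infinity> then i + 2 * shift n \<sigma> l s
      else arg_min_on (\<lambda>k. extended n e (k - 1)) {i - 2..i + 2})"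

text \<open>
  The estimate always is a finite number; it is typed in \<^typ>\<open>ereal\<close> because block sums are.
\<close>

definition M_split ::
  "nat \<Rightarrow> real \<Rightarrow> (nat \<Rightarrow> real) \<Rightarrow> (nat \<Rightarrow> real) \<Rightarrow> (nat \<Rightarrow> real) \<Rightarrow> ereal" where
  "M_split n \<sigma> l s e =
    (let j = j_hat n \<sigma> l s in
      ereal (1 / 2 ^ (finest n - j)) * block_sum n e j (final_index n \<sigma> l s e))"

definition M_hat ::
  "nat \<Rightarrow> real \<Rightarrow> (nat \<Rightarrow> real) \<Rightarrow> (nat \<Rightarrow> real) \<Rightarrow> (nat \<Rightarrow> real) \<Rightarrow> ereal" where
  "M_hat n \<sigma> y z1 z2 =
    M_split n \<sigma> (sample_l \<sigma> y z1 z2) (sample_s \<sigma> y z1 z2) (sample_e \<sigma> y z1)"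

definition M_hat_risk :: "nat \<Rightarrow> real \<Rightarrow> (real \<Rightarrow> real) \<Rightarrow> ennreal" where
  "M_hat_risk n \<sigma> f =
    (\<integral>\<^sup>+ (y, z1, z2). e2ennreal \<bar>M_hat n \<sigma> y z1 z2 - ereal (min_value f)\<bar>
      \<partial>(data n \<sigma> f \<Otimes>\<^sub>M noise n \<Otimes>\<^sub>M noise n))"

end

theory Submission
  imports Defs
begin

text \<open>
  The only probabilistic tool is the Cameron--Martin formula. If \<open>g\<close> is invariant under translations
  in direction \<open>d\<close>, then \<open>E (g exp \<langle>d, Z\<rangle>) = exp (\<bar>d\<bar>\<^sup>2 / 2) E g\<close> for standard Gaussian \<open>Z\<close>; this
  replaces every use of independence, and it bounds \<open>E (g \<bar>\<langle>d, Z\<rangle>\<bar>)\<close> by a multiple of \<open>\<bar>d\<bar> E g\<close>.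

  Lower bound: raising the bottom of \<open>f\<close> by \<open>u\<close> while changing the grid values by at most \<open>\<sigma>\<close> in
  Euclidean norm shows that the benchmark is at least a multiple of \<open>u\<close>. Hence the benchmark
  dominates the gap between the minimum and the smallest grid value, and also the standard deviation
  of a block mean at any level where, at some position, the block means of \<open>f\<close> rise by half the
  standard deviation of their difference on both sides. Let \<open>j\<^sub>0\<close> be the last level with a dominated
  standard deviation; beyond it one of the two sides is always flat.

  Upper bound: up to level \<open>j\<^sub>0\<close> the standard deviations grow geometrically, so it suffices that the
  expected error of stopping at level \<open>j\<close> is of the order of the standard deviation at \<open>j\<close>. Beyond
  \<open>j\<^sub>0\<close> each level is passed with probability at most \<open>1/2\<close>, independently because the stopping
  blocks of different levels are disjoint, and this beats the factor \<open>\<surd>2\<close> by which the standard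
  deviation grows. The bias is controlled pathwise: stopping on a side means that the slope there is
  small compared with the noise, and convexity transfers this slope to the chosen block as long as
  the path is close to the minimum. When the path leaves the minimum it does so because the noise
  outweighs the slope, and afterwards the observed mean along the path can only decrease.
\<close>

section \<open>Translations of Gaussian samples\<close>

text \<open>Path and stopping level depend on the data, and no conditioning is used to deal with
  this. The level is removed by summing the error over all levels with a weight that is at least 1
  at the level actually reached; the path is removed by summing over its finitely many values. What
  remains are integrals of products, such as the indicator of a fixed path times a weight times one
  linear functional, each treated by a translation that leaves the other factors unchanged. The
  offsets 5 and 6 of the stopping blocks serve two ends. While the path is next to the minimum,
  these blocks lie further out than the chosen block, so their slope dominates the slope there. And
  they avoid all blocks of offset at most 6 at finer levels of the path, which makes the stopping
  directions orthogonal. Threshold 2 and flatness 1/2, in standard deviations, leave 3/2 to be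
  supplied by the noise. The Chernoff bound exp (-9/8) is below 1/2, hence below the 1 / sqrt 2 that
  the sum over levels needs to converge.\<close>

abbreviation std_normal :: "real measure" where
  "std_normal \<equiv> density lborel (\<lambda>x. ennreal (std_normal_density x))"

lemma prob_std_normal: "prob_space std_normal"
  by (rule prob_space_normal_density) simp

lemma std_normal_shift:
  fixes F :: "real \<Rightarrow> ennreal"
  assumes [measurable]: "F \<in> borel_measurable borel"
  shows "(\<integral>\<^sup>+x. F (x + c) \<partial>std_normal) =
    (\<integral>\<^sup>+x. F x * ennreal (exp (c * x - c\<^sup>2 / 2)) \<partial>std_normal)"
proof -
  have dens: "std_normal_density (x - c) = exp (c * x - c\<^sup>2 / 2) * std_normal_density x" for x
    by (simp add: std_normal_density_def exp_add[symmetric] power2_eq_square algebra_simps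
        add_divide_distrib diff_divide_distrib flip: exp_add)
  have "(\<integral>\<^sup>+x. F (x + c) \<partial>std_normal) =
      (\<integral>\<^sup>+x. ennreal (std_normal_density x) * F (x + c) \<partial>lborel)"
    by (subst nn_integral_density) auto
  also have "\<dots> = (\<integral>\<^sup>+x. ennreal (std_normal_density (x - c)) * F x \<partial>lborel)"
    by (subst nn_integral_real_affine[where c=1 and t=c]) (auto simp: add.commute)
  also have "\<dots> = (\<integral>\<^sup>+x. ennreal (std_normal_density x) * (F x * ennreal (exp (c * x - c\<^sup>2 / 2))) \<partial>lborel)"
    by (intro nn_integral_cong) (simp add: dens ennreal_mult' mult_ac)
  also have "\<dots> = (\<integral>\<^sup>+x. F x * ennreal (exp (c * x - c\<^sup>2 / 2)) \<partial>std_normal)"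
    by (subst nn_integral_density) auto
  finally show ?thesis .
qed

lemma PiM_std_normal_shift:
  fixes F :: "('i \<Rightarrow> real) \<Rightarrow> ennreal"
  assumes "finite I" and "F \<in> borel_measurable (PiM I (\<lambda>_. borel))"
  shows "(\<integral>\<^sup>+x. F (\<lambda>i\<in>I. x i + u i) \<partial>PiM I (\<lambda>_. std_normal)) =
    (\<integral>\<^sup>+x. F x * ennreal (exp (\<Sum>i\<in>I. u i * x i - (u i)\<^sup>2 / 2)) \<partial>PiM I (\<lambda>_. std_normal))"
  using assms
proof (induction I arbitrary: F)
  case empty
  interpret product_sigma_finite "\<lambda>_::'i. std_normal"
    by (intro product_sigma_finite.intro prob_space_imp_sigma_finite prob_std_normal)
  show ?case by (simp add: PiM_empty nn_integral_count_space_finite)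
next
  case (insert i I)
  interpret P: product_sigma_finite "\<lambda>_::'i. std_normal"
    by (intro product_sigma_finite.intro prob_space_imp_sigma_finite prob_std_normal)
  have sets_eq: "sets (PiM A (\<lambda>_::'i. std_normal)) = sets (PiM A (\<lambda>_. borel))" for A
    by (intro sets_PiM_cong) auto
  note [measurable_cong] = sets_eq
  note [measurable] = insert.prems insert.hyps(1)
  define w where "w t = ennreal (exp (u i * t - (u i)\<^sup>2 / 2))" for t
  have [measurable]: "w \<in> borel_measurable borel" unfolding w_def by measurable
  \<comment> \<open>The weight of coordinate \<open>i\<close> goes into \<open>G\<close> before the
    induction hypothesis is applied, so the hypothesis has to supply only the weights over
    \<open>I\<close>.\<close>
  define G where "G x = (\<integral>\<^sup>+y. F (x(i := y)) * w y \<partial>std_normal)" for x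
  have insert_meas [measurable]: "(\<lambda>(x, y). F (x(i := y)) * w y) \<in> borel_measurable (PiM I (\<lambda>_. borel) \<Otimes>\<^sub>M std_normal)"
    by measurable
  interpret N: prob_space std_normal by (rule prob_std_normal)
  have [measurable]: "G \<in> borel_measurable (PiM I (\<lambda>_. borel))"
    unfolding G_def by measurable
  have "(\<integral>\<^sup>+x. F (\<lambda>k\<in>insert i I. x k + u k) \<partial>PiM (insert i I) (\<lambda>_. std_normal))
     = (\<integral>\<^sup>+x. (\<integral>\<^sup>+y. F (\<lambda>k\<in>insert i I. (x(i := y)) k + u k) \<partial>std_normal) \<partial>PiM I (\<lambda>_. std_normal))"
    using insert by (subst P.product_nn_integral_insert) auto
  also have "\<dots> = (\<integral>\<^sup>+x. (\<integral>\<^sup>+y. F ((\<lambda>k\<in>I. x k + u k)(i := y + u i)) \<partial>std_normal) \<partial>PiM I (\<lambda>_. std_normal))"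
    using insert.hyps by (intro nn_integral_cong arg_cong[where f=F]) (auto simp: fun_eq_iff)
  also have "\<dots> = (\<integral>\<^sup>+x. G (\<lambda>k\<in>I. x k + u k) \<partial>PiM I (\<lambda>_. std_normal))"
  proof (intro nn_integral_cong)
    fix x :: "'i \<Rightarrow> real"
    have "(\<lambda>k\<in>I. x k + u k) \<in> space (PiM I (\<lambda>_. borel))" by (auto simp: space_PiM)
    then show "(\<integral>\<^sup>+y. F ((\<lambda>k\<in>I. x k + u k)(i := y + u i)) \<partial>std_normal) = G (\<lambda>k\<in>I. x k + u k)"
      unfolding G_def w_def
      by (subst std_normal_shift[symmetric]) (auto)
  qed
  also have "\<dots> = (\<integral>\<^sup>+x. G x * ennreal (exp (\<Sum>i\<in>I. u i * x i - (u i)\<^sup>2 / 2)) \<partial>PiM I (\<lambda>_. std_normal))"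
    by (rule insert.IH) measurable
  also have "\<dots> = (\<integral>\<^sup>+x. (\<integral>\<^sup>+y. F (x(i := y)) * ennreal (exp (\<Sum>k\<in>insert i I. u k * (x(i:=y)) k - (u k)\<^sup>2 / 2))
      \<partial>std_normal) \<partial>PiM I (\<lambda>_. std_normal))"
  proof (intro nn_integral_cong)
    fix x assume x: "x \<in> space (PiM I (\<lambda>_::'i. std_normal))"
    then have x': "x \<in> space (PiM I (\<lambda>_::'i. borel :: real measure))" by (simp add: space_PiM)
    have "(\<Sum>k\<in>insert i I. u k * (x(i:=y)) k - (u k)\<^sup>2 / 2) =
       (u i * y - (u i)\<^sup>2/2) + (\<Sum>k\<in>I. u k * x k - (u k)\<^sup>2 / 2)" for y
      using insert.hyps by (subst sum.insert) (auto intro!: sum.cong)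
    then show "G x * ennreal (exp (\<Sum>i\<in>I. u i * x i - (u i)\<^sup>2 / 2)) =
      (\<integral>\<^sup>+y. F (x(i := y)) * ennreal (exp (\<Sum>k\<in>insert i I. u k * (x(i:=y)) k - (u k)\<^sup>2 / 2)) \<partial>std_normal)"
      unfolding G_def using measurable_compose[OF measurable_Pair1' insert_meas, OF x'] x
      by (subst nn_integral_multc[symmetric]) (auto simp: w_def exp_add ennreal_mult' mult_ac)
  qed
  also have "\<dots> = (\<integral>\<^sup>+x. F x * ennreal (exp (\<Sum>i\<in>insert i I. u i * x i - (u i)\<^sup>2 / 2)) \<partial>PiM (insert i I) (\<lambda>_. std_normal))"
    using insert by (subst P.product_nn_integral_insert) auto
  finally show ?case .
qed


text \<open>A change of variables with a weight passes to products by Fubini. The maps and weights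
  are arbitrary because the lemma is applied twice, the second time with a product as right
  factor.\<close>

lemma nn_integral_shift_pair:
  fixes T1 :: "'a \<Rightarrow> 'a" and T2 :: "'b \<Rightarrow> 'b" and w1 :: "'a \<Rightarrow> ennreal" and w2 :: "'b \<Rightarrow> ennreal"
  assumes "sigma_finite_measure M1" "sigma_finite_measure M2"
  and [measurable]: "T1 \<in> M1 \<rightarrow>\<^sub>M M1" "T2 \<in> M2 \<rightarrow>\<^sub>M M2" "w1 \<in> borel_measurable M1" "w2 \<in> borel_measurable M2"
  and 1: "\<And>F. F \<in> borel_measurable M1 \<Longrightarrow> (\<integral>\<^sup>+x. F (T1 x) \<partial>M1) = (\<integral>\<^sup>+x. F x * w1 x \<partial>M1)"
  and 2: "\<And>F. F \<in> borel_measurable M2 \<Longrightarrow> (\<integral>\<^sup>+x. F (T2 x) \<partial>M2) = (\<integral>\<^sup>+x. F x * w2 x \<partial>M2)"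
  and F[measurable]: "F \<in> borel_measurable (M1 \<Otimes>\<^sub>M M2)"
  shows "(\<integral>\<^sup>+(x, y). F (T1 x, T2 y) \<partial>(M1 \<Otimes>\<^sub>M M2)) = (\<integral>\<^sup>+(x, y). F (x, y) * (w1 x * w2 y) \<partial>(M1 \<Otimes>\<^sub>M M2))"
proof -
  interpret M1: sigma_finite_measure M1 by fact
  interpret M2: sigma_finite_measure M2 by fact
  have "(\<integral>\<^sup>+(x, y). F (T1 x, T2 y) \<partial>(M1 \<Otimes>\<^sub>M M2)) = (\<integral>\<^sup>+x. (\<integral>\<^sup>+y. F (T1 x, T2 y) \<partial>M2) \<partial>M1)"
    by (subst M2.nn_integral_fst[symmetric]) auto
  also have "\<dots> = (\<integral>\<^sup>+x. (\<integral>\<^sup>+y. F (T1 x, y) * w2 y \<partial>M2) \<partial>M1)"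
    by (intro nn_integral_cong 2) (use measurable_space[of T1 M1 M1] in \<open>auto\<close>)
  also have "\<dots> = (\<integral>\<^sup>+x. (\<integral>\<^sup>+y. F (x, y) * w2 y \<partial>M2) * w1 x \<partial>M1)"
    by (rule 1) measurable
  also have "\<dots> = (\<integral>\<^sup>+x. (\<integral>\<^sup>+y. F (x, y) * (w1 x * w2 y) \<partial>M2) \<partial>M1)"
    by (intro nn_integral_cong, subst nn_integral_multc[symmetric]) (auto simp: mult_ac)
  also have "\<dots> = (\<integral>\<^sup>+(x, y). F (x, y) * (w1 x * w2 y) \<partial>(M1 \<Otimes>\<^sub>M M2))"
    by (subst M2.nn_integral_fst[symmetric]) auto
  finally show ?thesis .
qed

abbreviation sample_space :: "nat \<Rightarrow> (nat \<Rightarrow> real) measure" where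
  "sample_space n \<equiv> PiM {0..n} (\<lambda>_. borel)"

definition dot :: "nat \<Rightarrow> (nat \<Rightarrow> real) \<Rightarrow> (nat \<Rightarrow> real) \<Rightarrow> real" where
  "dot n u x = (\<Sum>k\<in>{0..n}. u k * x k)"

text \<open>The restriction to \<open>{0..n}\<close> keeps the result extensional, that is, inside
  the space of the product measure.\<close>

definition translate :: "nat \<Rightarrow> (nat \<Rightarrow> real) \<Rightarrow> (nat \<Rightarrow> real) \<Rightarrow> nat \<Rightarrow> real" where
  "translate n u x = (\<lambda>k\<in>{0..n}. x k + u k)"

lemma sets_noise [measurable_cong]: "sets (noise n) = sets (sample_space n)"
  unfolding noise_def by (intro sets_PiM_cong) auto

lemma prob_space_noise: "prob_space (noise n)"
  unfolding noise_def by (intro prob_space_PiM prob_std_normal)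

lemma measurable_coordinate [measurable]:
  "k \<in> {0..n} \<Longrightarrow> (\<lambda>x. x k) \<in> borel_measurable (sample_space n)"
  by (rule measurable_component_singleton)

lemma measurable_dot [measurable]: "dot n u \<in> borel_measurable (sample_space n)"
  unfolding dot_def by measurable

lemma measurable_translate [measurable]: "translate n u \<in> sample_space n \<rightarrow>\<^sub>M sample_space n"
  unfolding translate_def by measurable

lemma noise_shift:
  assumes "F \<in> borel_measurable (sample_space n)"
  shows "(\<integral>\<^sup>+x. F (translate n u x) \<partial>noise n) =
    (\<integral>\<^sup>+x. F x * ennreal (exp (dot n u x - dot n u u / 2)) \<partial>noise n)"
  using PiM_std_normal_shift[of "{0..n}" F u] assms
  unfolding noise_def translate_def dot_def
  by (simp add: sum_subtractf power2_eq_square sum_divide_distrib)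

definition noise3 :: "nat \<Rightarrow> ((nat \<Rightarrow> real) \<times> (nat \<Rightarrow> real) \<times> (nat \<Rightarrow> real)) measure" where
  "noise3 n = noise n \<Otimes>\<^sub>M (noise n \<Otimes>\<^sub>M noise n)"

lemma noise3_shift:
  assumes F: "F \<in> borel_measurable (sample_space n \<Otimes>\<^sub>M (sample_space n \<Otimes>\<^sub>M sample_space n))"
  shows "(\<integral>\<^sup>+(x, y, z). F (translate n u x, translate n v y, translate n w z) \<partial>noise3 n) =
    (\<integral>\<^sup>+(x, y, z). F (x, y, z) * ennreal (exp (dot n u x + dot n v y + dot n w z
        - (dot n u u + dot n v v + dot n w w) / 2)) \<partial>noise3 n)"
proof -
  note [measurable] = F
  have sf: "sigma_finite_measure (noise n)" "sigma_finite_measure (noise n \<Otimes>\<^sub>M noise n)"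
    by (intro prob_space_imp_sigma_finite prob_space_pair prob_space_noise)+
  define e where "e u x = ennreal (exp (dot n u x - dot n u u / 2))" for u x
  have [measurable]: "e u \<in> borel_measurable (sample_space n)" for u unfolding e_def by measurable
  have 2: "(\<integral>\<^sup>+x. G (map_prod (translate n v) (translate n w) x) \<partial>(noise n \<Otimes>\<^sub>M noise n)) =
      (\<integral>\<^sup>+x. G x * (e v (fst x) * e w (snd x)) \<partial>(noise n \<Otimes>\<^sub>M noise n))"
    if [measurable]: "G \<in> borel_measurable (noise n \<Otimes>\<^sub>M noise n)" for G
    using nn_integral_shift_pair[OF sf(1) sf(1), of "translate n v" "translate n w" "e v" "e w" G]
    by (simp add: noise_shift e_def map_prod_def split_def)
  have "(\<integral>\<^sup>+(x, y). F (translate n u x, map_prod (translate n v) (translate n w) y) \<partial>noise3 n)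
    = (\<integral>\<^sup>+(x, y). F (x, y) * (e u x * (e v (fst y) * e w (snd y))) \<partial>noise3 n)"
    unfolding noise3_def
    by (rule nn_integral_shift_pair[OF sf _ _ _ _ _ 2]) (auto simp: noise_shift e_def map_prod_def split_def)
  moreover have "e u x * (e v y * e w z) = ennreal (exp (dot n u x + dot n v y + dot n w z
        - (dot n u u + dot n v v + dot n w w) / 2))" for x y z
    unfolding e_def by (simp add: ennreal_mult'[symmetric] exp_add[symmetric] diff_divide_distrib add_divide_distrib)
  ultimately show ?thesis by (simp add: split_def map_prod_def)
qed

section \<open>The joint law of the three samples\<close>

type_synonym sample3 = "(nat \<Rightarrow> real) \<times> (nat \<Rightarrow> real) \<times> (nat \<Rightarrow> real)"

abbreviation sample_space3 :: "nat \<Rightarrow> sample3 measure" where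
  "sample_space3 n \<equiv> sample_space n \<Otimes>\<^sub>M (sample_space n \<Otimes>\<^sub>M sample_space n)"

definition grid :: "nat \<Rightarrow> (real \<Rightarrow> real) \<Rightarrow> nat \<Rightarrow> real" where
  "grid n f k = f (real k / real n)"

definition split_samples :: "nat \<Rightarrow> real \<Rightarrow> (nat \<Rightarrow> real) \<times> (nat \<Rightarrow> real) \<times> (nat \<Rightarrow> real) \<Rightarrow> sample3" where
  "split_samples n \<sigma> = (\<lambda>(y, z1, z2).
    (restrict (sample_l \<sigma> y z1 z2) {0..n}, restrict (sample_s \<sigma> y z1 z2) {0..n}, restrict (sample_e \<sigma> y z1) {0..n}))"

lemma measurable_split_samples [measurable]:
  "split_samples n \<sigma> \<in> sample_space3 n \<rightarrow>\<^sub>M sample_space3 n"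
  unfolding split_samples_def sample_l_def sample_s_def sample_e_def restrict_def[symmetric]
  by measurable

lemma measurable_observation [measurable]: "observation n \<sigma> f \<in> sample_space n \<rightarrow>\<^sub>M sample_space n"
  unfolding observation_def by measurable

definition samples :: "nat \<Rightarrow> real \<Rightarrow> (real \<Rightarrow> real) \<Rightarrow> sample3 measure" where
  "samples n \<sigma> f = distr (data n \<sigma> f \<Otimes>\<^sub>M (noise n \<Otimes>\<^sub>M noise n)) (sample_space3 n) (split_samples n \<sigma>)"

lemma sets_data [measurable_cong]: "sets (data n \<sigma> f) = sets (sample_space n)"
  unfolding data_def by simp

lemma prob_space_data: "prob_space (data n \<sigma> f)"
  unfolding data_def by (intro prob_space.prob_space_distr prob_space_noise) measurable

lemma prob_space_samples: "prob_space (samples n \<sigma> f)"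
  unfolding samples_def 
  by (intro prob_space.prob_space_distr prob_space_pair prob_space_noise prob_space_data) measurable

lemma sets_samples [measurable_cong]: "sets (samples n \<sigma> f) = sets (sample_space3 n)"
  unfolding samples_def by simp

lemma nn_integral_samples:
  assumes [measurable]: "F \<in> borel_measurable (sample_space3 n)"
  shows "(\<integral>\<^sup>+\<omega>. F \<omega> \<partial>samples n \<sigma> f) =
    (\<integral>\<^sup>+(x, y, z). F (split_samples n \<sigma> (observation n \<sigma> f x, y, z)) \<partial>noise3 n)"
proof -
  interpret P: prob_space "noise n \<Otimes>\<^sub>M noise n" by (intro prob_space_pair prob_space_noise)
  have "(\<integral>\<^sup>+\<omega>. F \<omega> \<partial>samples n \<sigma> f) = 
    (\<integral>\<^sup>+\<omega>. F (split_samples n \<sigma> \<omega>) \<partial>(data n \<sigma> f \<Otimes>\<^sub>M (noise n \<Otimes>\<^sub>M noise n)))"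
    unfolding samples_def by (subst nn_integral_distr) auto
  also have "\<dots> = (\<integral>\<^sup>+x. (\<integral>\<^sup>+y. F (split_samples n \<sigma> (x, y)) \<partial>(noise n \<Otimes>\<^sub>M noise n)) \<partial>data n \<sigma> f)"
    by (subst P.nn_integral_fst[symmetric]) auto
  also have "\<dots> = (\<integral>\<^sup>+x. (\<integral>\<^sup>+y. F (split_samples n \<sigma> (observation n \<sigma> f x, y)) \<partial>(noise n \<Otimes>\<^sub>M noise n)) \<partial>noise n)"
    unfolding data_def by (subst nn_integral_distr) auto
  also have "\<dots> = (\<integral>\<^sup>+(x, y, z). F (split_samples n \<sigma> (observation n \<sigma> f x, y, z)) \<partial>noise3 n)"
    unfolding noise3_def by (subst P.nn_integral_fst[symmetric]) (auto simp: split_def)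
  finally show ?thesis .
qed

text \<open>\<open>d\<close> is the direction of the exponential tilt. \<open>c\<close> will be the
  variance \<open>3 * \<sigma>\<^sup>2\<close>, which turns the tilt into the mean shift that it
  produces.\<close>

definition translate3 :: "nat \<Rightarrow> real \<Rightarrow> sample3 \<Rightarrow> sample3 \<Rightarrow> sample3" where
  "translate3 n c = (\<lambda>(u, v, w) (l, s, e). 
    (translate n (\<lambda>k. c * u k) l, translate n (\<lambda>k. c * v k) s, translate n (\<lambda>k. c * w k) e))"

definition dot3 :: "nat \<Rightarrow> sample3 \<Rightarrow> sample3 \<Rightarrow> real" where
  "dot3 n = (\<lambda>(u, v, w) (l, s, e). dot n u l + dot n v s + dot n w e)"

lemma measurable_translate3 [measurable]: "translate3 n c d \<in> sample_space3 n \<rightarrow>\<^sub>M sample_space3 n"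
  unfolding translate3_def by (cases d) (simp, measurable)

lemma measurable_dot3 [measurable]: "dot3 n d \<in> borel_measurable (sample_space3 n)"
  unfolding dot3_def by (cases d) (simp, measurable)

text \<open>The noises of the three samples are uncorrelated and have variance \<open>3 \<sigma>\<^sup>2\<close>, so that a
  translation of the Gaussian variables can move any one of the samples and fix the other two.\<close>

lemma samples_shift:
  assumes F[measurable]: "F \<in> borel_measurable (sample_space3 n)" and \<sigma>: "\<sigma> > 0"
  shows "(\<integral>\<^sup>+\<omega>. F (translate3 n (3 * \<sigma>\<^sup>2) d \<omega>) \<partial>samples n \<sigma> f) =
    (\<integral>\<^sup>+\<omega>. F \<omega> * ennreal (exp (dot3 n d \<omega> - dot3 n d (grid n f, grid n f, grid n f) - 3 * \<sigma>\<^sup>2 / 2 * dot3 n d d)) \<partial>samples n \<sigma> f)"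
proof -
  obtain u v w where d: "d = (u, v, w)" by (cases d)
  define \<Lambda> where "\<Lambda> = (\<lambda>(x, y, z). split_samples n \<sigma> (observation n \<sigma> f x, y, z))"
  have [measurable]: "\<Lambda> \<in> sample_space3 n \<rightarrow>\<^sub>M sample_space3 n" unfolding \<Lambda>_def by measurable
  \<comment> \<open>The samples are the mean plus \<sigma> times a matrix with rows (1, sqrt 2 / 2,
    sqrt 6 / 2), (1, sqrt 2 / 2, - sqrt 6 / 2), (1, - sqrt 2, 0) applied to the noises; the rows are
    orthogonal and have squared length 3. The transposed matrix applied to \<open>d\<close>, times
    \<sigma>, is therefore the noise shift that moves the samples by
    \<open>3 * \<sigma>\<^sup>2\<close> times \<open>d\<close>.\<close>
  define u' where "u' k = \<sigma> * (u k + v k + w k)" for k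
  define v' where "v' k = \<sigma> * (sqrt 2 / 2 * u k + sqrt 2 / 2 * v k - sqrt 2 * w k)" for k
  define w' where "w' k = \<sigma> * (sqrt 6 / 2 * u k - sqrt 6 / 2 * v k)" for k
  have tr: "translate3 n (3 * \<sigma>\<^sup>2) d (\<Lambda> (x, y, z)) = \<Lambda> (translate n u' x, translate n v' y, translate n w' z)" for x y z
    by (auto simp: translate3_def d \<Lambda>_def translate_def split_samples_def sample_l_def sample_s_def
       sample_e_def observation_def u'_def v'_def w'_def fun_eq_iff algebra_simps power2_eq_square)
  have ex: "dot n u' x + dot n v' y + dot n w' z - (dot n u' u' + dot n v' v' + dot n w' w') / 2 =
    dot3 n d (\<Lambda> (x, y, z)) - dot3 n d (grid n f, grid n f, grid n f) - 3 * \<sigma>\<^sup>2 / 2 * dot3 n d d" for x y z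
  proof -
    have "dot n u' x + dot n v' y + dot n w' z = dot3 n d (\<Lambda> (x, y, z)) - dot3 n d (grid n f, grid n f, grid n f)"
      unfolding dot3_def d \<Lambda>_def split_samples_def dot_def prod.case
      by (simp only: sum.distrib[symmetric] sum_subtractf[symmetric])
         (intro sum.cong refl, simp add: u'_def v'_def w'_def grid_def sample_l_def sample_s_def sample_e_def observation_def algebra_simps)
    moreover have "dot n u' u' + dot n v' v' + dot n w' w' = 3 * \<sigma>\<^sup>2 * dot3 n d d"
      unfolding dot3_def d dot_def prod.case
      by (simp only: sum.distrib[symmetric] sum_distrib_left)
         (intro sum.cong refl, simp add: u'_def v'_def w'_def algebra_simps power2_eq_square)
    ultimately show ?thesis by simp
  qed
  have "(\<integral>\<^sup>+\<omega>. F (translate3 n (3 * \<sigma>\<^sup>2) d \<omega>) \<partial>samples n \<sigma> f) = 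
      (\<integral>\<^sup>+(x, y, z). F (\<Lambda> (translate n u' x, translate n v' y, translate n w' z)) \<partial>noise3 n)"
    by (subst nn_integral_samples)
      (auto simp: tr[unfolded \<Lambda>_def prod.case] \<Lambda>_def split_def intro!: nn_integral_cong)
  also have "\<dots> = (\<integral>\<^sup>+(x, y, z). F (\<Lambda> (x, y, z)) * ennreal (exp (dot3 n d (\<Lambda> (x, y, z)) - dot3 n d (grid n f, grid n f, grid n f) - 3 * \<sigma>\<^sup>2 / 2 * dot3 n d d)) \<partial>noise3 n)"
    by (subst noise3_shift[where F="\<lambda>x. F (\<Lambda> x)"]) (auto simp: ex)
  also have "\<dots> = (\<integral>\<^sup>+\<omega>. F \<omega> * ennreal (exp (dot3 n d \<omega> - dot3 n d (grid n f, grid n f, grid n f) - 3 * \<sigma>\<^sup>2 / 2 * dot3 n d d)) \<partial>samples n \<sigma> f)"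
    by (subst nn_integral_samples) (auto simp: \<Lambda>_def split_def)
  finally show ?thesis .
qed

section \<open>A lower bound for the benchmark\<close>

lemma conv_fun_minimizer:
  assumes "f \<in> conv_fun"
  shows "minimizer f \<in> {0..1}" and "t \<in> {0..1} \<Longrightarrow> min_value f \<le> f t"
proof -
  obtain t0 where "is_arg_min f (\<lambda>t. t \<in> {0..1}) t0"
    using assms unfolding conv_fun_def by auto
  then have "is_arg_min f (\<lambda>t. t \<in> {0..1}) (minimizer f)"
    unfolding minimizer_def arg_min_on_def arg_min_def by (rule someI)
  then show "minimizer f \<in> {0..1}" and "t \<in> {0..1} \<Longrightarrow> min_value f \<le> f t"
    unfolding is_arg_min_def min_value_def by (auto simp: not_less)
qed

text \<open>This is the alternative in the lower bound. Truncating \<open>f\<close> from below by a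
  constant would create a flat bottom; the slope \<open>u / 2\<close> of the cone makes the
  minimizer unique again, and on the unit interval the cone stays below
  \<open>min_value f + u\<close>.\<close>

lemma conv_fun_raise:
  assumes f: "f \<in> conv_fun" and u: "u > 0"
  defines "g \<equiv> \<lambda>t. max (f t) (min_value f + u / 2 + u / 2 * \<bar>t - minimizer f\<bar>)"
  shows "g \<in> conv_fun" and "min_value g = min_value f + u / 2"
proof -
  let ?t = "minimizer f"
  have conv: "convex_on {0..1} f" using f by (simp add: conv_fun_def)
  have "convex_on {0..1} (\<lambda>t. min_value f + u / 2 + u / 2 * \<bar>t - ?t\<bar>)"
  proof (rule convex_onI)
    fix t x y :: real assume t: "0 < t" "t < 1"
    have "(1 - t) * x + t * y - ?t = (1 - t) * (x - ?t) + t * (y - ?t)" by (simp add: algebra_simps)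
    then have "\<bar>(1 - t) * x + t * y - ?t\<bar> \<le> \<bar>(1 - t) * (x - ?t)\<bar> + \<bar>t * (y - ?t)\<bar>" 
      by (metis abs_triangle_ineq)
    also have "\<dots> = (1 - t) * \<bar>x - ?t\<bar> + t * \<bar>y - ?t\<bar>" using t by (simp add: abs_mult)
    finally have "u / 2 * \<bar>(1 - t) * x + t * y - ?t\<bar> \<le> u / 2 * ((1 - t) * \<bar>x - ?t\<bar> + t * \<bar>y - ?t\<bar>)"
      using u by (intro mult_left_mono) auto
    moreover
    have aux: "(1 - t) * (p + q * X) + t * (p + q * Y) = p + q * ((1 - t) * X + t * Y)" for p q X Y :: real
      by (simp add: algebra_simps)
    have "(1 - t) * (min_value f + u / 2 + u / 2 * \<bar>x - ?t\<bar>) + t * (min_value f + u / 2 + u / 2 * \<bar>y - ?t\<bar>)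
       = min_value f + u / 2 + u / 2 * ((1 - t) * \<bar>x - ?t\<bar> + t * \<bar>y - ?t\<bar>)"
      by (rule aux)
    ultimately show "min_value f + u / 2 + u / 2 * \<bar>(1 - t) *\<^sub>R x + t *\<^sub>R y - ?t\<bar>
       \<le> (1 - t) * (min_value f + u / 2 + u / 2 * \<bar>x - ?t\<bar>) + t * (min_value f + u / 2 + u / 2 * \<bar>y - ?t\<bar>)"
      by simp
  qed simp
  with conv have "convex_on {0..1} g"
  proof (intro convex_onI)
    fix t x y :: real assume t: "0 < t" "t < 1" and xy: "x \<in> {0..1}" "y \<in> {0..1}"
    let ?h = "\<lambda>t. min_value f + u / 2 + u / 2 * \<bar>t - ?t\<bar>"
    assume h: "convex_on {0..1} ?h"
    have "(1 - t) * f x + t * f y \<le> (1 - t) * g x + t * g y"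
      "(1 - t) * ?h x + t * ?h y \<le> (1 - t) * g x + t * g y"
      using t unfolding g_def by (auto intro!: add_mono mult_left_mono simp del: max_less_iff_conj)
    then show "g ((1 - t) *\<^sub>R x + t *\<^sub>R y) \<le> (1 - t) * g x + t * g y"
      using convex_onD[OF conv, of t x y] convex_onD[OF h, of t x y] t xy by (simp add: g_def)
  qed simp
  moreover have t: "?t \<in> {0..1}" and le: "\<And>t. t \<in> {0..1} \<Longrightarrow> min_value f \<le> f t"
    using conv_fun_minimizer[OF f] by auto
  have g_min: "g ?t = min_value f + u / 2" using u by (simp add: g_def min_value_def)
  have g_gt: "g x > g ?t" if "x \<noteq> ?t" for x
    using that u unfolding g_min by (simp add: g_def less_max_iff_disj)
  have uniq: "is_arg_min g (\<lambda>t. t \<in> {0..1}) x \<longleftrightarrow> x = ?t" for x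
    unfolding is_arg_min_def using t g_gt by (metis less_asym)
  have "\<exists>!t. is_arg_min g (\<lambda>t. t \<in> {0..1}) t" unfolding uniq by simp
  ultimately show "g \<in> conv_fun" unfolding conv_fun_def by blast
  have "minimizer g = ?t"
    unfolding minimizer_def arg_min_on_def arg_min_def uniq by simp
  then show "min_value g = min_value f + u / 2" using g_min by (simp add: min_value_def)
qed

text \<open>The integral is the overlap of two Gaussian laws at distance at most one. The likelihood
  ratio has mean 1 and second moment \<open>exp (dot n u u)\<close>, which is at most 3; this leaves
  \<open>1 - 3 / 4\<close>.\<close>

lemma noise_affinity:
  assumes "dot n u u \<le> 1"
  shows "1 / 4 \<le> (\<integral>\<^sup>+x. ennreal (min 1 (exp (dot n u x - dot n u u / 2))) \<partial>noise n)"
proof -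
  interpret N: prob_space "noise n" by (rule prob_space_noise)
  define r where "r x = exp (dot n u x - dot n u u / 2)" for x
  have [measurable]: "r \<in> borel_measurable (sample_space n)" unfolding r_def by measurable
  have int1: "(\<integral>\<^sup>+x. ennreal (r x) \<partial>noise n) = 1"
    using noise_shift[of "\<lambda>_. 1" n u] by (simp add: r_def N.emeasure_space_1)
  have d2: "dot n (\<lambda>k. 2 * u k) x = 2 * dot n u x" for x
    by (simp add: dot_def sum_distrib_left mult_ac)
  have dd: "dot n (\<lambda>k. 2 * u k) (\<lambda>k. 2 * u k) = 4 * dot n u u"
    by (simp add: dot_def sum_distrib_left mult_ac)
  have "1 = (\<integral>\<^sup>+x. ennreal (exp (dot n (\<lambda>k. 2 * u k) x - 2 * dot n u u)) \<partial>noise n)"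
    using noise_shift[of "\<lambda>_. 1" n "\<lambda>k. 2 * u k"] 
    by (simp add: dd N.emeasure_space_1)
  then have "ennreal (exp (dot n u u)) = ennreal (exp (dot n u u)) *
     (\<integral>\<^sup>+x. ennreal (exp (dot n (\<lambda>k. 2 * u k) x - 2 * dot n u u)) \<partial>noise n)"
    by simp
  also have "\<dots> = (\<integral>\<^sup>+x. ennreal ((r x)\<^sup>2) \<partial>noise n)"
    by (subst nn_integral_cmult[symmetric])
       (auto simp: ennreal_mult'[symmetric] r_def exp_add[symmetric] exp_double[symmetric] d2 intro!: nn_integral_cong)
  finally have "(\<integral>\<^sup>+x. ennreal ((r x)\<^sup>2) \<partial>noise n) = ennreal (exp (dot n u u))" ..
  also have "\<dots> \<le> ennreal (exp 1)" using assms by (intro ennreal_leI) simp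
  also have "\<dots> \<le> ennreal 3" using exp_le by (intro ennreal_leI) simp
  finally have sq: "(\<integral>\<^sup>+x. ennreal ((r x)\<^sup>2) \<partial>noise n) \<le> ennreal 3" .
  \<comment> \<open>Only the first two moments of the likelihood ratio are needed, since \<open>min 1 r \<ge> r - r\<^sup>2 / 4\<close>.\<close>
  have pw: "r x \<le> min 1 (r x) + 1 / 4 * (r x)\<^sup>2" for x
  proof -
    have "0 \<le> (r x / 2 - 1)\<^sup>2" by simp
    then show ?thesis by (simp add: power2_eq_square field_simps min_def)
  qed
  have "1 = (\<integral>\<^sup>+x. ennreal (r x) \<partial>noise n)" using int1 by simp
  also have "\<dots> \<le> (\<integral>\<^sup>+x. ennreal (min 1 (r x)) + ennreal (1 / 4) * ennreal ((r x)\<^sup>2) \<partial>noise n)"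
    using pw by (intro nn_integral_mono) (simp add: ennreal_mult'[symmetric] ennreal_plus[symmetric] r_def ennreal_leI del: ennreal_plus)
  also have "\<dots> = (\<integral>\<^sup>+x. ennreal (min 1 (r x)) \<partial>noise n) + ennreal (1 / 4) * (\<integral>\<^sup>+x. ennreal ((r x)\<^sup>2) \<partial>noise n)"
    by (subst nn_integral_add) (auto simp: nn_integral_cmult)
  also have "\<dots> \<le> (\<integral>\<^sup>+x. ennreal (min 1 (r x)) \<partial>noise n) + ennreal (1 / 4) * ennreal 3"
    using sq by (intro add_left_mono mult_left_mono) auto
  also have "ennreal (1 / 4) * ennreal 3 = ennreal (3 / 4)" by (subst ennreal_mult[symmetric]) auto
  finally have *: "ennreal 1 \<le> (\<integral>\<^sup>+x. ennreal (min 1 (r x)) \<partial>noise n) + ennreal (3 / 4)" by simp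
  show ?thesis
  proof (cases "(\<integral>\<^sup>+x. ennreal (min 1 (r x)) \<partial>noise n)")
    case (real v)
    with * have "1 \<le> v + 3 / 4" by (simp add: ennreal_plus[symmetric] del: ennreal_plus ennreal_1)
    then have "ennreal (1 / 4) \<le> ennreal v" by (intro ennreal_leI) simp
    moreover have "ennreal (1 / 4) = 1 / 4" by (simp add: divide_ennreal[symmetric])
    ultimately show ?thesis using real by (simp add: r_def)
  qed (simp add: r_def)
qed

text \<open>Le Cam's two-point argument: at the same data the two losses sum to at least the
  distance of the minimum values, a quarter of the mass is common to both laws, and the maximum is
  at least half the sum.\<close>

lemma two_point_risk:
  assumes \<sigma>: "\<sigma> > 0" and \<delta>: "\<delta> \<in> estimators n"
    and close: "(\<Sum>k\<in>{0..n}. (grid n g k - grid n f k)\<^sup>2) \<le> \<sigma>\<^sup>2"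
  shows "ennreal (\<bar>min_value g - min_value f\<bar> / 8) \<le> max (risk n \<sigma> \<delta> f) (risk n \<sigma> \<delta> g)"
proof -
  define A where "A h y = (\<integral>\<^sup>+ a. ennreal \<bar>a - min_value h\<bar> \<partial>\<delta> y)" for h y
  define u where "u k = (grid n g k - grid n f k) / \<sigma>" for k
  define r where "r x = exp (dot n u x - dot n u u / 2)" for x
  have [measurable]: "r \<in> borel_measurable (sample_space n)" unfolding r_def by measurable
  have \<delta>'[measurable]: "\<delta> \<in> sample_space n \<rightarrow>\<^sub>M prob_algebra borel" using \<delta> by (simp add: estimators_def)
  have [measurable]: "\<delta> \<in> sample_space n \<rightarrow>\<^sub>M subprob_algebra borel" by (rule measurable_prob_algebraD[OF \<delta>'])
  have [measurable]: "A h \<in> borel_measurable (sample_space n)" for h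
    unfolding A_def by (rule nn_integral_measurable_subprob_algebra2[where N=borel]) auto
  have uu: "dot n u u \<le> 1"
  proof -
    have "dot n u u = (\<Sum>k\<in>{0..n}. (grid n g k - grid n f k)\<^sup>2) / \<sigma>\<^sup>2"
      unfolding dot_def u_def by (simp add: sum_divide_distrib power2_eq_square)
    then show ?thesis using close \<sigma> by simp
  qed
  have risk: "risk n \<sigma> \<delta> h = (\<integral>\<^sup>+x. A h (observation n \<sigma> h x) \<partial>noise n)" for h
    unfolding risk_def A_def[symmetric] data_def by (subst nn_integral_distr) auto
  have obs: "observation n \<sigma> g x = observation n \<sigma> f (translate n u x)" for x
    using \<sigma> by (auto simp: observation_def translate_def u_def grid_def field_simps)
  have rg: "risk n \<sigma> \<delta> g = (\<integral>\<^sup>+x. A g (observation n \<sigma> f x) * ennreal (r x) \<partial>noise n)"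
    unfolding risk obs r_def by (rule noise_shift) measurable
  have sumA: "ennreal \<bar>min_value g - min_value f\<bar> \<le> A f y + A g y" if y: "y \<in> space (sample_space n)" for y
  proof -
    have "\<delta> y \<in> space (prob_algebra borel)" using measurable_space[OF \<delta>' y] .
    then have p: "prob_space (\<delta> y)" and "sets (\<delta> y) = sets borel"
      by (auto simp: space_prob_algebra)
    interpret prob_space "\<delta> y" by fact
    have meas: "(\<lambda>a. ennreal \<bar>a - c\<bar>) \<in> borel_measurable (\<delta> y)" for c
      by (subst measurable_cong_sets[OF \<open>sets (\<delta> y) = sets borel\<close> refl]) measurable
    have "ennreal \<bar>min_value g - min_value f\<bar> = (\<integral>\<^sup>+a. ennreal \<bar>min_value g - min_value f\<bar> \<partial>\<delta> y)"
      by (simp add: emeasure_space_1)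
    also have "\<dots> \<le> (\<integral>\<^sup>+a. ennreal \<bar>a - min_value f\<bar> + ennreal \<bar>a - min_value g\<bar> \<partial>\<delta> y)"
      by (intro nn_integral_mono) (simp add: ennreal_plus[symmetric] ennreal_leI del: ennreal_plus)
    also have "\<dots> = A f y + A g y" unfolding A_def by (rule nn_integral_add; rule meas)
    finally show ?thesis .
  qed
  have pw: "ennreal \<bar>min_value g - min_value f\<bar> * ennreal (min 1 (r x)) \<le>
     A f (observation n \<sigma> f x) + A g (observation n \<sigma> f x) * ennreal (r x)" if x: "x \<in> space (noise n)" for x
  proof -
    let ?y = "observation n \<sigma> f x"
    have "?y \<in> space (sample_space n)" by (auto simp: observation_def space_PiM)
    from sumA[OF this] have "ennreal \<bar>min_value g - min_value f\<bar> * ennreal (min 1 (r x)) \<le> (A f ?y + A g ?y) * ennreal (min 1 (r x))"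
      by (rule mult_right_mono) simp
    also have "\<dots> = A f ?y * ennreal (min 1 (r x)) + A g ?y * ennreal (min 1 (r x))" by (simp add: distrib_right)
    also have "\<dots> \<le> A f ?y * 1 + A g ?y * ennreal (r x)"
      by (intro add_mono mult_left_mono) (auto intro!: ennreal_leI)
    finally show ?thesis by simp
  qed
  have "ennreal \<bar>min_value g - min_value f\<bar> * (1 / 4) \<le> ennreal \<bar>min_value g - min_value f\<bar> * 
     (\<integral>\<^sup>+x. ennreal (min 1 (r x)) \<partial>noise n)"
    using noise_affinity[OF uu] unfolding r_def by (intro mult_left_mono) auto
  also have "\<dots> = (\<integral>\<^sup>+x. ennreal \<bar>min_value g - min_value f\<bar> * ennreal (min 1 (r x)) \<partial>noise n)"
    by (subst nn_integral_cmult) auto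
  also have "\<dots> \<le> (\<integral>\<^sup>+x. A f (observation n \<sigma> f x) + A g (observation n \<sigma> f x) * ennreal (r x) \<partial>noise n)"
    by (rule nn_integral_mono) (rule pw)
  also have "\<dots> = risk n \<sigma> \<delta> f + risk n \<sigma> \<delta> g"
    unfolding rg by (subst nn_integral_add) (auto simp: risk)
  also have "\<dots> \<le> 2 * max (risk n \<sigma> \<delta> f) (risk n \<sigma> \<delta> g)"
    unfolding mult_2 by (intro add_mono) auto
  finally have le: "ennreal \<bar>min_value g - min_value f\<bar> * (1 / 4) \<le> 2 * max (risk n \<sigma> \<delta> f) (risk n \<sigma> \<delta> g)" .
  have eq: "ennreal \<bar>min_value g - min_value f\<bar> * (1 / 4) = ennreal (\<bar>min_value g - min_value f\<bar> / 4)"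
    by (simp add: ennreal_times_divide divide_ennreal[symmetric])
  show ?thesis
  proof (cases "max (risk n \<sigma> \<delta> f) (risk n \<sigma> \<delta> g)")
    case (real v)
    with le eq have "ennreal (\<bar>min_value g - min_value f\<bar> / 4) \<le> ennreal (2 * v)" by (simp add: ennreal_mult')
    then have "\<bar>min_value g - min_value f\<bar> / 4 \<le> 2 * v" using real by simp
    then show ?thesis unfolding real using real by (intro ennreal_leI) simp
  qed simp
qed

text \<open>The raised function lifts a grid value at most to height \<open>min_value f + u\<close>,
  so the sum bounds its squared distance from \<open>f\<close> on the grid. The minimum moves by
  \<open>u / 2\<close>, and the two-point bound costs another factor 8.\<close>

lemma benchmark_lower:
  assumes f: "f \<in> conv_fun" and "n \<ge> 1" and \<sigma>: "\<sigma> > 0" and u: "u > 0"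
    and small: "(\<Sum>k\<in>{0..n}. (max 0 (min_value f + u - grid n f k))\<^sup>2) \<le> \<sigma>\<^sup>2"
  shows "ennreal (u / 16) \<le> benchmark n \<sigma> f"
proof -
  define g where "g t = max (f t) (min_value f + u / 2 + u / 2 * \<bar>t - minimizer f\<bar>)" for t
  have g: "g \<in> conv_fun" "min_value g = min_value f + u / 2"
    using conv_fun_raise[OF f u] by (simp_all add: g_def[abs_def])
  have "(\<Sum>k\<in>{0..n}. (grid n g k - grid n f k)\<^sup>2) \<le> (\<Sum>k\<in>{0..n}. (max 0 (min_value f + u - grid n f k))\<^sup>2)"
  proof (intro sum_mono power_mono)
    fix k assume k: "k \<in> {0..n}"
    have "\<bar>real k / real n - minimizer f\<bar> \<le> 1" 
    proof -
      have "0 \<le> real k / real n" "real k / real n \<le> 1" using k \<open>n \<ge> 1\<close> by auto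
      then show ?thesis using conv_fun_minimizer(1)[OF f] unfolding abs_le_iff atLeastAtMost_iff by linarith
    qed
    then have "u / 2 * \<bar>real k / real n - minimizer f\<bar> \<le> u / 2" using u by (simp add: mult_left_le)
    then show "grid n g k - grid n f k \<le> max 0 (min_value f + u - grid n f k)"
      unfolding grid_def g_def by (simp add: max_def)
    show "0 \<le> grid n g k - grid n f k" unfolding grid_def g_def by simp
  qed
  with small have "(\<Sum>k\<in>{0..n}. (grid n g k - grid n f k)\<^sup>2) \<le> \<sigma>\<^sup>2" by simp
  then have "ennreal (u / 16) \<le> max (risk n \<sigma> \<delta> f) (risk n \<sigma> \<delta> g)" if "\<delta> \<in> estimators n" for \<delta>
    using two_point_risk[OF \<sigma> that, of g f] g(2) u by simp
  then have "ennreal (u / 16) \<le> (INF \<delta>\<in>estimators n. max (risk n \<sigma> \<delta> f) (risk n \<sigma> \<delta> g))"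
    by (intro INF_greatest)
  also have "\<dots> \<le> benchmark n \<sigma> f" unfolding benchmark_def using g(1) by (intro SUP_upper)
  finally show ?thesis .
qed

section \<open>Block means of a convex sequence\<close>

definition len :: "nat \<Rightarrow> nat \<Rightarrow> int" where
  "len n j = 2 ^ (finest n - j)"

definition valid :: "nat \<Rightarrow> nat \<Rightarrow> int \<Rightarrow> bool" where
  "valid n j i \<longleftrightarrow> 1 \<le> i \<and> i * len n j \<le> int n + 1"

text \<open>An indicator vector, so that block sums are inner products and Gaussian translations
  apply to them. A block that sticks out of the sample is cut off here, whereas
  \<open>block_sum\<close> makes it infinite.\<close>

definition block :: "nat \<Rightarrow> nat \<Rightarrow> int \<Rightarrow> nat \<Rightarrow> real" where
  "block n j i k = of_bool ((i - 1) * len n j \<le> int k \<and> int k < i * len n j)"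

abbreviation block_total :: "nat \<Rightarrow> (nat \<Rightarrow> real) \<Rightarrow> nat \<Rightarrow> int \<Rightarrow> real" where
  "block_total n v j i \<equiv> dot n (block n j i) v"

definition block_mean :: "nat \<Rightarrow> (nat \<Rightarrow> real) \<Rightarrow> nat \<Rightarrow> int \<Rightarrow> real" where
  "block_mean n v j i = block_total n v j i / real_of_int (len n j)"

lemma len_pos [simp]: "len n j > 0"
  by (simp add: len_def)

lemma len_ge1 [simp]: "len n j \<ge> 1"
  using len_pos[of n j] by linarith

lemma len_nonneg [simp]: "0 \<le> len n j" and len_nonzero [simp]: "len n j \<noteq> 0"
  using len_pos[of n j] by linarith+

lemma len_Suc: "j < finest n \<Longrightarrow> len n j = 2 * len n (Suc j)"
  unfolding len_def by (subst power_Suc[symmetric]) (simp add: Suc_diff_Suc)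

lemma len_finest [simp]: "len n (finest n) = 1"
  by (simp add: len_def)

lemma le_block_count_iff: "i \<le> block_count n j \<longleftrightarrow> i * len n j \<le> int n + 1"
proof -
  have "i \<le> block_count n j \<longleftrightarrow> real_of_int i \<le> real (n + 1) / 2 ^ (finest n - j)"
    unfolding block_count_def by (rule le_floor_iff)
  also have "\<dots> \<longleftrightarrow> real_of_int i * 2 ^ (finest n - j) \<le> real (n + 1)"
    by (simp add: pos_le_divide_eq)
  also have "\<dots> \<longleftrightarrow> real_of_int (i * len n j) \<le> real_of_int (int n + 1)"
    by (simp add: len_def add.commute)
  finally show ?thesis by (simp only: of_int_le_iff)
qed

lemma valid_iff: "valid n j i \<longleftrightarrow> 1 \<le> i \<and> i \<le> block_count n j"
  by (simp add: valid_def le_block_count_iff)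

lemma finest_bounds: "2 ^ finest n \<le> n + 1" "n + 1 < 2 * 2 ^ finest n"
proof -
  let ?x = "real (n + 1)"
  have x: "?x \<ge> 1" by simp
  have nn: "\<lfloor>log 2 ?x\<rfloor> \<ge> 0" using x by (simp add: zero_le_log_cancel_iff)
  have f: "real (finest n) = of_int \<lfloor>log 2 ?x\<rfloor>" unfolding finest_def using nn by simp
  have "2 powr real (finest n) \<le> ?x"
    using f by (subst le_log_iff[symmetric]) auto
  then have "real (2 ^ finest n) \<le> real (n + 1)" by (simp add: powr_realpow)
  then show "2 ^ finest n \<le> n + 1" by (simp only: of_nat_le_iff)
  have "?x < 2 powr (real (finest n) + 1)"
    using f by (subst log_less_iff[symmetric]) auto
  then have "real (n + 1) < real (2 * 2 ^ finest n)" by (simp add: powr_add powr_realpow)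
  then show "n + 1 < 2 * 2 ^ finest n" by (simp only: of_nat_less_iff)
qed

text \<open>So level 0 has exactly one complete block, with index 1.\<close>

lemma len_0_bounds: "len n 0 \<le> int n + 1" "int n + 1 < 2 * len n 0"
proof -
  have "int (2 ^ finest n) \<le> int (n + 1)" "int (n + 1) < int (2 * 2 ^ finest n)"
    using finest_bounds[of n] by (simp_all only: of_nat_le_iff of_nat_less_iff)
  then show "len n 0 \<le> int n + 1" "int n + 1 < 2 * len n 0" by (simp_all add: len_def add.commute)
qed

lemma block_total_valid:
  assumes "valid n j i"
  shows "block_total n v j i = (\<Sum>k = (i - 1) * len n j..i * len n j - 1. v (nat k))"
proof -
  have "block_total n v j i = (\<Sum>k\<in>{0..n}. if (i - 1) * len n j \<le> int k \<and> int k < i * len n j then v k else 0)"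
    unfolding dot_def block_def by (intro sum.cong) auto
  also have "\<dots> = (\<Sum>k\<in>{k\<in>{0..n}. (i - 1) * len n j \<le> int k \<and> int k < i * len n j}. v k)"
    by (rule sum.inter_filter[symmetric]) simp
  also have "\<dots> = (\<Sum>k = (i - 1) * len n j..i * len n j - 1. v (nat k))"
  proof (rule sum.reindex_bij_witness[where i=nat and j=int])
    fix k assume k: "k \<in> {(i - 1) * len n j..i * len n j - 1}"
    have "0 \<le> (i - 1) * len n j" using assms by (intro mult_nonneg_nonneg) (auto simp: valid_def less_imp_le)
    with k show "int (nat k) = k" by auto
    moreover have "i * len n j \<le> int n + 1" using assms by (simp add: valid_def)
    ultimately show "nat k \<in> {k\<in>{0..n}. (i - 1) * len n j \<le> int k \<and> int k < i * len n j}"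
      using k by auto
  qed auto
  finally show ?thesis .
qed

lemma block_sum_valid:
  assumes "valid n j i"
  shows "block_sum n v j i = ereal (block_total n v j i)"
proof -
  have "0 \<le> (i - 1) * len n j" using assms by (intro mult_nonneg_nonneg) (auto simp: valid_def less_imp_le)
  moreover have "i * len n j \<le> int n + 1" using assms by (simp add: valid_def)
  ultimately have "extended n v k = ereal (v (nat k))" if "k \<in> {(i - 1) * len n j..i * len n j - 1}" for k
    using that unfolding extended_def by auto
  then show ?thesis
    unfolding block_sum_def block_total_valid[OF assms] by (simp add: len_def)
qed

lemma block_sum_invalid:
  assumes "\<not> valid n j i"
  shows "block_sum n v j i = \<infinity>"
proof -
  let ?A = "{(i - 1) * len n j..i * len n j - 1}"
  have ne: "(i - 1) * len n j \<le> i * len n j - 1" by (simp add: algebra_simps)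
  have "\<exists>k\<in>?A. k \<notin> {0..int n}"
  proof (cases "1 \<le> i")
    case True
    with assms have "i * len n j - 1 > int n" by (simp add: valid_def)
    then show ?thesis using ne by (intro bexI[of _ "i * len n j - 1"]) auto
  next
    case False
    then have "(i - 1) * len n j < 0" by (intro mult_neg_pos) auto
    then show ?thesis using ne by (intro bexI[of _ "(i - 1) * len n j"]) auto
  qed
  then have "\<exists>k\<in>?A. extended n v k = \<infinity>" by (auto simp: extended_def)
  then show ?thesis unfolding block_sum_def len_def[symmetric] by (subst sum_Pinfty) auto
qed

text \<open>Holds for cut-off blocks as well. This matters because the noise is later followed
  through neighbours of the path, which may be incomplete.\<close>

lemma block_total_split:
  assumes "j < finest n"
  shows "block_total n v j i = block_total n v (Suc j) (2 * i - 1) + block_total n v (Suc j) (2 * i)"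
proof -
  have "block n j i k = block n (Suc j) (2 * i - 1) k + block n (Suc j) (2 * i) k" for k
    unfolding block_def len_Suc[OF assms] using len_pos[of n "Suc j"]
    by (auto simp: of_bool_def algebra_simps)
  then show ?thesis by (simp add: dot_def distrib_right sum.distrib)
qed

section \<open>Slopes of a convex sequence, pointwise and averaged over blocks\<close>

lemma sum_block_shift:
  fixes \<alpha> :: "int \<Rightarrow> real" and L :: int
  shows "(\<Sum>k = (i + t - 1) * L..(i + t) * L - 1. \<alpha> k) = (\<Sum>k = (i - 1) * L..i * L - 1. \<alpha> (k + t * L))"
  by (rule sum.reindex_bij_witness[where i="\<lambda>k. k + t * L" and j="\<lambda>k. k - t * L"])
     (auto simp: algebra_simps)

text \<open>Increasing chord slopes, multiplied out so that no division occurs. \<open>c\<close> is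
  an integer because it is compared with block boundaries, which may be negative.\<close>

locale convex_sequence =
  fixes n :: nat and a :: "nat \<Rightarrow> real" and c :: int
  assumes slopes: "\<And>p q r s. p < q \<Longrightarrow> r < s \<Longrightarrow> p \<le> r \<Longrightarrow> q \<le> s \<Longrightarrow> s \<le> n \<Longrightarrow>
      (a q - a p) * (real s - real r) \<le> (a s - a r) * (real q - real p)"
    and c: "c \<in> {0..int n}"
    and least: "\<And>k. k \<le> n \<Longrightarrow> a (nat c) \<le> a k"
begin

abbreviation "\<alpha> k \<equiv> a (nat k)"
abbreviation "b j i \<equiv> block_mean n a j i"
abbreviation "cells j i \<equiv> {(i - 1) * len n j..i * len n j - 1}"

lemma int_slopes:
  assumes "p < q" "r < s" "p \<le> r" "q \<le> s" "0 \<le> p" "s \<le> int n"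
  shows "(\<alpha> q - \<alpha> p) * of_int (s - r) \<le> (\<alpha> s - \<alpha> r) * of_int (q - p)"
  using slopes[of "nat p" "nat q" "nat r" "nat s"] assms by (simp add: nat_less_eq_zless nat_le_eq_zle)

text \<open>The sign \<open>s\<close> treats both sides of the minimum at once. The chord from
  \<open>c\<close> to \<open>x\<close> is no steeper than a chord of length \<open>d\<close>
  starting at a point \<open>y\<close> further out. Monotonicity outwards is the case
  \<open>x = y\<close>, except at \<open>y = c\<close>, where the first chord degenerates and
  minimality of \<open>c\<close> takes its place.\<close>

lemma growth:
  assumes s: "s = 1 \<or> s = -1" and "x \<in> {0..int n}" "y \<in> {0..int n}" "y + s * d \<in> {0..int n}"
    and "0 \<le> s * (x - c)" "s * (x - c) \<le> s * (y - c)" and d: "d \<ge> 1"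
  shows "(\<alpha> x - \<alpha> c) * of_int d \<le> of_int (s * (x - c)) * (\<alpha> (y + s * d) - \<alpha> y)"
    and "\<alpha> y \<le> \<alpha> (y + s * d)"
proof -
  have *: "(\<alpha> z - \<alpha> c) * of_int d \<le> of_int (s * (z - c)) * (\<alpha> (y + s * d) - \<alpha> y)"
    if "z \<in> {0..int n}" "0 \<le> s * (z - c)" "s * (z - c) \<le> s * (y - c)" for z
  proof (cases "z = c")
    case False
    from s show ?thesis
    proof
      assume "s = 1"
      then show ?thesis using int_slopes[of c z y "y + d"] False that assms c
        by (simp add: mult.commute)
    next
      assume "s = -1"
      then show ?thesis using int_slopes[of "y - d" y z c] False that assms c
        by (simp add: algebra_simps)
    qed
  qed simp
  show "(\<alpha> x - \<alpha> c) * of_int d \<le> of_int (s * (x - c)) * (\<alpha> (y + s * d) - \<alpha> y)"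
    using assms by (intro *) auto
  show "\<alpha> y \<le> \<alpha> (y + s * d)"
  proof (cases "y = c")
    case True
    then show ?thesis using least[of "nat (y + s * d)"] assms by auto
  next
    case False
    have "0 \<le> (\<alpha> y - \<alpha> c) * of_int d" using least[of "nat y"] assms by auto
    also have "\<dots> \<le> of_int (s * (y - c)) * (\<alpha> (y + s * d) - \<alpha> y)" using assms by (intro *) auto
    finally have "0 \<le> of_int (s * (y - c)) * (\<alpha> (y + s * d) - \<alpha> y)" .
    moreover have "s * (y - c) > 0" using False assms s by auto
    then have "real_of_int (s * (y - c)) > 0" by (simp only: of_int_0_less_iff)
    ultimately show ?thesis by (simp add: zero_le_mult_iff)
  qed
qed

lemma equal_steps:
  assumes s: "s = 1 \<or> s = -1" and "x \<in> {0..int n}" "x + s * d \<in> {0..int n}"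
    "y \<in> {0..int n}" "y + s * d \<in> {0..int n}" and "s * x \<le> s * y" and d: "d \<ge> 1"
  shows "\<alpha> (x + s * d) - \<alpha> x \<le> \<alpha> (y + s * d) - \<alpha> y"
  using s
proof
  assume "s = 1"
  then show ?thesis using int_slopes[of x "x + d" y "y + d"] assms by (simp add: mult_le_cancel_right)
next
  assume "s = -1"
  then show ?thesis using int_slopes[of "y - d" y "x - d" x] assms by (simp add: mult_le_cancel_right)
qed

lemma cells_range: "valid n j i \<Longrightarrow> y \<in> cells j i \<Longrightarrow> y \<in> {0..int n}"
proof -
  assume "valid n j i" "y \<in> cells j i"
  moreover from this have "0 \<le> (i - 1) * len n j" by (intro mult_nonneg_nonneg) (auto simp: valid_def)
  ultimately show ?thesis unfolding valid_def atLeastAtMost_iff by linarith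
qed

lemma cells_shift: "y \<in> cells j i \<Longrightarrow> y + t * len n j \<in> cells j (i + t)"
  by (auto simp: algebra_simps)

lemma card_cells: "of_nat (card (cells j i)) = real_of_int (len n j)"
  using len_pos[of n j] by (simp add: algebra_simps less_imp_le)

lemma mean_shift:
  assumes "valid n j (i + t)"
  shows "real_of_int (len n j) * b j (i + t) = (\<Sum>y\<in>cells j i. \<alpha> (y + t * len n j))"
  unfolding block_mean_def block_total_valid[OF assms] sum_block_shift[of "\<lambda>k. \<alpha> k"]
  using len_pos[of n j] by simp

lemma mean_sum:
  assumes "valid n j i"
  shows "real_of_int (len n j) * b j i = (\<Sum>y\<in>cells j i. \<alpha> y)"
  using mean_shift[of j i 0] assms by simp

text \<open>Averages a pointwise inequality over a block and its translate by \<open>t\<close>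
  blocks. The coefficients \<open>p\<close>, \<open>q\<close>, \<open>r\<close> cover comparisons
  with constants too.\<close>

lemma mean_le:
  assumes "valid n j i" "valid n j (i + t)" and "\<And>y. y \<in> cells j i \<Longrightarrow> p * \<alpha> y + q \<le> r * \<alpha> (y + t * len n j)"
  shows "p * b j i + q \<le> r * b j (i + t)"
proof -
  have "real_of_int (len n j) * (p * b j i + q) = (\<Sum>y\<in>cells j i. p * \<alpha> y + q)"
    using mean_sum[OF assms(1)] card_cells[of i j]
    by (simp add: sum.distrib sum_distrib_left[symmetric] algebra_simps)
  also have "\<dots> \<le> (\<Sum>y\<in>cells j i. r * \<alpha> (y + t * len n j))"
    by (rule sum_mono) (rule assms(3))
  also have "\<dots> = real_of_int (len n j) * (r * b j (i + t))"
    using mean_shift[OF assms(2)] by (simp add: sum_distrib_left[symmetric])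
  finally show ?thesis using len_pos[of n j] by (simp add: mult_le_cancel_left)
qed

lemma mean_le_const:
  assumes "valid n j i" and "\<And>y. y \<in> cells j i \<Longrightarrow> \<alpha> y \<le> q"
  shows "b j i \<le> q"
  using mean_le[of j i 0 1 "-q" 0] assms by simp

lemma mean_ge_least:
  assumes "valid n j i"
  shows "\<alpha> c \<le> b j i"
  using mean_le[of j i 0 0 "\<alpha> c" 1] assms least cells_range[OF assms] by fastforce

text \<open>The rise from \<open>c\<close> to \<open>x\<close> is at most \<open>D\<close> times any
  step of length \<open>len n j\<close> that starts in block \<open>q\<close>, beyond
  \<open>x\<close>. Averaging over the block turns these steps into a difference of block
  means.\<close>

lemma point_growth:
  assumes s: "s = 1 \<or> s = -1" and v: "valid n j q" "valid n j (q + s)" and x: "x \<in> {0..int n}"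
    and xc: "0 \<le> s * (x - c)" "s * (x - c) \<le> D * len n j"
    and ord: "\<And>y. y \<in> cells j q \<Longrightarrow> s * x \<le> s * y"
  shows "\<alpha> x - \<alpha> c \<le> of_int D * (b j (q + s) - b j q)"
    and "b j q \<le> b j (q + s)"
proof -
  have g: "(\<alpha> x - \<alpha> c) * of_int (len n j) \<le> of_int (s * (x - c)) * (\<alpha> (y + s * len n j) - \<alpha> y)"
    "\<alpha> y \<le> \<alpha> (y + s * len n j)" if y: "y \<in> cells j q" for y
    using growth[OF s x cells_range[OF v(1) y] cells_range[OF v(2) cells_shift[OF y]] xc(1) _ len_ge1] ord[OF y]
    by (simp_all add: right_diff_distrib)
  have "0 \<le> D * len n j" using xc by linarith
  have "(\<alpha> x - \<alpha> c) + of_int D * \<alpha> y \<le> of_int D * \<alpha> (y + s * len n j)" if y: "y \<in> cells j q" for y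
  proof -
    have "(\<alpha> x - \<alpha> c) * of_int (len n j) \<le> of_int (s * (x - c)) * (\<alpha> (y + s * len n j) - \<alpha> y)"
      by (rule g(1)[OF y])
    also have "\<dots> \<le> of_int (D * len n j) * (\<alpha> (y + s * len n j) - \<alpha> y)"
      using xc(2) g(2)[OF y] by (intro mult_right_mono) (simp_all only: of_int_le_iff diff_ge_0_iff_ge)
    finally have "(\<alpha> x - \<alpha> c) * of_int (len n j) \<le> (of_int D * (\<alpha> (y + s * len n j) - \<alpha> y)) * of_int (len n j)"
      by (simp add: mult_ac)
    then have "\<alpha> x - \<alpha> c \<le> of_int D * (\<alpha> (y + s * len n j) - \<alpha> y)"
      by (rule mult_right_le_imp_le) simp
    then show ?thesis by (simp add: algebra_simps)
  qed
  then have "of_int D * b j q + (\<alpha> x - \<alpha> c) \<le> of_int D * b j (q + s)"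
    by (intro mean_le v) (simp add: add.commute)
  then show "\<alpha> x - \<alpha> c \<le> of_int D * (b j (q + s) - b j q)" by (simp add: algebra_simps)
  show "b j q \<le> b j (q + s)" using mean_le[OF v, of 1 0 1] g(2) by simp
qed

text \<open>Here each cell of block \<open>p\<close> plays the role of \<open>x\<close>, and its own
  translate supplies the step.\<close>

lemma mean_growth:
  assumes s: "s = 1 \<or> s = -1" and v: "valid n j p" "valid n j (p + s)"
    and yc: "\<And>y. y \<in> cells j p \<Longrightarrow> 0 \<le> s * (y - c) \<and> s * (y - c) \<le> D * len n j"
  shows "b j p - \<alpha> c \<le> of_int D * (b j (p + s) - b j p)"
proof -
  have "(1 + of_int D) * \<alpha> y + (- \<alpha> c) \<le> of_int D * \<alpha> (y + s * len n j)" if y: "y \<in> cells j p" for y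
  proof -
    note y' = cells_range[OF v(1) y] cells_range[OF v(2) cells_shift[OF y]]
    have "(\<alpha> y - \<alpha> c) * of_int (len n j) \<le> of_int (s * (y - c)) * (\<alpha> (y + s * len n j) - \<alpha> y)"
      using growth(1)[OF s y'(1) y' _ _ len_ge1] yc[OF y] by auto
    also have "\<dots> \<le> of_int (D * len n j) * (\<alpha> (y + s * len n j) - \<alpha> y)"
      using yc[OF y] growth(2)[OF s y'(1) y' _ _ len_ge1] 
      by (intro mult_right_mono) (simp_all only: of_int_le_iff diff_ge_0_iff_ge order_refl)
    finally have "(\<alpha> y - \<alpha> c) * of_int (len n j) \<le> (of_int D * (\<alpha> (y + s * len n j) - \<alpha> y)) * of_int (len n j)"
      by (simp add: mult_ac)
    then have "\<alpha> y - \<alpha> c \<le> of_int D * (\<alpha> (y + s * len n j) - \<alpha> y)"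
      by (rule mult_right_le_imp_le) simp
    then show ?thesis by (simp add: algebra_simps)
  qed
  from mean_le[OF v this] show ?thesis by (simp add: algebra_simps)
qed

lemma mean_mono:
  assumes s: "s = 1 \<or> s = -1" and v: "valid n j p" "valid n j (p + s * t)" and t: "t \<ge> 0"
    and yc: "\<And>y. y \<in> cells j p \<Longrightarrow> 0 \<le> s * (y - c)"
  shows "b j p \<le> b j (p + s * t)"
proof (cases "t = 0")
  case False
  with t have "t * len n j \<ge> 1" by (smt (verit) len_ge1 mult_le_cancel_left1)
  have "\<alpha> y \<le> \<alpha> (y + s * t * len n j)" if y: "y \<in> cells j p" for y
  proof -
    note y' = cells_range[OF v(1) y] cells_range[OF v(2) cells_shift[OF y]]
    show ?thesis
      using growth(2)[OF s y'(1), of y "t * len n j"] y' yc[OF y] \<open>t * len n j \<ge> 1\<close>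
      by (simp add: mult.assoc)
  qed
  then show ?thesis using mean_le[OF v, of 1 0 1] by simp
qed simp

lemma mean_steps:
  assumes s: "s = 1 \<or> s = -1" and v: "valid n j p" "valid n j (p + s)" "valid n j q" "valid n j (q + s)"
    and "s * p \<le> s * q"
  shows "b j (p + s) - b j p \<le> b j (q + s) - b j q"
proof -
  define t where "t = q - p"
  have vt: "valid n j (p + t)" "valid n j (p + (t + s))" using v by (simp_all add: t_def algebra_simps)
  have "(\<Sum>y\<in>cells j p. \<alpha> (y + s * len n j) - \<alpha> y) \<le> (\<Sum>y\<in>cells j p. \<alpha> (y + (t + s) * len n j) - \<alpha> (y + t * len n j))"
  proof (rule sum_mono)
    fix y assume y: "y \<in> cells j p"
    have "s * y \<le> s * (y + t * len n j)" using s assms(6) less_imp_le[OF len_pos[of n j]]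
      by (auto simp: t_def mult_nonpos_nonneg)
    then show "\<alpha> (y + s * len n j) - \<alpha> y \<le> \<alpha> (y + (t + s) * len n j) - \<alpha> (y + t * len n j)"
      using equal_steps[OF s cells_range[OF v(1) y] cells_range[OF v(2) cells_shift[OF y]]
        cells_range[OF vt(1) cells_shift[OF y]] _ _ len_ge1] cells_range[OF vt(2) cells_shift[OF y]]
      by (simp add: algebra_simps)
  qed
  then have "real_of_int (len n j) * (b j (p + s) - b j p) \<le> real_of_int (len n j) * (b j (p + (t + s)) - b j (p + t))"
    using mean_shift[OF v(2)] mean_sum[OF v(1)] mean_shift[OF vt(1)] mean_shift[OF vt(2)]
    by (simp add: sum_subtractf right_diff_distrib)
  then have "b j (p + s) - b j p \<le> b j (p + (t + s)) - b j (p + t)"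
    by (rule mult_left_le_imp_le) simp
  then show ?thesis by (simp add: t_def algebra_simps)
qed

text \<open>The comparison opposite to \<open>point_growth\<close>: a step between block means is at
  most a pointwise step of the same length further out. It lets steep blocks force large values
  beyond them.\<close>

lemma point_steps:
  assumes s: "s = 1 \<or> s = -1" and v: "valid n j q" "valid n j (q + s)"
    and x: "x \<in> {0..int n}" "x + s * len n j \<in> {0..int n}" and ord: "\<And>y. y \<in> cells j q \<Longrightarrow> s * y \<le> s * x"
  shows "b j (q + s) - b j q \<le> \<alpha> (x + s * len n j) - \<alpha> x"
proof -
  have "(\<Sum>y\<in>cells j q. \<alpha> (y + s * len n j) - \<alpha> y) \<le> (\<Sum>y\<in>cells j q. \<alpha> (x + s * len n j) - \<alpha> x)"
    using equal_steps[OF s _ _ x _ len_ge1] ord cells_range[OF v(1)] cells_range[OF v(2) cells_shift]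
    by (intro sum_mono) blast
  also have "\<dots> = real_of_int (len n j) * (\<alpha> (x + s * len n j) - \<alpha> x)" using card_cells[of q j] by simp
  finally have "real_of_int (len n j) * (b j (q + s) - b j q) \<le> real_of_int (len n j) * (\<alpha> (x + s * len n j) - \<alpha> x)"
    using mean_shift[OF v(2)] mean_sum[OF v(1)] by (simp add: sum_subtractf right_diff_distrib)
  then show ?thesis by (rule mult_left_le_imp_le) simp
qed

end

section \<open>The localization path\<close>

declare loc_index.simps(2) [simp del]

definition noise_mean :: "nat \<Rightarrow> (nat \<Rightarrow> real) \<Rightarrow> (nat \<Rightarrow> real) \<Rightarrow> nat \<Rightarrow> int \<Rightarrow> real" where
  "noise_mean n a v j i = block_mean n v j i - block_mean n a j i"

text \<open>\<open>j\<close> is the level of the two halves, whereas \<open>p\<close> numbers the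
  whole block one level coarser. Adding or subtracting this contrast turns the noise of a block into
  that of its halves.\<close>

definition split_noise :: "nat \<Rightarrow> (nat \<Rightarrow> real) \<Rightarrow> (nat \<Rightarrow> real) \<Rightarrow> nat \<Rightarrow> int \<Rightarrow> real" where
  "split_noise n a v j p = (noise_mean n a v j (2 * p - 1) - noise_mean n a v j (2 * p)) / 2"

text \<open>Bounds the noise around the path \<open>\<kappa>\<close> without a maximum over all blocks: the difference
  between the two halves of a block is independent of the coarser sums that select the block.\<close>

definition fluctuation :: "nat \<Rightarrow> (nat \<Rightarrow> real) \<Rightarrow> (nat \<Rightarrow> int) \<Rightarrow> (nat \<Rightarrow> real) \<Rightarrow> nat \<Rightarrow> real" where
  "fluctuation n a \<kappa> v j = (\<Sum>p\<in>{-1, 0, 1}. \<bar>noise_mean n a v 0 (1 + p)\<bar>) +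
     (\<Sum>k<j. \<Sum>p\<in>{-1, 0, 1}. \<bar>split_noise n a v (Suc k) (\<kappa> k + p)\<bar>)"

lemma fluctuation_nonneg: "fluctuation n a \<kappa> v j \<ge> 0"
  unfolding fluctuation_def by (intro add_nonneg_nonneg sum_nonneg) auto

lemma fluctuation_mono: "j \<le> k \<Longrightarrow> fluctuation n a \<kappa> v j \<le> fluctuation n a \<kappa> v k"
  unfolding fluctuation_def by (intro add_left_mono sum_mono2) (auto intro!: sum_nonneg)

lemma block_mean_split:
  assumes "j < finest n"
  shows "2 * block_mean n v j p = block_mean n v (Suc j) (2 * p - 1) + block_mean n v (Suc j) (2 * p)"
  using len_pos[of n "Suc j"] len_Suc[OF assms]
  unfolding block_mean_def block_total_split[OF assms] by (simp add: add_divide_distrib)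

lemma noise_mean_children:
  assumes "j < finest n"
  shows "noise_mean n a v (Suc j) (2 * p - 1) = noise_mean n a v j p + split_noise n a v (Suc j) p"
    and "noise_mean n a v (Suc j) (2 * p) = noise_mean n a v j p - split_noise n a v (Suc j) p"
  using block_mean_split[OF assms, of v p] block_mean_split[OF assms, of a p]
  unfolding noise_mean_def split_noise_def by (auto simp: field_simps)

lemma block_sum_mean:
  "valid n j i \<Longrightarrow> block_sum n v j i = ereal (real_of_int (len n j) * block_mean n v j i)"
  using len_pos[of n j] by (simp add: block_sum_valid block_mean_def)

abbreviation candidates :: "nat \<Rightarrow> (nat \<Rightarrow> real) \<Rightarrow> nat \<Rightarrow> int set" where
  "candidates n l j \<equiv>
    {max (2 * loc_index n l j - 2) 1 .. min (2 * loc_index n l j + 1) (block_count n (Suc j))}"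

lemma valid_children:
  assumes "j < finest n" "valid n j i"
  shows "valid n (Suc j) (2 * i - 1)" "valid n (Suc j) (2 * i)"
proof -
  have "2 * i * len n (Suc j) \<le> int n + 1" using assms len_Suc[OF assms(1)] by (simp add: valid_def mult.assoc mult.left_commute)
  moreover have "(2 * i - 1) * len n (Suc j) \<le> 2 * i * len n (Suc j)" by (simp add: algebra_simps less_imp_le)
  ultimately show "valid n (Suc j) (2 * i - 1)" "valid n (Suc j) (2 * i)" 
    using assms(2) unfolding valid_def by linarith+
qed

lemma valid_0: "valid n 0 1"
  using len_0_bounds(1)[of n] by (simp add: valid_def)

lemma loc_index_step:
  assumes "j < finest n" "valid n j (loc_index n l j)"
  shows "loc_index n l (Suc j) \<in> candidates n l j"
    and "\<And>i. i \<in> candidates n l j \<Longrightarrow> block_mean n l (Suc j) (loc_index n l (Suc j)) \<le> block_mean n l (Suc j) i"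
    and "valid n (Suc j) (loc_index n l (Suc j))"
proof -
  let ?S = "candidates n l j"
  have "2 * loc_index n l j \<in> ?S"
    using valid_children[OF assms] assms(2) by (auto simp: valid_iff)
  then have ne: "?S \<noteq> {}" "finite ?S" by auto
  have in_S: "loc_index n l (Suc j) \<in> ?S"
    using arg_min_if_finite(1)[OF ne(2,1), of "block_sum n l (Suc j)"] by (simp add: loc_index.simps)
  then show "loc_index n l (Suc j) \<in> ?S" .
  have v: "valid n (Suc j) i" if "i \<in> ?S" for i using that by (auto simp: valid_iff)
  show "valid n (Suc j) (loc_index n l (Suc j))" by (rule v[OF in_S])
  fix i assume i: "i \<in> ?S"
  have "block_sum n l (Suc j) (loc_index n l (Suc j)) \<le> block_sum n l (Suc j) i"
    using arg_min_if_finite(2)[OF ne(2,1), of "block_sum n l (Suc j)"] i by (auto simp: not_less loc_index.simps)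
  then have "real_of_int (len n (Suc j)) * block_mean n l (Suc j) (loc_index n l (Suc j)) \<le> real_of_int (len n (Suc j)) * block_mean n l (Suc j) i"
    unfolding block_sum_mean[OF v[OF in_S]] block_sum_mean[OF v[OF i]] ereal_less_eq .
  then show "block_mean n l (Suc j) (loc_index n l (Suc j)) \<le> block_mean n l (Suc j) i"
    by (rule mult_left_le_imp_le) simp
qed

lemma valid_loc_index: "j \<le> finest n \<Longrightarrow> valid n j (loc_index n l j)"
proof (induction j)
  case (Suc j)
  then show ?case by (intro loc_index_step(3)) auto
qed (simp add: valid_0)

text \<open>The interval for \<open>i\<close> consists of the children of the path block and of its
  two neighbours. It is also the set of possible candidates enlarged by one on each side, which
  closes the induction in \<open>noise_at_path\<close>.\<close>

lemma noise_near_path: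
  assumes "j < finest n" and "\<And>p. \<bar>p\<bar> \<le> 1 \<Longrightarrow> \<bar>noise_mean n a l j (loc_index n l j + p)\<bar> \<le> fluctuation n a (loc_index n l) l j"
    and i: "2 * loc_index n l j - 3 \<le> i" "i \<le> 2 * loc_index n l j + 2"
  shows "\<bar>noise_mean n a l (Suc j) i\<bar> \<le> fluctuation n a (loc_index n l) l (Suc j)"
proof -
  define p where "p = (i + 1) div 2 - loc_index n l j"
  have p: "\<bar>p\<bar> \<le> 1" using i by (auto simp: p_def)
  have "i = 2 * (loc_index n l j + p) - 1 \<or> i = 2 * (loc_index n l j + p)" by (auto simp: p_def)
  then have "noise_mean n a l (Suc j) i = noise_mean n a l j (loc_index n l j + p) + split_noise n a l (Suc j) (loc_index n l j + p)
    \<or> noise_mean n a l (Suc j) i = noise_mean n a l j (loc_index n l j + p) - split_noise n a l (Suc j) (loc_index n l j + p)"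
    by (elim disjE) (simp_all only: noise_mean_children[OF assms(1)] simp_thms)
  then have "\<bar>noise_mean n a l (Suc j) i\<bar> \<le> \<bar>noise_mean n a l j (loc_index n l j + p)\<bar> + \<bar>split_noise n a l (Suc j) (loc_index n l j + p)\<bar>"
    using abs_triangle_ineq abs_triangle_ineq4 by metis
  also have "\<bar>split_noise n a l (Suc j) (loc_index n l j + p)\<bar> \<le> (\<Sum>p\<in>{-1, 0, 1}. \<bar>split_noise n a l (Suc j) (loc_index n l j + p)\<bar>)"
    using p by (intro member_le_sum) (auto simp: abs_le_iff)
  also have "\<bar>noise_mean n a l j (loc_index n l j + p)\<bar> \<le> fluctuation n a (loc_index n l) l j" by (rule assms(2)[OF p])
  finally show ?thesis by (simp add: fluctuation_def)
qed

lemma noise_at_path: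
  assumes "j \<le> finest n" "\<bar>p\<bar> \<le> 1"
  shows "\<bar>noise_mean n a l j (loc_index n l j + p)\<bar> \<le> fluctuation n a (loc_index n l) l j"
  using assms
proof (induction j arbitrary: p)
  case 0
  then have "p \<in> {-1, 0, 1}" by auto
  then show ?case by (auto simp: fluctuation_def)
next
  case (Suc j)
  have "loc_index n l (Suc j) \<in> candidates n l j"
    using Suc.prems by (intro loc_index_step valid_loc_index) auto
  then show ?case using Suc by (intro noise_near_path) auto
qed

text \<open>Both halves of the current block are candidates, and the current observed mean is their
  average.\<close>

lemma observed_decreasing:
  assumes "j < finest n"
  shows "block_mean n l (Suc j) (loc_index n l (Suc j)) \<le> block_mean n l j (loc_index n l j)"
proof -
  have v: "valid n j (loc_index n l j)" using assms by (intro valid_loc_index) auto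
  note st = loc_index_step[OF assms v] and ch = valid_children[OF assms v]
  have "block_mean n l (Suc j) (loc_index n l (Suc j)) \<le> block_mean n l (Suc j) (2 * loc_index n l j - 1)"
    "block_mean n l (Suc j) (loc_index n l (Suc j)) \<le> block_mean n l (Suc j) (2 * loc_index n l j)"
    using ch v by (auto intro!: st(2) simp: valid_iff)
  then show ?thesis using block_mean_split[OF assms, of l "loc_index n l j"] by linarith
qed

section \<open>Paths that leave the minimum\<close>

context convex_sequence
begin

text \<open>The block that contains the smallest grid value, counted from 1. It need not be
  complete: the last points of the sample may lie in no complete block.\<close>

definition home :: "nat \<Rightarrow> int" where
  "home j = c div len n j + 1"

text \<open>Distance 1 is tolerated: a path that moves from there to distance 2 or more at the next
  level had a neighbour of the new home block among its candidates.\<close>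

definition lost :: "(nat \<Rightarrow> real) \<Rightarrow> nat \<Rightarrow> bool" where
  "lost l j \<longleftrightarrow> \<bar>loc_index n l j - home j\<bar> \<ge> 2"

lemma home_bounds: "(home j - 1) * len n j \<le> c" "c < home j * len n j"
proof -
  have "len n j * (c div len n j) \<le> c \<and> c < len n j * (c div len n j) + len n j"
    using mult_div_mod_eq[of "len n j" c] pos_mod_bound[OF len_pos[of n j], of c] pos_mod_sign[OF len_pos[of n j], of c]
    by linarith
  then show "(home j - 1) * len n j \<le> c" "c < home j * len n j"
    by (auto simp: home_def algebra_simps)
qed

lemma home_ge1: "home j \<ge> 1"
  using c by (simp add: home_def pos_imp_zdiv_nonneg_iff)

lemma home_Suc:
  assumes "j < finest n"
  shows "home (Suc j) = 2 * home j - 1 \<or> home (Suc j) = 2 * home j"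
proof -
  have "c div len n j = c div len n (Suc j) div 2"
    unfolding len_Suc[OF assms] by (subst zdiv_zmult2_eq[symmetric]) (auto simp: mult.commute)
  moreover have "y + 1 = 2 * (y div 2 + 1) - 1 \<or> y + 1 = 2 * (y div 2 + 1)" for y :: int
    by presburger
  ultimately show ?thesis unfolding home_def by metis
qed

lemma not_lost_0: "\<not> lost l 0"
proof -
  have "c < 2 * len n 0" using c len_0_bounds(2)[of n] by simp
  then have "(home 0 - 1) * len n 0 < 2 * len n 0" using home_bounds(1)[of 0] by linarith
  then have "home 0 - 1 < 2" by (simp add: mult_less_cancel_right)
  then show ?thesis using home_ge1[of 0] by (simp add: lost_def)
qed

text \<open>On departure the path prefers \<open>i\<close> to the neighbour \<open>h + s\<close> of
  the home block on the same side, so the rise between these two blocks is at most the noise of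
  both, twice the fluctuation. Since \<open>i\<close> is at most 4 blocks from home, convexity
  bounds the whole bias by 5 times that rise.\<close>

lemma get_lost:
  assumes j: "j < finest n" and l: "\<not> lost l j" "lost l (Suc j)"
  shows "b (Suc j) (loc_index n l (Suc j)) - \<alpha> c \<le> 10 * fluctuation n a (loc_index n l) l (Suc j)"
proof -
  define i where "i = loc_index n l (Suc j)"
  define h where "h = home (Suc j)"
  define L where "L = len n (Suc j)"
  define s where "s = sgn (i - h)"
  have L: "L \<ge> 1" by (simp add: L_def)
  have vj: "valid n j (loc_index n l j)" using j by (intro valid_loc_index) auto
  note st = loc_index_step[OF j vj, folded i_def]
  have h: "h = 2 * home j - 1 \<or> h = 2 * home j" using home_Suc[OF j] by (simp add: h_def)
  have far: "\<bar>i - h\<bar> \<ge> 2" using l(2) by (simp add: lost_def i_def h_def)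
  have near: "\<bar>loc_index n l j - home j\<bar> \<le> 1" using l(1) by (simp add: lost_def)
  have s: "s = 1 \<and> i \<ge> h + 2 \<or> s = -1 \<and> i \<le> h - 2" using far by (auto simp: s_def sgn_if)
  then have s': "s = 1 \<or> s = -1" by auto
  have i: "2 * loc_index n l j - 2 \<le> i" "i \<le> 2 * loc_index n l j + 1" using st(1) by auto
  \<comment> \<open>The extreme case is \<open>loc_index n l j = home j + 1\<close>,
    \<open>i = 2 * home j + 3\<close>, \<open>h = 2 * home j - 1\<close>, or its mirror
    image.\<close>
  have close: "s * (i - h) \<le> 4" using s near h i by (elim disjE conjE) simp_all
  have hL: "(h - 1) * L \<le> c" "c < h * L" using home_bounds[of "Suc j"] by (simp_all add: h_def L_def)
  \<comment> \<open>Block \<open>h\<close> itself may be incomplete. Its neighbour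
    \<open>h + s\<close> is complete: it lies to the left of \<open>h\<close>, or to the right but
    not beyond \<open>i\<close>.\<close>
  have "valid n (Suc j) (h - 1)" if "h \<ge> 2"
    using that hL(1) c by (simp add: valid_def L_def)
  then have cand: "h + s \<in> candidates n l j"
    using s near h st(1) home_ge1[of "Suc j"] by (auto simp: valid_iff h_def)
  then have v1: "valid n (Suc j) (h + s)" by (auto simp: valid_iff)
  have v2: "valid n (Suc j) (i - s)" using s v1 st(3) by (auto simp: valid_iff)
  have iL: "s = 1 \<Longrightarrow> (h + 2) * L \<le> i * L" "s = -1 \<Longrightarrow> i * L \<le> (h - 2) * L" "s * (i - h) * L \<le> 4 * L"
    using s close L by (auto intro!: mult_right_mono)
  have "b (Suc j) (i - s) - \<alpha> c \<le> of_int 4 * (b (Suc j) (i - s + s) - b (Suc j) (i - s))"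
  proof (rule mean_growth[OF s' v2])
    show "valid n (Suc j) (i - s + s)" using st(3) by simp
    fix y assume "y \<in> cells (Suc j) (i - s)"
    then have y: "(i - s - 1) * L \<le> y" "y \<le> (i - s) * L - 1" by (simp_all add: L_def)
    have eq: "(i - s - 1) * L = i * L - s * L - L" "(i - s) * L = i * L - s * L" "(h - 1) * L = h * L - L"
      "(h + 2) * L = h * L + 2 * L" "(h - 2) * L = h * L - 2 * L" "s * (i - h) * L = s * (i * L) - s * (h * L)"
      by (simp_all add: algebra_simps)
    from s show "0 \<le> s * (y - c) \<and> s * (y - c) \<le> 4 * len n (Suc j)"
    proof
      assume "s = 1 \<and> h + 2 \<le> i"
      then show ?thesis using y hL iL(1,3) L unfolding eq L_def[symmetric] by simp
    next
      assume "s = -1 \<and> i \<le> h - 2"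
      then show ?thesis using y hL iL(2,3) L unfolding eq L_def[symmetric] by simp
    qed
  qed
  then have 1: "b (Suc j) i - \<alpha> c \<le> 5 * (b (Suc j) i - b (Suc j) (i - s))" by simp
  define t where "t = s * (i - h) - 2"
  have t: "h + s + s * t = i - s" "t \<ge> 0" using s' s by (auto simp: t_def algebra_simps)
  have "b (Suc j) (h + s) \<le> b (Suc j) (h + s + s * t)"
  proof (rule mean_mono[OF s' v1 _ t(2)])
    show "valid n (Suc j) (h + s + s * t)" by (subst t(1)) (rule v2)
    fix y assume "y \<in> cells (Suc j) (h + s)"
    then have y: "(h + s - 1) * L \<le> y" "y \<le> (h + s) * L - 1" by (simp_all add: L_def)
    have eq: "(h + s - 1) * L = h * L + s * L - L" "(h + s) * L = h * L + s * L" "(h - 1) * L = h * L - L"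
      by (simp_all add: algebra_simps)
    show "0 \<le> s * (y - c)" using s' y hL L unfolding eq by auto
  qed
  then have "b (Suc j) (h + s) \<le> b (Suc j) (i - s)" unfolding t(1) .
  with 1 have 2: "b (Suc j) i - \<alpha> c \<le> 5 * (b (Suc j) i - b (Suc j) (h + s))" by simp
  have "block_mean n l (Suc j) i \<le> block_mean n l (Suc j) (h + s)" by (rule st(2)[OF cand])
  then have "b (Suc j) i - b (Suc j) (h + s) \<le> noise_mean n a l (Suc j) (h + s) - noise_mean n a l (Suc j) i"
    by (simp add: noise_mean_def)
  also have "\<dots> \<le> 2 * fluctuation n a (loc_index n l) l (Suc j)"
  proof -
    have near: "\<bar>noise_mean n a l (Suc j) k\<bar> \<le> fluctuation n a (loc_index n l) l (Suc j)" if "k \<in> candidates n l j" for k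
      using that j by (intro noise_near_path noise_at_path) auto
    show ?thesis using near[OF cand] near[OF st(1)] by linarith
  qed
  finally show ?thesis using 2 by (simp add: i_def)
qed

text \<open>Formulated for the observed mean, which decreases along the path, whereas the true mean
  need not. The constant is 10 from the moment of departure plus 1 for the noise of the block then
  occupied; later levels only enlarge the right-hand side.\<close>

lemma lost_bias_observed:
  assumes "j \<le> finest n" "lost l j"
  shows "block_mean n l j (loc_index n l j) - \<alpha> c \<le> 11 * fluctuation n a (loc_index n l) l j"
  using assms
proof (induction j)
  case 0
  then show ?case using not_lost_0 by simp
next
  case (Suc j)
  show ?case
  proof (cases "lost l j")
    case True
    then have "block_mean n l j (loc_index n l j) - \<alpha> c \<le> 11 * fluctuation n a (loc_index n l) l j"
      using Suc by simp
    then show ?thesis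
      using observed_decreasing[of j n l] Suc.prems fluctuation_mono[of j "Suc j" n a "loc_index n l" l] by simp
  next
    case False
    have "b (Suc j) (loc_index n l (Suc j)) - \<alpha> c \<le> 10 * fluctuation n a (loc_index n l) l (Suc j)"
      using Suc.prems False by (intro get_lost) auto
    moreover have "noise_mean n a l (Suc j) (loc_index n l (Suc j)) \<le> fluctuation n a (loc_index n l) l (Suc j)"
      using noise_at_path[of "Suc j" n 0 a l] Suc.prems by simp
    ultimately show ?thesis by (simp add: noise_mean_def)
  qed
qed

lemma lost_bias:
  assumes "j \<le> finest n" "lost l j"
  shows "b j (loc_index n l j) - \<alpha> c \<le> 12 * fluctuation n a (loc_index n l) l j"
  using lost_bias_observed[OF assms] noise_at_path[of j n 0 a l] assms
  by (simp add: noise_mean_def abs_le_iff)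

end

section \<open>Bias at the stopping level\<close>

lemma valid_between: "valid n j p \<Longrightarrow> valid n j q \<Longrightarrow> p \<le> i \<Longrightarrow> i \<le> q \<Longrightarrow> valid n j i"
  by (auto simp: valid_iff)

lemma valid_toward:
  assumes "s = 1 \<or> s = -1" "valid n j i" "valid n j (i + t * s)" "0 \<le> r" "r \<le> t"
  shows "valid n j (i + r * s)"
  using assms by (auto simp: valid_iff)

context convex_sequence
begin

text \<open>If the path is next to home, the home block is one of \<open>i - 1\<close>,
  \<open>i\<close>, \<open>i + 1\<close>. Then block \<open>i + 2 * s\<close> lies on side
  \<open>s\<close> of the minimum, within 4 block lengths of it, and inside of the stopping blocks.
  Otherwise two steps outwards from \<open>i\<close> add at most twice the stopping slope to the
  bias of \<open>i\<close>.\<close>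

lemma side_bias:
  assumes s: "s = 1 \<or> s = -1" and v: "valid n j i" "valid n j (i + 6 * s)" 
    and B: "B \<ge> 0" "\<bar>i - home j\<bar> \<ge> 2 \<Longrightarrow> b j i - \<alpha> c \<le> B"
  shows "b j (i + 2 * s) - \<alpha> c \<le> B + 4 * max 0 (b j (i + 6 * s) - b j (i + 5 * s))"
proof -
  have val: "valid n j (i + r * s)" if "0 \<le> r" "r \<le> 6" for r
    using valid_toward[OF s v that] .
  let ?\<mu> = "b j (i + 6 * s) - b j (i + 5 * s)"
  show ?thesis
  proof (cases "\<bar>i - home j\<bar> \<ge> 2")
    case True
    have "b j (i + r * s + s) - b j (i + r * s) \<le> b j (i + 5 * s + s) - b j (i + 5 * s)" if "0 \<le> r" "r \<le> 1" for r
      using val[of r] val[of "r + 1"] val[of 5] val[of 6] that s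
      by (intro mean_steps) (auto simp: algebra_simps)
    from this[of 0] this[of 1] have "b j (i + 2 * s) - b j i \<le> 2 * ?\<mu>"
      by (simp add: algebra_simps)
    moreover have "x + z \<le> B + 4 * max 0 y" if "x \<le> 2 * y" "z \<le> B" for x y z :: real
      using that by (simp add: max_def)
    from this[OF calculation B(2)[OF True]] show ?thesis by simp
  next
    case False
    define L where "L = len n j"
    have L: "L \<ge> 1" by (simp add: L_def)
    have "b j (i + 2 * s) \<le> \<alpha> c + 4 * ?\<mu>"
    proof (rule mean_le_const[OF val])
      fix y assume y: "y \<in> cells j (i + 2 * s)"
      have h: "(home j - 1) * L \<le> c" "c < home j * L" "(i + 2 * s - 1) * L \<le> y" "y < (i + 2 * s) * L"
        using home_bounds[of j] y by (simp_all add: L_def)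
      define d where "d = home j - i"
      have d: "d = -1 \<or> d = 0 \<or> d = 1" using False by (auto simp: d_def)
      have hd: "home j = i + d" by (simp add: d_def)
      have yc: "0 \<le> s * (y - c) \<and> s * (y - c) \<le> 4 * len n j"
        using h s d L unfolding hd L_def[symmetric] by (auto simp: algebra_simps)
      have "\<alpha> y - \<alpha> c \<le> of_int 4 * (b j (i + 5 * s + s) - b j (i + 5 * s))"
      proof (rule point_growth(1)[OF s])
        fix z assume "z \<in> cells j (i + 5 * s)"
        then have "(i + 5 * s - 1) * L \<le> z" "z < (i + 5 * s) * L" by (simp_all add: L_def)
        then show "s * y \<le> s * z" using h s L by (auto simp: algebra_simps)
      qed (use val[of 5] val[of 6] yc cells_range[OF val y] in \<open>auto simp: algebra_simps\<close>)
      then show "\<alpha> y \<le> \<alpha> c + 4 * ?\<mu>" by (simp add: algebra_simps)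
    qed auto
    moreover have "x - z \<le> B + 4 * max 0 y" if "x \<le> z + 4 * y" for x y z :: real
      using that B(1) by (simp add: max_def)
    from this[OF calculation] show ?thesis .
  qed
qed

text \<open>Block \<open>i\<close> may contain the minimum, so each of its points is charged to the
  stopping slope on its own side of \<open>c\<close>.\<close>

lemma middle_bias:
  assumes v: "valid n j i" "valid n j (i + 6)" "valid n j (i - 6)"
    and B: "B \<ge> 0" "\<bar>i - home j\<bar> \<ge> 2 \<Longrightarrow> b j i - \<alpha> c \<le> B"
  shows "b j i - \<alpha> c \<le> B + 4 * max 0 (b j (i + 6) - b j (i + 5)) + 4 * max 0 (b j (i - 6) - b j (i - 5))"
proof (cases "\<bar>i - home j\<bar> \<ge> 2")
  case False
  define L where "L = len n j"
  have L: "L \<ge> 1" by (simp add: L_def)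
  have val: "valid n j (i + r)" if "-6 \<le> r" "r \<le> 6" for r
    using valid_between[OF v(3,2)] that by simp
  have "b j i \<le> \<alpha> c + (4 * max 0 (b j (i + 6) - b j (i + 5)) + 4 * max 0 (b j (i - 6) - b j (i - 5)))"
  proof (rule mean_le_const[OF v(1)])
    fix y assume y: "y \<in> cells j i"
    have h: "(home j - 1) * L \<le> c" "c < home j * L" "(i - 1) * L \<le> y" "y < i * L"
      using home_bounds[of j] y by (simp_all add: L_def)
    define d where "d = home j - i"
    have d: "d = -1 \<or> d = 0 \<or> d = 1" using False by (auto simp: d_def)
    have hd: "home j = i + d" by (simp add: d_def)
    define s :: int where "s = (if y \<ge> c then 1 else -1)"
    have s: "s = 1 \<or> s = -1" by (simp add: s_def)
    have yc: "0 \<le> s * (y - c)" "s * (y - c) \<le> 4 * len n j"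
      using h d L unfolding hd L_def[symmetric] s_def by (auto simp: algebra_simps)
    have "\<alpha> y - \<alpha> c \<le> of_int 4 * (b j (i + 5 * s + s) - b j (i + 5 * s))"
    proof (rule point_growth(1)[OF s])
      fix z assume "z \<in> cells j (i + 5 * s)"
      then have "(i + 5 * s - 1) * L \<le> z" "z < (i + 5 * s) * L" by (simp_all add: L_def)
      then show "s * y \<le> s * z" using h s L by (auto simp: algebra_simps)
    qed (use s val[of 5] val[of 6] val[of "-5"] val[of "-6"] yc cells_range[OF v(1) y] in \<open>auto simp: algebra_simps\<close>)
    moreover have four: "z \<le> 4 * max 0 x" if "z \<le> of_int 4 * x" for x z :: real
      using that by (simp add: max_def)
    from four[OF calculation]
    have "\<alpha> y - \<alpha> c \<le> 4 * max 0 (b j (i + 5 * s + s) - b j (i + 5 * s))" .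
    then have two: "\<alpha> y - \<alpha> c \<le> 4 * max 0 (b j (i + 6) - b j (i + 5)) \<or>
        \<alpha> y - \<alpha> c \<le> 4 * max 0 (b j (i - 6) - b j (i - 5))"
      using s by (elim disjE) (simp_all add: add.commute)
    have comb: "z \<le> w + (4 * max 0 x + 4 * max 0 x')" if "z - w \<le> 4 * max 0 x \<or> z - w \<le> 4 * max 0 x'" for x x' z w :: real
      using that by (auto simp: max_def split: if_splits)
    show "\<alpha> y \<le> \<alpha> c + (4 * max 0 (b j (i + 6) - b j (i + 5)) + 4 * max 0 (b j (i - 6) - b j (i - 5)))"
      by (rule comb[OF two])
  qed
  then show ?thesis using B(1) by simp
next
  case True
  have "x \<le> B + 4 * max 0 y + 4 * max 0 z" if "x \<le> B" for x y z :: real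
    using that by (simp add: max_def)
  from this[OF B(2)[OF True]] show ?thesis .
qed

text \<open>Beyond the outer stopping block a single step of length \<open>len n j\<close> already
  rises by \<theta>, from a value that is at least the minimum. The sample has a point that far out
  only if the outer block is complete, which is what \<open>steep\<close> asks for.\<close>

lemma steep_side:
  assumes s: "s = 1 \<or> s = -1" and v: "valid n j i"
    and steep: "valid n j (i + 6 * s) \<Longrightarrow> b j (i + 6 * s) - b j (i + 5 * s) \<ge> \<theta>"
    and x: "x \<in> {0..int n}" "\<alpha> x < \<alpha> c + \<theta>"
  shows "s = 1 \<Longrightarrow> x < (i + 6) * len n j" and "s = -1 \<Longrightarrow> x > (i - 7) * len n j"
proof -
  define L where "L = len n j"
  have L: "L \<ge> 1" by (simp add: L_def)
  have out: False if far: "s = 1 \<and> (i + 6) * L \<le> x \<or> s = -1 \<and> x \<le> (i - 7) * L"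
  proof -
    have vi: "(i - 1) * L \<ge> 0" using v L by (intro mult_nonneg_nonneg) (auto simp: valid_def)
    have "valid n j (i + 6 * s)"
    proof -
      from far have "s = 1 \<and> (i + 6) * L \<le> int n \<or> s = -1 \<and> 0 \<le> (i - 7) * L"
        using x(1) by auto
      moreover have "i - 7 \<ge> 0" if "0 \<le> (i - 7) * L" using that L by (simp add: zero_le_mult_iff)
      moreover have "(i - 6) * L \<le> i * L" using L by (intro mult_right_mono) auto
      ultimately show ?thesis using v by (auto simp: valid_def L_def[symmetric])
    qed
    then have "\<theta> \<le> b j (i + 6 * s) - b j (i + 5 * s)" by (rule steep)
    have v5: "valid n j (i + 5 * s)" by (rule valid_toward[OF s v \<open>valid n j (i + 6 * s)\<close>]) auto
    have iL: "i * L \<le> int n + 1" using v by (simp add: valid_def L_def)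
    have eqs: "(i + 6) * L = i * L + 6 * L" "(i - 7) * L = i * L - 7 * L" "(i - 1) * L = i * L - L"
      by (simp_all add: algebra_simps)
    have xs: "x - s * L \<in> {0..int n}"
      using far
    proof (elim disjE conjE)
      assume "s = 1" "(i + 6) * L \<le> x"
      then have "0 \<le> x - L \<and> x - L \<le> int n" using vi L x(1) unfolding eqs atLeastAtMost_iff by linarith
      then show ?thesis using \<open>s = 1\<close> by simp
    next
      assume "s = -1" "x \<le> (i - 7) * L"
      then have "0 \<le> x + L \<and> x + L \<le> int n" using iL L x(1) unfolding eqs atLeastAtMost_iff by linarith
      then show ?thesis using \<open>s = -1\<close> by simp
    qed
    have "b j (i + 5 * s + s) - b j (i + 5 * s) \<le> \<alpha> (x - s * L + s * len n j) - \<alpha> (x - s * L)"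
    proof (rule point_steps[OF s v5])
      show "valid n j (i + 5 * s + s)" using \<open>valid n j (i + 6 * s)\<close> by (simp add: algebra_simps)
      show "x - s * L \<in> {0..int n}" by (rule xs)
      show "x - s * L + s * len n j \<in> {0..int n}" using x(1) by (simp add: L_def)
      fix y assume "y \<in> cells j (i + 5 * s)"
      then have "(i + 5 * s - 1) * L \<le> y" "y < (i + 5 * s) * L" by (simp_all add: L_def)
      then show "s * y \<le> s * (x - s * L)" using far L by (auto simp: algebra_simps)
    qed
    moreover have "i + 5 * s + s = i + 6 * s" by simp
    ultimately have "b j (i + 6 * s) - b j (i + 5 * s) \<le> \<alpha> x - \<alpha> (x - s * L)" by (simp add: L_def)
    moreover have "\<alpha> c \<le> \<alpha> (x - s * L)"
    proof -
      have "nat (x - s * L) \<le> n" using xs by auto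
      then show ?thesis by (rule least)
    qed
    ultimately show False using x(2) \<open>\<theta> \<le> b j (i + 6 * s) - b j (i + 5 * s)\<close> by linarith
  qed
  show "s = 1 \<Longrightarrow> x < (i + 6) * len n j" and "s = -1 \<Longrightarrow> x > (i - 7) * len n j"
    using out by (auto simp: L_def not_le[symmetric])
qed

text \<open>By \<open>steep_side\<close> the points with a nonzero term lie between
  \<open>(i - 7) * len n j\<close> and \<open>(i + 6) * len n j\<close>, a range of 13 blocks, and
  each term is at most \<open>u\<^sup>2\<close>.\<close>

lemma sum_low_points:
  assumes v: "valid n j i"
    and steep: "\<And>s. s = 1 \<or> s = -1 \<Longrightarrow> valid n j (i + 6 * s) \<Longrightarrow> b j (i + 6 * s) - b j (i + 5 * s) \<ge> \<theta>"
    and M: "M \<le> \<alpha> c" and u: "0 \<le> u" "u \<le> \<theta>"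
  shows "(\<Sum>k\<in>{0..n}. (max 0 (M + u - a k))\<^sup>2) \<le> 13 * of_int (len n j) * u\<^sup>2"
proof -
  define L where "L = len n j"
  have L: "L \<ge> 1" by (simp add: L_def)
  define S where "S = {k\<in>{0..n}. a k < \<alpha> c + \<theta>}"
  have "S \<subseteq> nat ` {(i - 7) * L<..<(i + 6) * L}"
  proof
    fix k assume "k \<in> S"
    then have "int k \<in> {0..int n}" "\<alpha> (int k) < \<alpha> c + \<theta>" by (auto simp: S_def)
    from steep_side(1)[OF _ v steep this, of 1] steep_side(2)[OF _ v steep this, of "-1"]
    show "k \<in> nat ` {(i - 7) * L<..<(i + 6) * L}" by (intro image_eqI[of _ _ "int k"]) (auto simp: L_def)
  qed
  then have "card S \<le> card (nat ` {(i - 7) * L<..<(i + 6) * L})" by (intro card_mono) auto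
  also have "\<dots> \<le> card {(i - 7) * L<..<(i + 6) * L}" by (rule card_image_le) simp
  also have "\<dots> \<le> nat (13 * L)" by (simp add: algebra_simps)
  finally have "real (card S) \<le> real (nat (13 * L))" by (simp only: of_nat_le_iff)
  then have card: "real (card S) \<le> 13 * of_int L" using L by simp
  have "(\<Sum>k\<in>{0..n}. (max 0 (M + u - a k))\<^sup>2) \<le> (\<Sum>k\<in>{0..n}. if a k < \<alpha> c + \<theta> then u\<^sup>2 else 0)"
  proof (rule sum_mono)
    fix k assume "k \<in> {0..n}"
    then have "\<alpha> c \<le> a k" using least by simp
    then have "max 0 (M + u - a k) \<le> u" using M u by simp
    then have "(max 0 (M + u - a k))\<^sup>2 \<le> u\<^sup>2" by (intro power_mono) auto
    then show "(max 0 (M + u - a k))\<^sup>2 \<le> (if a k < \<alpha> c + \<theta> then u\<^sup>2 else 0)"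
      using M u by (auto simp: max_def)
  qed
  also have "\<dots> = (\<Sum>k\<in>S. u\<^sup>2)" unfolding S_def by (rule sum.inter_filter[symmetric]) simp
  also have "\<dots> \<le> 13 * of_int L * u\<^sup>2" using card by (simp add: mult_right_mono)
  finally show ?thesis by (simp add: L_def)
qed

end

section \<open>The error of the estimate for fixed samples\<close>

lemma block_sum_diff_le_iff:
  assumes s: "s = 1 \<or> s = -1" and v: "valid n j i"
  shows "block_sum n w j (i + 6 * s) - block_sum n w j (i + 5 * s) \<le> ereal t \<longleftrightarrow>
    valid n j (i + 6 * s) \<and> block_mean n w j (i + 6 * s) - block_mean n w j (i + 5 * s) \<le> t / real_of_int (len n j)"
proof (cases "valid n j (i + 6 * s)")
  case True
  moreover have "valid n j (i + 5 * s)" by (rule valid_toward[OF s v True]) auto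
  ultimately show ?thesis
    by (simp add: block_sum_mean pos_le_divide_eq right_diff_distrib[symmetric] mult.commute[of _ "real_of_int (len n j)"])
next
  case False
  then show ?thesis by (simp add: block_sum_invalid)
qed

text \<open>Standard deviation of the difference of two block means of the stopping sample, each of
  variance \<open>3 * \<sigma>\<^sup>2 / len n j\<close>.\<close>

definition mean_sd :: "nat \<Rightarrow> real \<Rightarrow> nat \<Rightarrow> real" where
  "mean_sd n \<sigma> j = stop_sd n \<sigma> j / real_of_int (len n j)"

definition side_noise :: "nat \<Rightarrow> (nat \<Rightarrow> real) \<Rightarrow> (nat \<Rightarrow> real) \<Rightarrow> nat \<Rightarrow> int \<Rightarrow> int \<Rightarrow> real" where
  "side_noise n a v j i s = noise_mean n a v j (i + 6 * s) - noise_mean n a v j (i + 5 * s)"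

definition stops :: "nat \<Rightarrow> real \<Rightarrow> (nat \<Rightarrow> real) \<Rightarrow> nat \<Rightarrow> int \<Rightarrow> int \<Rightarrow> bool" where
  "stops n \<sigma> v j i s \<longleftrightarrow> valid n j (i + 6 * s) \<and>
     block_mean n v j (i + 6 * s) - block_mean n v j (i + 5 * s) \<le> 2 * mean_sd n \<sigma> j"

text \<open>One bound for all outcomes at level \<open>j\<close>: the bias of a lost path with the
  factor of \<open>lost_bias\<close>, the noise of every block that may be reported, and on both
  sides the slope that is still possible after stopping there, with the factor 4 of
  \<open>side_bias\<close> and \<open>middle_bias\<close>.\<close>

definition level_error ::
  "nat \<Rightarrow> real \<Rightarrow> (nat \<Rightarrow> real) \<Rightarrow> (nat \<Rightarrow> int) \<Rightarrow> nat \<Rightarrow> (nat \<Rightarrow> real) \<Rightarrow> (nat \<Rightarrow> real) \<Rightarrow> (nat \<Rightarrow> real) \<Rightarrow> real"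
  where "level_error n \<sigma> a \<kappa> j l s e = 12 * fluctuation n a \<kappa> l j
     + (\<Sum>p\<in>{-2..2}. \<bar>noise_mean n a e j (\<kappa> j + p)\<bar>)
     + (\<Sum>r\<in>{1, -1}. 4 * (2 * mean_sd n \<sigma> j + \<bar>side_noise n a s j (\<kappa> j) r\<bar>))"

lemma mean_sd_nonneg: "0 \<le> mean_sd n \<sigma> j"
  by (simp add: mean_sd_def stop_sd_def)

lemma level_error_nonneg: "level_error n \<sigma> a \<kappa> j l s e \<ge> 0"
  unfolding level_error_def
  by (intro add_nonneg_nonneg sum_nonneg mult_nonneg_nonneg fluctuation_nonneg) (auto simp: mean_sd_nonneg)

lemma right_diff_le_iff:
  assumes "j \<le> finest n"
  shows "right_diff n l s j \<le> ereal (2 * stop_sd n \<sigma> j) \<longleftrightarrow> stops n \<sigma> s j (loc_index n l j) 1"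
  using block_sum_diff_le_iff[of 1 n j "loc_index n l j" s] valid_loc_index[OF assms]
  by (simp add: right_diff_def stops_def mean_sd_def)

lemma left_diff_le_iff:
  assumes "j \<le> finest n"
  shows "left_diff n l s j \<le> ereal (2 * stop_sd n \<sigma> j) \<longleftrightarrow> stops n \<sigma> s j (loc_index n l j) (-1)"
  using block_sum_diff_le_iff[of "-1" n j "loc_index n l j" s] valid_loc_index[OF assms]
  by (simp add: left_diff_def stops_def mean_sd_def)

lemma stop_stat_le_iff:
  assumes "j \<le> finest n"
  shows "stop_stat n l s j \<le> ereal (2 * stop_sd n \<sigma> j) \<longleftrightarrow>
    stops n \<sigma> s j (loc_index n l j) 1 \<or> stops n \<sigma> s j (loc_index n l j) (-1)"
  using right_diff_le_iff[OF assms] left_diff_le_iff[OF assms]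
  by (simp add: stop_stat_def min_le_iff_disj)

lemma j_check_cases:
  obtains (stop) j where "j \<le> finest n" "j_check n \<sigma> l s = enat j" "j_hat n \<sigma> l s = j"
      "stop_stat n l s j \<le> ereal (2 * stop_sd n \<sigma> j)" 
      "\<And>k. k < j \<Longrightarrow> \<not> stop_stat n l s k \<le> ereal (2 * stop_sd n \<sigma> k)"
  | (never) "j_check n \<sigma> l s = \<infinity>" "j_hat n \<sigma> l s = finest n" 
      "\<And>k. k \<le> finest n \<Longrightarrow> \<not> stop_stat n l s k \<le> ereal (2 * stop_sd n \<sigma> k)"
proof -
  define A where "A = {j \<in> {0..finest n}. stop_stat n l s j \<le> ereal (2 * stop_sd n \<sigma> j)}"
  have jc: "j_check n \<sigma> l s = Inf (enat ` A)" by (simp add: j_check_def A_def)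
  show thesis
  proof (cases "A = {}")
    case True
    then have "j_check n \<sigma> l s = \<infinity>" by (simp add: jc top_enat_def)
    with True show ?thesis by (intro never) (auto simp: j_hat_def A_def min_def)
  next
    case False
    have "Inf (enat ` A) \<in> enat ` A" using False
      by (simp add: Inf_enat_def) (metis (mono_tags, lifting) LeastI image_eqI ex_in_conv)
    then obtain j where j: "j \<in> A" "Inf (enat ` A) = enat j" by auto
    have "j \<le> k" if "k \<in> A" for k
      using Inf_lower[of "enat k" "enat ` A"] that j by simp
    then have "\<And>k. k < j \<Longrightarrow> k \<notin> A" by force
    then show ?thesis using j
      by (intro stop[of j]) (auto simp: jc j_hat_def A_def)
  qed
qed

context convex_sequence
begin

lemma stops_drift:
  assumes "stops n \<sigma> v j i r"
  shows "max 0 (b j (i + 6 * r) - b j (i + 5 * r)) \<le> 2 * mean_sd n \<sigma> j + \<bar>side_noise n a v j i r\<bar>"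
  using assms mean_sd_nonneg[of n \<sigma> j] unfolding stops_def side_noise_def noise_mean_def
  by (auto simp: max_def)

lemma abs_diff_le_bias:
  assumes "valid n j p" "M \<le> \<alpha> c" "b j p - \<alpha> c \<le> B" "0 \<le> B" and "block_mean n e j p = x"
  shows "\<bar>x - M\<bar> \<le> \<bar>noise_mean n a e j p\<bar> + B + (\<alpha> c - M)"
  using mean_ge_least[OF assms(1)] assms(2-) unfolding noise_mean_def by (auto simp: abs_if)

lemma bias_if_lost:
  assumes "j \<le> finest n"
  shows "\<bar>loc_index n l j - home j\<bar> \<ge> 2 \<Longrightarrow> b j (loc_index n l j) - \<alpha> c \<le> 12 * fluctuation n a (loc_index n l) l j"
  using lost_bias[OF assms, of l] by (simp add: lost_def)

lemma stopped_error:
  assumes j: "j \<le> finest n" and M: "M \<le> \<alpha> c"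
    and st: "stops n \<sigma> s j i 1 \<or> stops n \<sigma> s j i (-1)" and i: "i = loc_index n l j"
    and p: "p = i + 2 * (of_bool (stops n \<sigma> s j i 1) - of_bool (stops n \<sigma> s j i (-1)))"
  shows "valid n j p" and "\<bar>block_mean n e j p - M\<bar> \<le> level_error n \<sigma> a (loc_index n l) j l s e + (\<alpha> c - M)"
proof -
  let ?B = "12 * fluctuation n a (loc_index n l) l j"
  let ?d = "\<lambda>r. 4 * (2 * mean_sd n \<sigma> j + \<bar>side_noise n a s j i r\<bar>)"
  have d0: "?d r \<ge> 0" for r using mean_sd_nonneg[of n \<sigma> j] by simp
  have v: "valid n j i" using j i by (simp add: valid_loc_index)
  have B: "0 \<le> ?B" "\<bar>i - home j\<bar> \<ge> 2 \<Longrightarrow> b j i - \<alpha> c \<le> ?B"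
    using bias_if_lost[OF j, of l] fluctuation_nonneg i by auto
  have "valid n j p \<and> p - i \<in> {-2..2} \<and> b j p - \<alpha> c \<le> ?B + (?d 1 + ?d (-1))"
  proof (cases "stops n \<sigma> s j i 1")
    case R: True
    then have v6: "valid n j (i + 6)" by (simp add: stops_def)
    have dR: "4 * max 0 (b j (i + 6) - b j (i + 5)) \<le> ?d 1" using mult_left_mono[OF stops_drift[OF R], of 4] by simp
    show ?thesis
    proof (cases "stops n \<sigma> s j i (-1)")
      case L: True
      then have vm6: "valid n j (i - 6)" by (simp add: stops_def)
      have "4 * max 0 (b j (i - 6) - b j (i - 5)) \<le> ?d (-1)" using mult_left_mono[OF stops_drift[OF L], of 4] by simp
      with middle_bias[OF v v6 vm6 B] dR R L show ?thesis using v by (simp add: p)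
    next
      case False
      have "valid n j (i + 2)" by (rule valid_between[OF v v6]) auto
      with side_bias[of 1 j i, OF _ v _ B] v6 dR d0[of "-1"] R False show ?thesis by (simp add: p)
    qed
  next
    case False
    with st have L: "stops n \<sigma> s j i (-1)" by simp
    then have vm6: "valid n j (i - 6)" by (simp add: stops_def)
    have "4 * max 0 (b j (i - 6) - b j (i - 5)) \<le> ?d (-1)" using mult_left_mono[OF stops_drift[OF L], of 4] by simp
    moreover have "valid n j (i - 2)" by (rule valid_between[OF vm6 v]) auto
    ultimately show ?thesis using side_bias[of "-1" j i, OF _ v _ B] vm6 d0[of 1] L False by (simp add: p)
  qed
  then have vp: "valid n j p" and pi: "p - i \<in> {-2..2}" and bias: "b j p - \<alpha> c \<le> ?B + (?d 1 + ?d (-1))" by auto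
  show "valid n j p" by fact
  have "\<bar>noise_mean n a e j (i + (p - i))\<bar> \<le> (\<Sum>q\<in>{-2..2}. \<bar>noise_mean n a e j (i + q)\<bar>)"
    using pi by (intro member_le_sum[where f="\<lambda>q. \<bar>noise_mean n a e j (i + q)\<bar>"]) auto
  moreover have "\<bar>block_mean n e j p - M\<bar> \<le> \<bar>noise_mean n a e j p\<bar> + (?B + (?d 1 + ?d (-1))) + (\<alpha> c - M)"
    using B(1) d0 by (intro abs_diff_le_bias[OF vp M bias] refl) (meson add_nonneg_nonneg)
  ultimately show "\<bar>block_mean n e j p - M\<bar> \<le> level_error n \<sigma> a (loc_index n l) j l s e + (\<alpha> c - M)"
    by (simp add: level_error_def i)
qed

text \<open>At the finest level blocks are single points. The selected position \<open>p\<close> is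
  compared with a position \<open>q\<close> of small bias: the home position or, for a lost path,
  \<open>i\<close>. The error is controlled by the noise at \<open>p\<close> from below and by bias
  and noise at \<open>q\<close> from above, so selecting and estimating with the same sample does no
  harm.\<close>

lemma unstopped_error:
  fixes e :: "nat \<Rightarrow> real"
  assumes M: "M \<le> \<alpha> c" and i: "i = loc_index n l (finest n)"
    and p: "p = arg_min_on (\<lambda>k. extended n e (k - 1)) {i - 2..i + 2}"
  shows "valid n (finest n) p"
    and "\<bar>block_mean n e (finest n) p - M\<bar> \<le> level_error n \<sigma> a (loc_index n l) (finest n) l s e + (\<alpha> c - M)"
proof -
  let ?J = "finest n"
  let ?B = "12 * fluctuation n a (loc_index n l) l ?J"
  have v: "valid n ?J i" using i by (simp add: valid_loc_index)
  have bs: "(\<lambda>k. extended n e (k - 1)) = block_sum n e ?J" by (simp add: block_sum_def fun_eq_iff)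
  have S: "finite {i - 2..i + 2}" "{i - 2..i + 2} \<noteq> {}" by auto
  have pS: "p \<in> {i - 2..i + 2}" unfolding p by (rule arg_min_if_finite(1)[OF S])
  have le: "block_sum n e ?J p \<le> block_sum n e ?J q" if "q \<in> {i - 2..i + 2}" for q
    using arg_min_if_finite(2)[OF S, of "block_sum n e ?J"] that unfolding p bs by (auto simp: not_less)
  have home: "home ?J = c + 1" by (simp add: home_def)
  have vh: "valid n ?J (home ?J)" using c by (simp add: valid_def home)
  obtain q where q: "q \<in> {i - 2..i + 2}" "valid n ?J q" "b ?J q - \<alpha> c \<le> ?B"
  proof (cases "\<bar>i - home ?J\<bar> \<ge> 2")
    case True
    then show ?thesis using that[of i] v bias_if_lost[of ?J l] i by simp
  next
    case False
    have "b ?J (home ?J) = \<alpha> c" using mean_sum[OF vh] by (simp add: home)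
    moreover have "home ?J \<in> {i - 2..i + 2}" using False unfolding atLeastAtMost_iff by linarith
    ultimately show ?thesis using that[of "home ?J"] vh fluctuation_nonneg[of n a "loc_index n l" l ?J] by auto
  qed
  show vp: "valid n ?J p"
  proof (rule ccontr)
    assume "\<not> valid n ?J p"
    then show False using le[OF q(1)] block_sum_invalid block_sum_valid[OF q(2)] by simp
  qed
  have "block_mean n e ?J p \<le> block_mean n e ?J q"
    using le[OF q(1)] by (simp add: block_sum_mean vp q(2))
  then have up: "block_mean n e ?J p - \<alpha> c \<le> ?B + noise_mean n a e ?J q"
    using q(3) by (simp add: noise_mean_def)
  have low: "noise_mean n a e ?J p \<le> block_mean n e ?J p - \<alpha> c"
    using mean_ge_least[OF vp] by (simp add: noise_mean_def)
  have mem: "\<bar>noise_mean n a e ?J k\<bar> \<le> (\<Sum>r\<in>{-2..2}. \<bar>noise_mean n a e ?J (i + r)\<bar>)" if "k \<in> {i - 2..i + 2}" for k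
    using member_le_sum[of "k - i" "{-2..2}" "\<lambda>r. \<bar>noise_mean n a e ?J (i + r)\<bar>"] that by auto
  have "(\<Sum>r\<in>{1, -1}. 4 * (2 * mean_sd n \<sigma> ?J + \<bar>side_noise n a s ?J (loc_index n l ?J) r\<bar>)) \<ge> 0"
    using mean_sd_nonneg[of n \<sigma> ?J] by (intro sum_nonneg) auto
  moreover have "\<bar>block_mean n e ?J p - \<alpha> c\<bar> \<le> ?B + (\<Sum>r\<in>{-2..2}. \<bar>noise_mean n a e ?J (i + r)\<bar>)"
    using up low mem[OF pS] mem[OF q(1)] fluctuation_nonneg[of n a "loc_index n l" l ?J] by linarith
  ultimately show "\<bar>block_mean n e ?J p - M\<bar> \<le> level_error n \<sigma> a (loc_index n l) ?J l s e + (\<alpha> c - M)"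
    using M unfolding level_error_def i[symmetric] by linarith
qed

lemma M_split_error:
  assumes M: "M \<le> \<alpha> c" and \<sigma>: "\<sigma> > 0"
  obtains j where "j \<le> finest n" 
    "\<And>k. k < j \<Longrightarrow> \<not> stops n \<sigma> s k (loc_index n l k) 1 \<and> \<not> stops n \<sigma> s k (loc_index n l k) (-1)"
    "\<bar>M_split n \<sigma> l s e - ereal M\<bar> \<le> ereal (level_error n \<sigma> a (loc_index n l) j l s e + (\<alpha> c - M))"
proof -
  have fin: "ereal (1 / 2 ^ (finest n - j)) * block_sum n e j p = ereal (block_mean n e j p)"
    if "valid n j p" for j p
    using that by (simp add: block_sum_mean len_def)
  have crit: "2 * sqrt 6 * \<sigma> * sqrt (2 ^ (finest n - j)) = 2 * stop_sd n \<sigma> j" for j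
    using \<sigma> by (simp add: stop_sd_def real_sqrt_mult)
  show thesis
  proof (cases rule: j_check_cases[where n=n and \<sigma>=\<sigma> and l=l and s=s])
    case (stop j)
    let ?i = "loc_index n l j"
    let ?p = "?i + 2 * (of_bool (stops n \<sigma> s j ?i 1) - of_bool (stops n \<sigma> s j ?i (-1)))"
    have idx: "final_index n \<sigma> l s e = ?p"
      unfolding final_index_def shift_def Let_def stop(2,3) crit
      using right_diff_le_iff[OF stop(1)] left_diff_le_iff[OF stop(1)] by simp
    have st: "stops n \<sigma> s j ?i 1 \<or> stops n \<sigma> s j ?i (-1)"
      using stop(4) stop_stat_le_iff[OF stop(1)] by simp
    note err = stopped_error[OF stop(1) M st refl refl]
    have "M_split n \<sigma> l s e = ereal (block_mean n e j ?p)"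
      unfolding M_split_def Let_def stop(3) idx by (rule fin[OF err(1)])
    then show thesis using stop(1,5) err(2) stop_stat_le_iff[of _ n l s \<sigma>]
      by (intro that[of j]) auto
  next
    case never
    let ?i = "loc_index n l (finest n)"
    let ?p = "arg_min_on (\<lambda>k. extended n e (k - 1)) {?i - 2..?i + 2}"
    have idx: "final_index n \<sigma> l s e = ?p"
      unfolding final_index_def Let_def never(1,2) by simp
    note err = unstopped_error[OF M refl refl]
    have "M_split n \<sigma> l s e = ereal (block_mean n e (finest n) ?p)"
      unfolding M_split_def Let_def never(2) idx by (rule fin[OF err(1)])
    then show thesis using never(3) err(2) stop_stat_le_iff[of _ n l s \<sigma>]
      by (intro that[of "finest n"]) auto
  qed
qed

end

section \<open>Expectations along the path\<close>

text \<open>Ties are broken by Hilbert choice. Measurability survives because the choice is applied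
  to the set of minimizers, and this set ranges over the finite \<open>Pow S\<close>.\<close>

lemma measurable_arg_min_on:
  fixes F :: "'i \<Rightarrow> 'a \<Rightarrow> ereal"
  assumes S: "finite S" and F: "\<And>i. F i \<in> borel_measurable M"
  shows "(\<lambda>x. arg_min_on (\<lambda>i. F i x) S) \<in> M \<rightarrow>\<^sub>M count_space UNIV"
proof -
  define B where "B x = {i\<in>S. \<forall>k\<in>S. \<not> F k x < F i x}" for x
  have eq: "(\<lambda>x. arg_min_on (\<lambda>i. F i x) S) = (\<lambda>T. SOME i. i \<in> T) \<circ> B"
    by (auto simp: fun_eq_iff arg_min_on_def arg_min_def is_arg_min_def B_def intro!: arg_cong[where f=Eps])
  have "B \<in> M \<rightarrow>\<^sub>M count_space (Pow S)"
  proof (subst measurable_count_space_eq2, safe)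
    fix T assume "T \<subseteq> S"
    have iB: "i \<in> B x \<longleftrightarrow> (\<forall>k\<in>S. \<not> F k x < F i x)" if "i \<in> S" for i x
      using that by (simp add: B_def)
    have "B x = T \<longleftrightarrow> (\<forall>i\<in>S. (i \<in> T \<longrightarrow> i \<in> B x) \<and> (i \<in> B x \<longrightarrow> i \<in> T))" for x
      using \<open>T \<subseteq> S\<close> B_def by blast
    then have "B -` {T} \<inter> space M = {x\<in>space M. \<forall>i\<in>S. (i \<in> T \<longrightarrow> (\<forall>k\<in>S. \<not> F k x < F i x)) \<and> ((\<forall>k\<in>S. \<not> F k x < F i x) \<longrightarrow> i \<in> T)}"
      using iB by auto
    also have "\<dots> \<in> sets M"
      by (intro sets.sets_Collect_finite_All sets.sets_Collect_conj sets.sets_Collect_imp sets.sets_Collect_neg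
          sets.sets_Collect_const borel_measurable_less F S)
    finally show "B -` {T} \<inter> space M \<in> sets M" .
  qed (use S in \<open>auto simp: B_def\<close>)
  then show ?thesis unfolding eq by (rule measurable_comp) simp
qed

lemma measurable_block_sum [measurable]: "(\<lambda>v. block_sum n v j i) \<in> borel_measurable (sample_space n)"
  by (cases "valid n j i") (simp_all add: block_sum_valid block_sum_invalid)

lemma measurable_loc_index [measurable]: "(\<lambda>l. loc_index n l j) \<in> sample_space n \<rightarrow>\<^sub>M count_space UNIV"
proof (induction j)
  case (Suc j)
  have "(\<lambda>l. arg_min_on (block_sum n l (Suc j)) {max (2 * i - 2) 1 .. min (2 * i + 1) (block_count n (Suc j))})
      \<in> sample_space n \<rightarrow>\<^sub>M count_space UNIV" for i
    by (rule measurable_arg_min_on) auto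
  from measurable_compose_countable[OF this Suc] show ?case by (simp add: loc_index.simps)
qed simp

lemma measurable_noise_mean [measurable]: "(\<lambda>v. noise_mean n a v j i) \<in> borel_measurable (sample_space n)"
  unfolding noise_mean_def block_mean_def by measurable

lemma measurable_split_noise [measurable]: "(\<lambda>v. split_noise n a v j i) \<in> borel_measurable (sample_space n)"
  unfolding split_noise_def by measurable

lemma measurable_split_noise_path [measurable]:
  "(\<lambda>l. split_noise n a l (Suc k) (loc_index n l k + p)) \<in> borel_measurable (sample_space n)"
  by (rule measurable_compose_countable[where f="\<lambda>i l. split_noise n a l (Suc k) (i + p)"]) measurable

lemma measurable_side_noise [measurable]: "(\<lambda>v. side_noise n a v j i r) \<in> borel_measurable (sample_space n)"
  unfolding side_noise_def by measurable

lemma measurable_fluctuation [measurable]: "(\<lambda>v. fluctuation n a \<kappa> v j) \<in> borel_measurable (sample_space n)"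
  unfolding fluctuation_def by measurable

text \<open>Cut off at \<open>finest n\<close> so that there are finitely many paths, over which
  expectations are decomposed.\<close>

definition path :: "nat \<Rightarrow> (nat \<Rightarrow> real) \<Rightarrow> nat \<Rightarrow> int" where
  "path n l = (\<lambda>j\<in>{0..finest n}. loc_index n l j)"

definition paths :: "nat \<Rightarrow> (nat \<Rightarrow> int) set" where
  "paths n = range (path n)"

lemma loc_index_range: "j \<le> finest n \<Longrightarrow> loc_index n l j \<in> {1..int n + 1}"
proof -
  assume "j \<le> finest n"
  then have "valid n j (loc_index n l j)" by (rule valid_loc_index)
  moreover from this have "loc_index n l j * 1 \<le> loc_index n l j * len n j"
    by (intro mult_left_mono) (auto simp: valid_def)
  ultimately show ?thesis unfolding valid_def atLeastAtMost_iff by linarith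
qed

lemma finite_paths: "finite (paths n)"
  by (rule finite_subset[of _ "{0..finest n} \<rightarrow>\<^sub>E {1..int n + 1}"])
     (auto simp: paths_def path_def loc_index_range[unfolded atLeastAtMost_iff] intro!: finite_PiE)

lemma measurable_path [measurable]: "Measurable.pred (sample_space n) (\<lambda>l. path n l = \<kappa>)"
proof (cases "\<kappa> \<in> extensional {0..finest n}")
  case True
  then have "path n l = \<kappa> \<longleftrightarrow> (\<forall>j\<in>{0..finest n}. loc_index n l j = \<kappa> j)" for l
    by (auto simp: path_def fun_eq_iff extensional_def)
  then show ?thesis by simp
next
  case False
  then have "path n l \<noteq> \<kappa>" for l by (auto simp: path_def)
  then show ?thesis by simp
qed

section \<open>Translations of the path and moments of linear functionals\<close>

lemma dot_diff_left: "dot n (\<lambda>k. u k - v k) x = dot n u x - dot n v x"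
  by (simp add: dot_def left_diff_distrib sum_subtractf)

lemma dot_scale_left: "dot n (\<lambda>k. t * u k) x = t * dot n u x"
  by (simp add: dot_def sum_distrib_left mult.assoc)

lemma dot_sum_left: "dot n (\<lambda>k. \<Sum>i\<in>A. u i k) x = (\<Sum>i\<in>A. dot n (u i) x)"
  unfolding dot_def sum_distrib_right by (rule sum.swap)

lemma dot_commute: "dot n u v = dot n v u"
  by (simp add: dot_def mult.commute)

lemma dot_zero [simp]: "dot n (\<lambda>_. 0) x = 0" "dot n x (\<lambda>_. 0) = 0"
  by (simp_all add: dot_def)

lemma dot_translate: "dot n u (translate n v x) = dot n u x + dot n u v"
  by (simp add: dot_def translate_def distrib_left sum.distrib)

text \<open>This stands in for independence: up to level \<open>j\<close> the path sees the sample
  only through sums over complete blocks, so a direction with vanishing sums there does not move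
  it.\<close>

lemma loc_index_translate:
  assumes "\<And>k i. k \<le> j \<Longrightarrow> valid n k i \<Longrightarrow> block_total n u k i = 0"
  shows "loc_index n (translate n u l) j = loc_index n l j"
  using assms
proof (induction j)
  case (Suc j)
  have "block_sum n (translate n u l) (Suc j) i = block_sum n l (Suc j) i" for i
    using Suc.prems[of "Suc j" i] by (cases "valid n (Suc j) i") (simp_all add: block_sum_valid block_sum_invalid dot_translate)
  then have "block_sum n (translate n u l) (Suc j) = block_sum n l (Suc j)" by auto
  with Suc show ?case by (simp add: loc_index.simps)
qed simp

definition scale3 :: "real \<Rightarrow> sample3 \<Rightarrow> sample3" where
  "scale3 t = (\<lambda>(u, v, w). (\<lambda>k. t * u k, \<lambda>k. t * v k, \<lambda>k. t * w k))"

lemma dot3_scale: "dot3 n (scale3 t d) x = t * dot3 n d x" "dot3 n x (scale3 t d) = t * dot3 n x d"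
  by (cases d; cases x; simp add: dot3_def scale3_def dot_def sum_distrib_left algebra_simps)+

text \<open>The three samples have the same mean vector; \<open>diag3 (grid n f)\<close> is their
  joint mean.\<close>

definition diag3 :: "(nat \<Rightarrow> real) \<Rightarrow> sample3" where
  "diag3 a = (a, a, a)"

lemma samples_exp:
  assumes g[measurable]: "g \<in> borel_measurable (sample_space3 n)" and \<sigma>: "\<sigma> > 0"
    and inv: "\<And>\<omega>. \<omega> \<in> space (sample_space3 n) \<Longrightarrow> g (translate3 n (3 * \<sigma>\<^sup>2) d \<omega>) = g \<omega>"
  shows "(\<integral>\<^sup>+\<omega>. g \<omega> * ennreal (exp (dot3 n d \<omega> - dot3 n d (diag3 (grid n f)))) \<partial>samples n \<sigma> f) =
    ennreal (exp (3 * \<sigma>\<^sup>2 / 2 * dot3 n d d)) * (\<integral>\<^sup>+\<omega>. g \<omega> \<partial>samples n \<sigma> f)"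
proof -
  have "(\<integral>\<^sup>+\<omega>. g \<omega> \<partial>samples n \<sigma> f) =
    (\<integral>\<^sup>+\<omega>. g \<omega> * ennreal (exp (dot3 n d \<omega> - dot3 n d (diag3 (grid n f)) - 3 * \<sigma>\<^sup>2 / 2 * dot3 n d d)) \<partial>samples n \<sigma> f)"
    using samples_shift[OF g \<sigma>, where d=d and f=f] inv
    by (simp add: diag3_def sets_eq_imp_space_eq[OF sets_samples] cong: nn_integral_cong_simp)
  then have "ennreal (exp (3 * \<sigma>\<^sup>2 / 2 * dot3 n d d)) * (\<integral>\<^sup>+\<omega>. g \<omega> \<partial>samples n \<sigma> f) = (\<integral>\<^sup>+\<omega>. ennreal (exp (3 * \<sigma>\<^sup>2 / 2 * dot3 n d d)) *
    (g \<omega> * ennreal (exp (dot3 n d \<omega> - dot3 n d (diag3 (grid n f)) - 3 * \<sigma>\<^sup>2 / 2 * dot3 n d d))) \<partial>samples n \<sigma> f)"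
    by (subst nn_integral_cmult) auto
  also have "\<dots> = (\<integral>\<^sup>+\<omega>. g \<omega> * ennreal (exp (dot3 n d \<omega> - dot3 n d (diag3 (grid n f)))) \<partial>samples n \<sigma> f)"
  proof (intro nn_integral_cong)
    fix \<omega>
    have "ennreal (exp K) * (y * ennreal (exp (x - K))) = y * ennreal (exp x)" for x K y
    proof -
      have "ennreal (exp K) * ennreal (exp (x - K)) = ennreal (exp x)"
        by (simp add: ennreal_mult'[symmetric] exp_add[symmetric])
      then show ?thesis by (metis mult.left_commute)
    qed
    then show "ennreal (exp (3 * \<sigma>\<^sup>2 / 2 * dot3 n d d)) *
      (g \<omega> * ennreal (exp (dot3 n d \<omega> - dot3 n d (diag3 (grid n f)) - 3 * \<sigma>\<^sup>2 / 2 * dot3 n d d))) =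
      g \<omega> * ennreal (exp (dot3 n d \<omega> - dot3 n d (diag3 (grid n f))))" .
  qed
  finally show ?thesis ..
qed

text \<open>The absolute value of \<open>x\<close> is at most
  \<open>r * exp (x / r) + r * exp (- x / r)\<close>. As \<open>r\<^sup>2\<close> bounds the
  variance, each of the two exponential moments costs at most \<open>exp (1 / 2)\<close>, hence at
  most 2.\<close>

lemma samples_abs:
  assumes g[measurable]: "g \<in> borel_measurable (sample_space3 n)" and \<sigma>: "\<sigma> > 0"
    and inv: "\<And>t \<omega>. \<omega> \<in> space (sample_space3 n) \<Longrightarrow> g (translate3 n (3 * \<sigma>\<^sup>2) (scale3 t d) \<omega>) = g \<omega>"
    and r: "r > 0" "3 * \<sigma>\<^sup>2 * dot3 n d d \<le> r\<^sup>2"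
  shows "(\<integral>\<^sup>+\<omega>. g \<omega> * ennreal \<bar>dot3 n d \<omega> - dot3 n d (diag3 (grid n f))\<bar> \<partial>samples n \<sigma> f) \<le>
    ennreal (4 * r) * (\<integral>\<^sup>+\<omega>. g \<omega> \<partial>samples n \<sigma> f)"
proof -
  let ?X = "\<lambda>\<omega>. dot3 n d \<omega> - dot3 n d (diag3 (grid n f))"
  let ?I = "\<integral>\<^sup>+\<omega>. g \<omega> \<partial>samples n \<sigma> f"
  have e: "(\<integral>\<^sup>+\<omega>. g \<omega> * ennreal (exp (t * ?X \<omega>)) \<partial>samples n \<sigma> f) \<le> ennreal 2 * ?I" if t: "t = 1 / r \<or> t = - 1 / r" for t
  proof -
    have "(\<integral>\<^sup>+\<omega>. g \<omega> * ennreal (exp (t * ?X \<omega>)) \<partial>samples n \<sigma> f) = ennreal (exp (3 * \<sigma>\<^sup>2 / 2 * (t * (t * dot3 n d d)))) * ?I"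
      using samples_exp[OF g \<sigma>, of "scale3 t d" f] inv by (simp add: dot3_scale right_diff_distrib)
    also have "3 * \<sigma>\<^sup>2 / 2 * (t * (t * dot3 n d d)) = 3 * \<sigma>\<^sup>2 * dot3 n d d / r\<^sup>2 / 2"
      using t by (auto simp: power2_eq_square)
    also have "3 * \<sigma>\<^sup>2 * dot3 n d d / r\<^sup>2 / 2 \<le> 1 / 2"
    proof -
      have "3 * \<sigma>\<^sup>2 * dot3 n d d / r\<^sup>2 \<le> 1" unfolding divide_le_eq_1 using r by auto
      then show ?thesis by (rule divide_right_mono) simp
    qed
    also have "exp (1 / 2 :: real) \<le> 2" 
    proof -
      have "(exp (1 / 2 :: real))\<^sup>2 \<le> 2\<^sup>2" using exp_le by (simp add: power2_eq_square flip: exp_add)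
      then show ?thesis by (rule power2_le_imp_le) simp
    qed
    finally show ?thesis by (simp add: mult_right_mono ennreal_leI)
  qed
  have pw: "\<bar>x\<bar> \<le> r * exp (1 / r * x) + r * exp (- 1 / r * x)" for x
  proof -
    have "\<bar>x / r\<bar> \<le> exp (x / r) + exp (- (x / r))"
      using exp_ge_add_one_self[of "x / r"] exp_ge_add_one_self[of "- (x / r)"] by (smt (verit) exp_gt_zero)
    then have "r * \<bar>x / r\<bar> \<le> r * (exp (x / r) + exp (- (x / r)))" using r(1) by (intro mult_left_mono) auto
    then show ?thesis using r(1) by (simp add: abs_mult distrib_left)
  qed
  have "(\<integral>\<^sup>+\<omega>. g \<omega> * ennreal \<bar>?X \<omega>\<bar> \<partial>samples n \<sigma> f) \<le>
     (\<integral>\<^sup>+\<omega>. ennreal r * (g \<omega> * ennreal (exp (1 / r * ?X \<omega>))) + ennreal r * (g \<omega> * ennreal (exp (- 1 / r * ?X \<omega>))) \<partial>samples n \<sigma> f)"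
  proof (rule nn_integral_mono)
    fix \<omega>
    have "g \<omega> * ennreal \<bar>?X \<omega>\<bar> \<le> g \<omega> * ennreal (r * exp (1 / r * ?X \<omega>) + r * exp (- 1 / r * ?X \<omega>))"
      by (intro mult_left_mono ennreal_leI pw) auto
    also have "\<dots> = ennreal r * (g \<omega> * ennreal (exp (1 / r * ?X \<omega>))) + ennreal r * (g \<omega> * ennreal (exp (- 1 / r * ?X \<omega>)))"
      using r(1) by (simp add: ennreal_plus ennreal_mult distrib_left mult_ac del: ennreal_plus[symmetric])
    finally show "g \<omega> * ennreal \<bar>?X \<omega>\<bar> \<le> \<dots>" .
  qed
  also have "\<dots> = ennreal r * (\<integral>\<^sup>+\<omega>. g \<omega> * ennreal (exp (1 / r * ?X \<omega>)) \<partial>samples n \<sigma> f)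
       + ennreal r * (\<integral>\<^sup>+\<omega>. g \<omega> * ennreal (exp (- 1 / r * ?X \<omega>)) \<partial>samples n \<sigma> f)"
    by (subst nn_integral_add) (simp_all add: nn_integral_cmult)
  also have "\<dots> \<le> ennreal r * (ennreal 2 * ?I) + ennreal r * (ennreal 2 * ?I)"
    by (intro add_mono mult_left_mono e) auto
  also have "\<dots> = ennreal (4 * r) * ?I"
  proof -
    have "(4 :: ennreal) = 2 * 2" by simp
    then have "(4 :: ennreal) * y = y + y + (y + y)" for y by (metis mult.assoc mult_2)
    moreover have "ennreal (4 * r) = 4 * ennreal r" using r(1) by (simp add: ennreal_mult')
    ultimately show ?thesis by (simp add: mult.assoc mult_2 distrib_left distrib_right)
  qed
  finally show ?thesis .
qed

section \<open>Orthogonality of block directions\<close>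

lemma dot_scale_right: "dot n x (\<lambda>k. t * u k) = t * dot n x u"
  unfolding dot_commute[of n x] by (rule dot_scale_left)

lemma dot_diff_right: "dot n x (\<lambda>k. u k - v k) = dot n x u - dot n x v"
  unfolding dot_commute[of n x] by (rule dot_diff_left)

lemma translate_zero: "x \<in> space (sample_space n) \<Longrightarrow> translate n (\<lambda>_. 0) x = x"
  by (auto simp: translate_def space_PiM fun_eq_iff PiE_def extensional_def)

lemma block_disjoint:
  assumes "i * len n j \<le> (i' - 1) * len n j' \<or> i' * len n j' \<le> (i - 1) * len n j"
  shows "dot n (block n j i) (block n j' i') = 0"
  unfolding dot_def block_def using assms by (intro sum.neutral) auto

lemma block_orth: "i \<noteq> i' \<Longrightarrow> dot n (block n j i) (block n j i') = 0"
proof (rule block_disjoint)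
  assume "i \<noteq> i'"
  then have "i \<le> i' - 1 \<or> i' \<le> i - 1" by linarith
  then show "i * len n j \<le> (i' - 1) * len n j \<or> i' * len n j \<le> (i - 1) * len n j"
    by (auto intro!: mult_right_mono)
qed

lemma block_idem: "dot n (block n j i) (block n j i) = dot n (\<lambda>_. 1) (block n j i)"
  unfolding dot_def block_def by (intro sum.cong) auto

lemma block_norm_le: "dot n (block n j i) (block n j i) \<le> of_int (len n j)"
proof -
  let ?S = "{k \<in> {0..n}. (i - 1) * len n j \<le> int k \<and> int k < i * len n j}"
  have "dot n (block n j i) (block n j i) = (\<Sum>k\<in>{0..n}. if (i - 1) * len n j \<le> int k \<and> int k < i * len n j then 1 else 0)"
    unfolding dot_def block_def by (intro sum.cong) auto
  also have "\<dots> = (\<Sum>k\<in>?S. 1)" by (rule sum.inter_filter[symmetric]) simp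
  finally have "dot n (block n j i) (block n j i) = real (card ?S)" by simp
  also have "card ?S \<le> card {(i - 1) * len n j..i * len n j - 1}"
    by (rule card_inj_on_le[of int]) auto
  also have "real (card {(i - 1) * len n j..i * len n j - 1}) = of_int (len n j)"
    by (simp add: algebra_simps)
  finally show ?thesis by simp
qed

lemma block_norm_valid:
  assumes "valid n j i"
  shows "dot n (block n j i) (block n j i) = of_int (len n j)"
proof -
  have "dot n (block n j i) (block n j i) = block_total n (\<lambda>_. 1) j i"
    unfolding block_idem by (rule dot_commute)
  also have "\<dots> = of_int (len n j)"
    unfolding block_total_valid[OF assms] by (simp add: algebra_simps)
  finally show ?thesis .
qed

text \<open>A complete block at level \<open>k\<close> or coarser contains both halves of block
  \<open>p\<close> or misses both. Hence the contrast of the halves has zero sum on every block that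
  decides the path up to level \<open>k\<close>.\<close>

lemma children_balanced:
  assumes "k < finest n" "j \<le> k" "valid n j i"
  shows "block_total n (block n (Suc k) (2 * p - 1)) j i = block_total n (block n (Suc k) (2 * p)) j i"
  using assms(2,3)
proof (induction "k - j" arbitrary: j i)
  case 0
  then have j: "j = k" by simp
  note ch = valid_children[OF assms(1), of i]
  show ?case
  proof (cases "i = p")
    case True
    then show ?thesis using ch 0 j assms(1)
      by (simp add: block_total_split[OF assms(1)] block_norm_valid block_orth)
  next
    case False
    then have "2 * i - 1 \<noteq> 2 * p - 1" "2 * i \<noteq> 2 * p - 1" "2 * i - 1 \<noteq> 2 * p" "2 * i \<noteq> 2 * p"
      by presburger+
    then show ?thesis using j by (simp add: block_total_split[OF assms(1)] block_orth)
  qed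
next
  case (Suc m)
  then have "j < finest n" using assms(1) by simp
  note ch = valid_children[OF this, of i]
  show ?case unfolding block_total_split[OF \<open>j < finest n\<close>]
    using Suc.hyps(1)[of "Suc j"] Suc.hyps(2) Suc.prems ch by simp
qed

lemma len_double: "j < j' \<Longrightarrow> j' \<le> finest n \<Longrightarrow> 2 * len n j' \<le> len n j"
proof (induction j')
  case (Suc k)
  have "len n k = 2 * len n (Suc k)" using Suc.prems by (intro len_Suc) simp
  moreover have "0 < len n (Suc k)" by (rule len_pos)
  moreover have "len n k \<le> len n j"
  proof (cases "j = k")
    case False
    then have "2 * len n k \<le> len n j" using Suc by simp
    with len_pos[of n k] show ?thesis by linarith
  qed simp
  ultimately show ?case by linarith
qed simp

lemma loc_index_near:
  assumes "j < finest n"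
  shows "2 * loc_index n l j - 2 \<le> loc_index n l (Suc j)" "loc_index n l (Suc j) \<le> 2 * loc_index n l j + 1"
  using loc_index_step(1)[OF assms, of l] valid_loc_index[of j n l] assms by auto

text \<open>The offsets come from the fixed points of the extreme moves: going from \<open>i\<close>
  to \<open>2 * i + 1\<close> doubles \<open>i + 1\<close>, and going from \<open>i\<close> to
  \<open>2 * i - 2\<close> doubles \<open>i - 2\<close>. Doubling is compensated by halving the
  length, so the intervals are nested along the path.\<close>

lemma path_interval:
  assumes "j \<le> j'" "j' \<le> finest n"
  shows "(loc_index n l j' + 1) * len n j' \<le> (loc_index n l j + 1) * len n j"
    and "(loc_index n l j - 2) * len n j \<le> (loc_index n l j' - 2) * len n j'"
  using assms
proof (induction j' rule: dec_induct)
  case (step k)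
  {
    case 1
    have "(loc_index n l (Suc k) + 1) * len n (Suc k) \<le> (2 * (loc_index n l k + 1)) * len n (Suc k)"
      using 1 loc_index_near[of k n l] by (intro mult_right_mono) auto
    also have "\<dots> = (loc_index n l k + 1) * len n k" using 1 len_Suc[of k n] by simp
    finally show ?case using step 1 by simp
  next
    case 2
    have "(loc_index n l k - 2) * len n k = (2 * (loc_index n l k - 2)) * len n (Suc k)"
      using 2 len_Suc[of k n] by simp
    also have "\<dots> \<le> (loc_index n l (Suc k) - 2) * len n (Suc k)"
      using 2 loc_index_near[of k n l] by (intro mult_right_mono) auto
    finally show ?case using step 2 by simp
  }
qed auto

text \<open>By nesting, and since lengths at least halve, blocks of offset at most 6 at a finer
  level lie between \<open>(loc_index n l j - 5) * len n j\<close> and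
  \<open>(loc_index n l j + 4) * len n j\<close>. These are the inner ends of the blocks of offset
  -5 and 5.\<close>

lemma path_blocks_orth:
  assumes j: "j < j'" "j' \<le> finest n" and x: "\<bar>x\<bar> \<ge> 5" and y: "\<bar>y\<bar> \<le> 6"
  shows "dot n (block n j (loc_index n l j + x)) (block n j' (loc_index n l j' + y)) = 0"
proof (rule block_disjoint)
  let ?\<kappa> = "loc_index n l"
  define L L' where "L = len n j" "L' = len n j'"
  have L: "L' \<ge> 1" "2 * L' \<le> L" using len_double[OF j] by (simp_all add: L_L'_def)
  have U: "(?\<kappa> j' + 1) * L' \<le> (?\<kappa> j + 1) * L" and D: "(?\<kappa> j - 2) * L \<le> (?\<kappa> j' - 2) * L'"
    using path_interval[of j j' n l] j by (simp_all add: L_L'_def)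
  have eqs: "(?\<kappa> j' + 1) * L' = ?\<kappa> j' * L' + L'" "(?\<kappa> j + 1) * L = ?\<kappa> j * L + L"
    "(?\<kappa> j - 2) * L = ?\<kappa> j * L - 2 * L" "(?\<kappa> j' - 2) * L' = ?\<kappa> j' * L' - 2 * L'" by (simp_all add: algebra_simps)
  from x consider "x \<ge> 5" | "x \<le> -5" by linarith
  then show "(?\<kappa> j + x) * len n j \<le> (?\<kappa> j' + y - 1) * len n j' \<or> (?\<kappa> j' + y) * len n j' \<le> (?\<kappa> j + x - 1) * len n j"
    unfolding L_L'_def[symmetric]
  proof cases
    case 1
    have "(?\<kappa> j' + y) * L' \<le> (?\<kappa> j' + 6) * L'" using y L by (intro mult_right_mono) auto
    also have "\<dots> = ?\<kappa> j' * L' + 6 * L'" by (simp add: algebra_simps)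
    also have "\<dots> \<le> ?\<kappa> j * L + 4 * L" using U L unfolding eqs by linarith
    also have "\<dots> = (?\<kappa> j + 4) * L" by (simp add: algebra_simps)
    also have "\<dots> \<le> (?\<kappa> j + x - 1) * L" using 1 L by (intro mult_right_mono) auto
    finally show "(?\<kappa> j + x) * L \<le> (?\<kappa> j' + y - 1) * L' \<or> (?\<kappa> j' + y) * L' \<le> (?\<kappa> j + x - 1) * L" ..
  next
    case 2
    have "(?\<kappa> j + x) * L \<le> (?\<kappa> j - 5) * L" using 2 L by (intro mult_right_mono) auto
    also have "\<dots> = ?\<kappa> j * L - 5 * L" by (simp add: algebra_simps)
    also have "\<dots> \<le> ?\<kappa> j' * L' - 7 * L'" using D L unfolding eqs by linarith
    also have "\<dots> = (?\<kappa> j' - 7) * L'" by (simp add: algebra_simps)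
    also have "\<dots> \<le> (?\<kappa> j' + y - 1) * L'" using y L by (intro mult_right_mono) auto
    finally show "(?\<kappa> j + x) * L \<le> (?\<kappa> j' + y - 1) * L' \<or> (?\<kappa> j' + y) * L' \<le> (?\<kappa> j + x - 1) * L" ..
  qed
qed

definition block_dir :: "nat \<Rightarrow> nat \<Rightarrow> int \<Rightarrow> nat \<Rightarrow> real" where
  "block_dir n j i k = 1 / of_int (len n j) * block n j i k"

definition side_dir :: "nat \<Rightarrow> nat \<Rightarrow> int \<Rightarrow> int \<Rightarrow> nat \<Rightarrow> real" where
  "side_dir n j i r k = block_dir n j (i + 6 * r) k - block_dir n j (i + 5 * r) k"

definition split_dir :: "nat \<Rightarrow> nat \<Rightarrow> int \<Rightarrow> nat \<Rightarrow> real" where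
  "split_dir n j p k = 1 / 2 * (block_dir n j (2 * p - 1) k - block_dir n j (2 * p) k)"

lemma dot_block_dir: "dot n (block_dir n j i) v = block_mean n v j i"
  unfolding block_dir_def dot_scale_left block_mean_def by simp

lemma noise_mean_dot: "noise_mean n a v j i = dot n (block_dir n j i) v - dot n (block_dir n j i) a"
  by (simp add: dot_block_dir noise_mean_def)

lemma side_noise_dot: "side_noise n a v j i r = dot n (side_dir n j i r) v - dot n (side_dir n j i r) a"
  unfolding side_dir_def dot_diff_left dot_block_dir side_noise_def noise_mean_def by simp

lemma split_noise_dot: "split_noise n a v j p = dot n (split_dir n j p) v - dot n (split_dir n j p) a"
  unfolding split_dir_def dot_scale_left dot_diff_left dot_block_dir split_noise_def noise_mean_def by (simp add: field_simps)

lemma block_dir_dot: "dot n (block_dir n j i) (block_dir n j' i') =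
    dot n (block n j i) (block n j' i') / (of_int (len n j) * of_int (len n j'))"
  unfolding block_dir_def dot_scale_left dot_commute[of n "block n j i"] by (simp add: dot_commute)

lemma block_dir_norm: "dot n (block_dir n j i) (block_dir n j i) \<le> 1 / of_int (len n j)"
  unfolding block_dir_dot using block_norm_le[of n j i] by (simp add: pos_divide_le_eq)

lemma dot_diff_diff:
  assumes "dot n u v = 0"
  shows "dot n (\<lambda>k. u k - v k) (\<lambda>k. u k - v k) = dot n u u + dot n v v"
  unfolding dot_diff_left dot_commute[of n _ "\<lambda>k. u k - v k"] using assms by (simp add: dot_commute[of n v u])

lemma side_dir_norm: 
  assumes "r \<noteq> 0" shows "dot n (side_dir n j i r) (side_dir n j i r) \<le> 2 / of_int (len n j)"
proof -
  have "dot n (block_dir n j (i + 6 * r)) (block_dir n j (i + 5 * r)) = 0"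
    using assms by (simp add: block_dir_dot block_orth)
  then have "dot n (side_dir n j i r) (side_dir n j i r) = dot n (block_dir n j (i + 6 * r)) (block_dir n j (i + 6 * r))
     + dot n (block_dir n j (i + 5 * r)) (block_dir n j (i + 5 * r))"
    unfolding side_dir_def by (rule dot_diff_diff)
  then show ?thesis using block_dir_norm[of n j "i + 6 * r"] block_dir_norm[of n j "i + 5 * r"] by linarith
qed

text \<open>A generous bound, stated in the form that \<open>norm_bounds\<close> takes.\<close>

lemma split_dir_norm: "dot n (split_dir n j p) (split_dir n j p) \<le> 2 / of_int (len n j)"
proof -
  have "dot n (block_dir n j (2 * p - 1)) (block_dir n j (2 * p)) = 0"
    by (simp add: block_dir_dot block_orth)
  note d = dot_diff_diff[OF this]
  have "dot n (split_dir n j p) (split_dir n j p) = 1 / 4 * (dot n (block_dir n j (2 * p - 1)) (block_dir n j (2 * p - 1))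
     + dot n (block_dir n j (2 * p)) (block_dir n j (2 * p)))"
    unfolding d[symmetric] unfolding split_dir_def dot_scale_left dot_scale_right by simp
  moreover have "x \<le> 2 * c" if "x = 1 / 4 * (y + z)" "y \<le> c" "z \<le> c" "0 \<le> c" for x y z c :: real
    using that by simp
  from this[OF calculation block_dir_norm block_dir_norm] show ?thesis by simp
qed

lemma side_dir_orth:
  assumes j: "j < j'" "j' \<le> finest n" and r: "r \<in> {1, -1}" "r' \<in> {1, -1}"
  shows "dot n (side_dir n j (loc_index n l j) r) (side_dir n j' (loc_index n l j') r') = 0"
proof -
  have z: "dot n (block_dir n j (loc_index n l j + x)) (block_dir n j' (loc_index n l j' + y)) = 0"
    if "x \<in> {6 * r, 5 * r}" "y \<in> {6 * r', 5 * r'}" for x y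
    unfolding block_dir_dot using that r by (subst path_blocks_orth[OF j]) auto
  have w: "dot n (block_dir n j (loc_index n l j + x)) (side_dir n j' (loc_index n l j') r') = 0" if "x \<in> {6 * r, 5 * r}" for x
    unfolding side_dir_def by (subst dot_commute, subst dot_diff_left) (use z[OF that] in \<open>simp add: dot_commute\<close>)
  show ?thesis unfolding side_dir_def[of n j] dot_diff_left using w by simp
qed

section \<open>Standard deviations across levels, and the weights\<close>

lemma mean_sd_sq: "(mean_sd n \<sigma> j)\<^sup>2 = 6 * \<sigma>\<^sup>2 / of_int (len n j)"
proof -
  have "(stop_sd n \<sigma> j)\<^sup>2 = 6 * of_int (len n j) * \<sigma>\<^sup>2" by (simp add: stop_sd_def len_def)
  then show ?thesis by (simp add: mean_sd_def power_divide power2_eq_square)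
qed

lemma mean_sd_pos: "\<sigma> > 0 \<Longrightarrow> mean_sd n \<sigma> j > 0"
  by (simp add: mean_sd_def stop_sd_def)

lemma mean_sd_Suc: 
  assumes "j < finest n" "\<sigma> > 0" shows "mean_sd n \<sigma> (Suc j) = sqrt 2 * mean_sd n \<sigma> j"
proof -
  have "(mean_sd n \<sigma> (Suc j))\<^sup>2 = (sqrt 2 * mean_sd n \<sigma> j)\<^sup>2"
    unfolding power_mult_distrib mean_sd_sq len_Suc[OF assms(1)] by simp
  then show ?thesis by (rule power2_eq_imp_eq) (auto intro!: mean_sd_nonneg mult_nonneg_nonneg)
qed

text \<open>The ratio sqrt 2 of consecutive terms is replaced by 4 / 3, for which the constant
  reproduces itself: \<open>4 * (3 / 4) + 1 = 4\<close>.\<close>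

lemma sum_mean_sd:
  assumes "j \<le> finest n" "\<sigma> > 0"
  shows "(\<Sum>k\<le>j. mean_sd n \<sigma> k) \<le> 4 * mean_sd n \<sigma> j"
  using assms(1)
proof (induction j)
  case 0
  then show ?case using mean_sd_nonneg[of n \<sigma> 0] by simp
next
  case (Suc j)
  have "4 / 3 \<le> sqrt 2" by (rule real_le_rsqrt) (simp add: power2_eq_square)
  then have "4 / 3 * mean_sd n \<sigma> j \<le> mean_sd n \<sigma> (Suc j)"
    using Suc assms(2) mean_sd_nonneg[of n \<sigma> j] by (simp only: mean_sd_Suc Suc_le_lessD mult_right_mono)
  then show ?case using Suc by simp
qed

text \<open>Truncated subtraction makes the exponent 0 up to level \<open>Suc j0\<close>, since only
  levels strictly between \<open>j0\<close> and \<open>j\<close> count as passed. From then on the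
  terms shrink by sqrt 2 / 2, at most 3 / 4, and \<open>3 * t j\<close> in the invariant stands for
  the rest of the geometric series. The invariant starts with
  \<open>4 + 4 * (3 / 2) = 10\<close>.\<close>

lemma weighted_sum_mean_sd:
  assumes "j0 \<le> finest n" "\<sigma> > 0"
  shows "(\<Sum>j\<le>finest n. (1 / 2) ^ (j - Suc j0) * mean_sd n \<sigma> j) \<le> 10 * mean_sd n \<sigma> j0"
proof -
  define t where "t j = (1 / 2) ^ (j - Suc j0) * mean_sd n \<sigma> j" for j
  have t0: "t j \<ge> 0" for j by (simp add: t_def mean_sd_nonneg)
  have s: "sqrt 2 \<le> 3 / 2" by (rule real_le_lsqrt) (auto simp: power2_eq_square)
  have base: "(\<Sum>j\<le>j0. t j) \<le> 4 * mean_sd n \<sigma> j0"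
    using sum_mean_sd[OF assms] by (simp add: t_def)
  have "(\<Sum>j\<le>j. t j) + 3 * t j \<le> 10 * mean_sd n \<sigma> j0" if "Suc j0 \<le> j" "j \<le> finest n" for j
    using that
  proof (induction j rule: dec_induct)
    case base
    have "t (Suc j0) = sqrt 2 * mean_sd n \<sigma> j0" using base assms(2) by (simp add: t_def mean_sd_Suc)
    also have "\<dots> \<le> 3 / 2 * mean_sd n \<sigma> j0" using s mean_sd_nonneg by (intro mult_right_mono)
    finally have "t (Suc j0) \<le> 3 / 2 * mean_sd n \<sigma> j0" .
    then show ?case using \<open>(\<Sum>j\<le>j0. t j) \<le> 4 * mean_sd n \<sigma> j0\<close> by simp
  next
    case (step j)
    have "Suc j - Suc j0 = Suc (j - Suc j0)" using step by simp
    then have "t (Suc j) = sqrt 2 / 2 * t j"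
      using step assms(2) by (simp add: t_def mean_sd_Suc)
    also have "\<dots> \<le> (3 / 2) / 2 * t j" using s t0[of j] by (intro mult_right_mono) auto
    finally show ?case using step by simp
  qed
  from this[of "finest n"] base t0[of "finest n"] mean_sd_nonneg[of n \<sigma> j0] assms(1)
  have "(\<Sum>j\<le>finest n. t j) \<le> 10 * mean_sd n \<sigma> j0"
    by (cases "j0 = finest n") auto
  then show ?thesis by (simp add: t_def)
qed

text \<open>Chernoff weights: \<open>weight\<close> dominates the indicator that the side chosen by \<open>sg\<close> stops at no
  level strictly between \<open>j0\<close> and \<open>j\<close>, provided that the mean difference on that side is at most
  half a standard deviation.\<close>

definition weight ::
  "nat \<Rightarrow> real \<Rightarrow> (nat \<Rightarrow> real) \<Rightarrow> (nat \<Rightarrow> int \<Rightarrow> int) \<Rightarrow> nat \<Rightarrow> (nat \<Rightarrow> int) \<Rightarrow> nat \<Rightarrow> (nat \<Rightarrow> real) \<Rightarrow> real"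
  where "weight n \<sigma> a sg j0 \<kappa> j s =
    exp (\<Sum>k\<in>{j0<..<j}. 3 / 2 * (side_noise n a s k (\<kappa> k) (sg k (\<kappa> k)) / mean_sd n \<sigma> k) - 9 / 4)"

lemma measurable_weight [measurable]: "weight n \<sigma> a sg j0 \<kappa> j \<in> borel_measurable (sample_space n)"
  unfolding weight_def by measurable

lemma weight_pos: "weight n \<sigma> a sg j0 \<kappa> j s > 0"
  by (simp add: weight_def)

definition on_path :: "nat \<Rightarrow> (nat \<Rightarrow> int) \<Rightarrow> (nat \<Rightarrow> real) \<Rightarrow> ennreal" where
  "on_path n \<kappa> l = (if path n l = \<kappa> then 1 else 0)"

lemma measurable_on_path [measurable]: "on_path n \<kappa> \<in> borel_measurable (sample_space n)"
  unfolding on_path_def by measurable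

text \<open>Exactly one indicator is 1. Inside each summand the path is a constant, as the
  translation arguments require.\<close>

lemma sum_on_path: "(\<Sum>\<kappa>\<in>paths n. on_path n \<kappa> l * T \<kappa>) = T (path n l)"
proof -
  have "(\<Sum>\<kappa>\<in>paths n. on_path n \<kappa> l * T \<kappa>) = (\<Sum>\<kappa>\<in>{path n l}. on_path n \<kappa> l * T \<kappa>)"
    using finite_paths by (intro sum.mono_neutral_right) (auto simp: paths_def on_path_def)
  then show ?thesis by (simp add: on_path_def)
qed

lemma fluctuation_cong: "(\<And>k. k < j \<Longrightarrow> \<kappa> k = \<kappa>' k) \<Longrightarrow> fluctuation n a \<kappa> l j = fluctuation n a \<kappa>' l j"
  unfolding fluctuation_def by simp

lemma level_error_cong: "(\<And>k. k \<le> j \<Longrightarrow> \<kappa> k = \<kappa>' k) \<Longrightarrow> level_error n \<sigma> a \<kappa> j = level_error n \<sigma> a \<kappa>' j"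
  using fluctuation_cong[of j \<kappa> \<kappa>'] unfolding level_error_def by (auto simp: fun_eq_iff)

lemma weight_cong: "(\<And>k. k < j \<Longrightarrow> \<kappa> k = \<kappa>' k) \<Longrightarrow> weight n \<sigma> a sg j0 \<kappa> j = weight n \<sigma> a sg j0 \<kappa>' j"
  unfolding weight_def by (auto simp: fun_eq_iff intro!: sum.cong)

lemma dot_orth_sum:
  assumes "finite A" and "\<And>i j. i \<in> A \<Longrightarrow> j \<in> A \<Longrightarrow> i \<noteq> j \<Longrightarrow> dot n (w i) (w j) = 0"
  shows "dot n (\<lambda>k. \<Sum>i\<in>A. c i * w i k) (\<lambda>k. \<Sum>i\<in>A. c i * w i k) = (\<Sum>i\<in>A. (c i)\<^sup>2 * dot n (w i) (w i))"
proof -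
  have "dot n (w i) (\<lambda>k. \<Sum>i\<in>A. c i * w i k) = c i * dot n (w i) (w i)" if "i \<in> A" for i
  proof -
    have "dot n (w i) (\<lambda>k. \<Sum>i\<in>A. c i * w i k) = (\<Sum>j\<in>A. c j * dot n (w i) (w j))"
      unfolding dot_commute[of n "w i" "\<lambda>k. \<Sum>i\<in>A. c i * w i k"] dot_sum_left dot_scale_left
      by (simp add: dot_commute)
    also have "\<dots> = (\<Sum>j\<in>{i}. c j * dot n (w i) (w j))"
      using assms that by (intro sum.mono_neutral_right) auto
    finally show ?thesis by simp
  qed
  then show ?thesis unfolding dot_sum_left dot_scale_left by (simp add: power2_eq_square mult.assoc)
qed

section \<open>Moment bounds in the regression model\<close>

locale regression =
  fixes n :: nat and \<sigma> :: real and f :: "real \<Rightarrow> real"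
  assumes n: "n \<ge> 1" and \<sigma>: "\<sigma> > 0" and f: "f \<in> conv_fun"
begin

abbreviation "a \<equiv> grid n f"
abbreviation "Q \<equiv> samples n \<sigma> f"
abbreviation "sd j \<equiv> mean_sd n \<sigma> j"

lemma space_3: "\<omega> \<in> space (sample_space3 n) \<Longrightarrow>
    fst \<omega> \<in> space (sample_space n) \<and> fst (snd \<omega>) \<in> space (sample_space n) \<and> snd (snd \<omega>) \<in> space (sample_space n)"
  by (auto simp: space_pair_measure)

text \<open>This and the next two lemmas apply \<open>samples_abs\<close> to a functional of one
  sample. Translating one sample fixes the other two, so invariance is asked only of a factor that
  depends on the moved sample.\<close>

lemma abs_l:
  assumes [measurable]: "g \<in> borel_measurable (sample_space n)"
    and inv: "\<And>t l. l \<in> space (sample_space n) \<Longrightarrow> g (translate n (\<lambda>k. t * w k) l) = g l"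
    and r: "r > 0" "3 * \<sigma>\<^sup>2 * dot n w w \<le> r\<^sup>2"
  shows "(\<integral>\<^sup>+\<omega>. g (fst \<omega>) * ennreal \<bar>dot n w (fst \<omega>) - dot n w a\<bar> \<partial>Q) \<le> ennreal (4 * r) * (\<integral>\<^sup>+\<omega>. g (fst \<omega>) \<partial>Q)"
proof -
  have "g (fst (translate3 n (3 * \<sigma>\<^sup>2) (scale3 t (w, \<lambda>_. 0, \<lambda>_. 0)) \<omega>)) = g (fst \<omega>)" if "\<omega> \<in> space (sample_space3 n)" for t \<omega>
    using inv[of "fst \<omega>" "3 * \<sigma>\<^sup>2 * t"] space_3[OF that]
    by (cases \<omega>) (simp add: translate3_def scale3_def mult.assoc)
  from samples_abs[where d="(w, \<lambda>_. 0, \<lambda>_. 0)", OF _ \<sigma> this r(1), of f] r(2)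
  show ?thesis by (simp add: dot3_def split_def diag3_def)
qed

lemma abs_s:
  assumes [measurable]: "g \<in> borel_measurable (sample_space n)" "h \<in> borel_measurable (sample_space n)"
    and inv: "\<And>t s. s \<in> space (sample_space n) \<Longrightarrow> h (translate n (\<lambda>k. t * w k) s) = h s"
    and r: "r > 0" "3 * \<sigma>\<^sup>2 * dot n w w \<le> r\<^sup>2"
  shows "(\<integral>\<^sup>+\<omega>. g (fst \<omega>) * h (fst (snd \<omega>)) * ennreal \<bar>dot n w (fst (snd \<omega>)) - dot n w a\<bar> \<partial>Q) \<le>
    ennreal (4 * r) * (\<integral>\<^sup>+\<omega>. g (fst \<omega>) * h (fst (snd \<omega>)) \<partial>Q)"
proof -
  let ?g = "\<lambda>\<omega>. g (fst \<omega>) * h (fst (snd \<omega>))"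
  have "?g (translate3 n (3 * \<sigma>\<^sup>2) (scale3 t (\<lambda>_. 0, w, \<lambda>_. 0)) \<omega>) = ?g \<omega>" if "\<omega> \<in> space (sample_space3 n)" for t \<omega>
    using inv[of "fst (snd \<omega>)" "3 * \<sigma>\<^sup>2 * t"] space_3[OF that]
    by (cases \<omega>) (simp add: translate3_def scale3_def mult.assoc translate_zero)
  from samples_abs[where d="(\<lambda>_. 0, w, \<lambda>_. 0)", OF _ \<sigma> this r(1), of f] r(2)
  show ?thesis by (simp add: dot3_def split_def diag3_def)
qed

lemma abs_e:
  assumes [measurable]: "g \<in> borel_measurable (sample_space n)" "h \<in> borel_measurable (sample_space n)"
    and r: "r > 0" "3 * \<sigma>\<^sup>2 * dot n w w \<le> r\<^sup>2"
  shows "(\<integral>\<^sup>+\<omega>. g (fst \<omega>) * h (fst (snd \<omega>)) * ennreal \<bar>dot n w (snd (snd \<omega>)) - dot n w a\<bar> \<partial>Q) \<le>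
    ennreal (4 * r) * (\<integral>\<^sup>+\<omega>. g (fst \<omega>) * h (fst (snd \<omega>)) \<partial>Q)"
proof -
  let ?g = "\<lambda>\<omega>. g (fst \<omega>) * h (fst (snd \<omega>))"
  have "?g (translate3 n (3 * \<sigma>\<^sup>2) (scale3 t (\<lambda>_. 0, \<lambda>_. 0, w)) \<omega>) = ?g \<omega>" if "\<omega> \<in> space (sample_space3 n)" for t \<omega>
    using space_3[OF that]
    by (cases \<omega>) (simp add: translate3_def scale3_def mult.assoc translate_zero)
  from samples_abs[where d="(\<lambda>_. 0, \<lambda>_. 0, w)", OF _ \<sigma> this r(1), of f] r(2)
  show ?thesis by (simp add: dot3_def split_def diag3_def)
qed

lemma exp_s:
  assumes [measurable]: "g \<in> borel_measurable (sample_space n)"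
  shows "(\<integral>\<^sup>+\<omega>. g (fst \<omega>) * ennreal (exp (dot n w (fst (snd \<omega>)) - dot n w a)) \<partial>Q) =
    ennreal (exp (3 * \<sigma>\<^sup>2 / 2 * dot n w w)) * (\<integral>\<^sup>+\<omega>. g (fst \<omega>) \<partial>Q)"
proof -
  have "g (fst (translate3 n (3 * \<sigma>\<^sup>2) (\<lambda>_. 0, w, \<lambda>_. 0) \<omega>)) = g (fst \<omega>)" if "\<omega> \<in> space (sample_space3 n)" for \<omega>
    using space_3[OF that] by (cases \<omega>) (simp add: translate3_def translate_zero)
  from samples_exp[where g="\<lambda>\<omega>. g (fst \<omega>)" and d="(\<lambda>_. 0, w, \<lambda>_. 0)", OF _ \<sigma> this, of f]
  show ?thesis by (simp add: dot3_def split_def diag3_def)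
qed

lemma norm_bounds:
  assumes "dot n w w \<le> 2 / of_int (len n j)"
  shows "3 * \<sigma>\<^sup>2 * dot n w w \<le> (sd j)\<^sup>2"
proof -
  have "3 * \<sigma>\<^sup>2 * dot n w w \<le> 3 * \<sigma>\<^sup>2 * (2 / of_int (len n j))" using assms by (intro mult_left_mono) auto
  then show ?thesis by (simp add: mean_sd_sq)
qed

lemma block_dir_norm_sd: "3 * \<sigma>\<^sup>2 * dot n (block_dir n j i) (block_dir n j i) \<le> (sd j)\<^sup>2"
  using block_dir_norm[of n j i] len_pos[of n j]
  by (intro norm_bounds) (smt (verit) divide_right_mono of_int_0_le_iff len_nonneg)

text \<open>Three terms per level cost \<open>4 * sd k\<close> each, and the geometric growth of the
  standard deviations contributes another factor 4.\<close>

lemma expected_fluctuation: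
  assumes j: "j \<le> finest n"
  shows "(\<integral>\<^sup>+\<omega>. ennreal (fluctuation n a (loc_index n (fst \<omega>)) (fst \<omega>) j) \<partial>Q) \<le> ennreal (48 * sd j)"
proof -
  interpret P: prob_space Q by (rule prob_space_samples)
  have one: "(\<integral>\<^sup>+\<omega>. 1 \<partial>Q) = 1" by (simp add: P.emeasure_space_1)
  have A: "(\<integral>\<^sup>+\<omega>. ennreal \<bar>noise_mean n a (fst \<omega>) 0 i\<bar> \<partial>Q) \<le> ennreal (4 * sd 0)" for i
    using abs_l[of "\<lambda>_. 1" "block_dir n 0 i" "sd 0"] block_dir_norm_sd mean_sd_pos[OF \<sigma>] one
    by (simp add: noise_mean_dot)
  have B: "(\<integral>\<^sup>+\<omega>. ennreal \<bar>split_noise n a (fst \<omega>) (Suc k) (loc_index n (fst \<omega>) k + p)\<bar> \<partial>Q) \<le> ennreal (4 * sd (Suc k))"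
    if k: "k < finest n" for k p
  proof -
    \<comment> \<open>The position at level \<open>k\<close> is fixed by an indicator
      \<open>h i\<close>. By \<open>children_balanced\<close> the contrast of halves at level
      \<open>Suc k\<close> leaves that indicator unchanged.\<close>
    define I where "I = {1..int n + 1}"
    define h :: "int \<Rightarrow> (nat \<Rightarrow> real) \<Rightarrow> ennreal" where "h i l = (if loc_index n l k = i then 1 else 0)" for i l
    have [measurable]: "h i \<in> borel_measurable (sample_space n)" for i unfolding h_def by measurable
    have sum_h: "(\<Sum>i\<in>I. h i l * T i) = T (loc_index n l k)" for l and T :: "int \<Rightarrow> ennreal"
    proof -
      have "(\<Sum>i\<in>I. h i l * T i) = (\<Sum>i\<in>{loc_index n l k}. h i l * T i)"
        using loc_index_range[of k n l] k by (intro sum.mono_neutral_right) (auto simp: h_def I_def)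
      then show ?thesis by (simp add: h_def)
    qed
    have each: "(\<integral>\<^sup>+\<omega>. h i (fst \<omega>) * ennreal \<bar>split_noise n a (fst \<omega>) (Suc k) (i + p)\<bar> \<partial>Q)
      \<le> ennreal (4 * sd (Suc k)) * (\<integral>\<^sup>+\<omega>. h i (fst \<omega>) \<partial>Q)" for i
      unfolding split_noise_dot
    proof (rule abs_l)
      fix t l
      have "block_total n (\<lambda>x. t * split_dir n (Suc k) (i + p) x) k' i' = 0" if "k' \<le> k" "valid n k' i'" for k' i'
        using children_balanced[OF k that, of "i + p"]
        unfolding dot_scale_right split_dir_def dot_diff_right dot_commute[of n "block n k' i'" "block_dir n _ _"] dot_block_dir
        by (simp add: block_mean_def dot_commute)
      then show "h i (translate n (\<lambda>x. t * split_dir n (Suc k) (i + p) x) l) = h i l"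
        unfolding h_def by (subst loc_index_translate) auto
    qed (use mean_sd_pos[OF \<sigma>] norm_bounds[OF split_dir_norm] in auto)
    have "(\<integral>\<^sup>+\<omega>. ennreal \<bar>split_noise n a (fst \<omega>) (Suc k) (loc_index n (fst \<omega>) k + p)\<bar> \<partial>Q)
      = (\<integral>\<^sup>+\<omega>. (\<Sum>i\<in>I. h i (fst \<omega>) * ennreal \<bar>split_noise n a (fst \<omega>) (Suc k) (i + p)\<bar>) \<partial>Q)"
      by (simp add: sum_h)
    also have "\<dots> = (\<Sum>i\<in>I. \<integral>\<^sup>+\<omega>. h i (fst \<omega>) * ennreal \<bar>split_noise n a (fst \<omega>) (Suc k) (i + p)\<bar> \<partial>Q)"
      by (rule nn_integral_sum) measurable
    also have "\<dots> \<le> (\<Sum>i\<in>I. ennreal (4 * sd (Suc k)) * (\<integral>\<^sup>+\<omega>. h i (fst \<omega>) \<partial>Q))"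
      by (intro sum_mono each)
    also have "\<dots> = ennreal (4 * sd (Suc k)) * (\<integral>\<^sup>+\<omega>. (\<Sum>i\<in>I. h i (fst \<omega>)) \<partial>Q)"
      by (subst nn_integral_sum) (auto simp: sum_distrib_left)
    also have "(\<lambda>\<omega>. \<Sum>i\<in>I. h i (fst \<omega>)) = (\<lambda>_ :: sample3. 1)"
      using sum_h[of _ "\<lambda>_. 1"] by simp
    finally show ?thesis by (simp add: P.emeasure_space_1)
  qed
  have eq: "ennreal (fluctuation n a (loc_index n (fst \<omega>)) (fst \<omega>) j) =
     (\<Sum>p\<in>{-1, 0, 1}. ennreal \<bar>noise_mean n a (fst \<omega>) 0 (1 + p)\<bar>) +
     (\<Sum>k<j. \<Sum>p\<in>{-1, 0, 1}. ennreal \<bar>split_noise n a (fst \<omega>) (Suc k) (loc_index n (fst \<omega>) k + p)\<bar>)" for \<omega> :: sample3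
    unfolding fluctuation_def by (simp add: sum_nonneg ennreal_plus sum_ennreal del: sum.insert)
  have "(\<integral>\<^sup>+\<omega>. ennreal (fluctuation n a (loc_index n (fst \<omega>)) (fst \<omega>) j) \<partial>Q) =
     (\<Sum>p\<in>{-1, 0, 1}. \<integral>\<^sup>+\<omega>. ennreal \<bar>noise_mean n a (fst \<omega>) 0 (1 + p)\<bar> \<partial>Q) +
     (\<Sum>k<j. \<Sum>p\<in>{-1, 0, 1}. \<integral>\<^sup>+\<omega>. ennreal \<bar>split_noise n a (fst \<omega>) (Suc k) (loc_index n (fst \<omega>) k + p)\<bar> \<partial>Q)"
    unfolding eq by (simp add: nn_integral_add nn_integral_sum del: sum.insert sum_ennreal)
  also have "\<dots> \<le> (\<Sum>p\<in>{-1, 0, 1::int}. ennreal (4 * sd 0)) + (\<Sum>k<j. \<Sum>p\<in>{-1, 0, 1::int}. ennreal (4 * sd (Suc k)))"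
    using j by (intro add_mono sum_mono A B) auto
  also have "\<dots> = (\<Sum>p\<in>{-1, 0, 1::int}. \<Sum>k\<le>j. ennreal (4 * sd k))"
    by (simp add: sum.atMost_shift distrib_left sum_distrib_left del: sum_ennreal)
  also have "\<dots> = (\<Sum>p\<in>{-1, 0, 1::int}. ennreal (4 * (\<Sum>k\<le>j. sd k)))"
    by (subst sum_ennreal) (simp_all add: mean_sd_nonneg sum_distrib_left)
  also have "\<dots> = ennreal (\<Sum>p\<in>{-1, 0, 1::int}. 4 * (\<Sum>k\<le>j. sd k))"
    by (rule sum_ennreal) (simp add: mean_sd_nonneg sum_nonneg)
  also have "(\<Sum>p\<in>{-1, 0, 1::int}. 4 * (\<Sum>k\<le>j. sd k)) = 12 * (\<Sum>k\<le>j. sd k)"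
    by simp
  also have "\<dots> \<le> ennreal (48 * sd j)"
    using sum_mean_sd[OF j \<sigma>] by (intro ennreal_leI) simp
  finally show ?thesis .
qed

end

section \<open>The risk of the estimator\<close>

text \<open>Both slopes are compared with that of the chord from \<open>p\<close> to
  \<open>s\<close>.\<close>

lemma convex_on_slopes:
  fixes f :: "real \<Rightarrow> real"
  assumes f: "convex_on S f" and S: "p \<in> S" "q \<in> S" "r \<in> S" "s \<in> S"
    and o: "p < q" "r < s" "p \<le> r" "q \<le> s"
  shows "(f q - f p) / (q - p) \<le> (f s - f r) / (s - r)"
proof -
  have flip: "(f x - f y) / (x - y) = (f y - f x) / (y - x)" for x y
    by (metis minus_diff_eq minus_divide_divide)
  have "(f p - f q) / (p - q) \<le> (f p - f s) / (p - s)"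
    using convex_on_slope_le(1)[OF f, of p s q] S o by (cases "q = s") auto
  also have "\<dots> \<le> (f r - f s) / (r - s)"
    using convex_on_slope_le(2)[OF f, of p s r] S o by (cases "p = r") auto
  finally show ?thesis by (simp add: flip[of p q] flip[of r s])
qed

lemma loc_index_cong: "block_sum n l = block_sum n l' \<Longrightarrow> loc_index n l j = loc_index n l' j"
  by (induction j) (simp_all add: loc_index.simps)

text \<open>\<open>M_hat\<close> passes total functions to \<open>M_split\<close>, while the law
  \<open>samples\<close> lives on functions restricted to \<open>{0..n}\<close>; this reconciles the
  two.\<close>

lemma M_split_cong:
  assumes l: "extended n l = extended n l'" and s: "extended n s = extended n s'" and e: "extended n e = extended n e'"
  shows "M_split n \<sigma> l s e = M_split n \<sigma> l' s' e'"
proof -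
  have bs: "block_sum n v = block_sum n v'" if "extended n v = extended n v'" for v v'
    by (simp add: fun_eq_iff block_sum_def that)
  note eqs = bs[OF l] bs[OF s] bs[OF e] loc_index_cong[OF bs[OF l]] e
  have sides: "right_diff n l s = right_diff n l' s'" "left_diff n l s = left_diff n l' s'"
    unfolding right_diff_def left_diff_def eqs by (simp_all add: fun_eq_iff eqs)
  then have jc: "j_check n \<sigma> l s = j_check n \<sigma> l' s'" unfolding j_check_def stop_stat_def by simp
  then have jh: "j_hat n \<sigma> l s = j_hat n \<sigma> l' s'" unfolding j_hat_def by simp
  show ?thesis unfolding M_split_def final_index_def shift_def Let_def sides jc jh eqs ..
qed

lemma extended_restrict: "extended n (restrict v {0..n}) = extended n v"
  by (auto simp: fun_eq_iff extended_def)

text \<open>Passes from the data to the law of the split samples through a majorant, so that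
  measurability is a matter of \<open>U\<close> alone.\<close>

lemma M_hat_risk_le:
  assumes [measurable]: "U \<in> borel_measurable (sample_space3 n)"
    and U: "\<And>l s e. e2ennreal \<bar>M_split n \<sigma> l s e - ereal (min_value f)\<bar> \<le> U (l, s, e)"
  shows "M_hat_risk n \<sigma> f \<le> (\<integral>\<^sup>+\<omega>. U \<omega> \<partial>samples n \<sigma> f)"
proof -
  have "M_hat_risk n \<sigma> f \<le> (\<integral>\<^sup>+\<omega>. U (split_samples n \<sigma> \<omega>) \<partial>(data n \<sigma> f \<Otimes>\<^sub>M noise n \<Otimes>\<^sub>M noise n))"
    unfolding M_hat_risk_def
  proof (rule nn_integral_mono, clarify)
    fix y z1 z2 
    show "e2ennreal \<bar>M_hat n \<sigma> y z1 z2 - ereal (min_value f)\<bar> \<le> U (split_samples n \<sigma> (y, z1, z2))"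
      unfolding M_hat_def split_samples_def prod.case
      by (subst M_split_cong[OF extended_restrict[symmetric] extended_restrict[symmetric] extended_restrict[symmetric]]) (rule U)
  qed
  also have "\<dots> = (\<integral>\<^sup>+\<omega>. U \<omega> \<partial>samples n \<sigma> f)"
    unfolding samples_def by (rule nn_integral_distr[symmetric]) auto
  finally show ?thesis .
qed

section \<open>Benchmark and risk for a fixed convex function\<close>

context regression
begin

definition best :: nat where
  "best = arg_min_on a {0..n}"

sublocale seq: convex_sequence n a "int best"
proof
  have S: "finite {0..n}" "{0..n} \<noteq> {}" by auto
  show "int best \<in> {0..int n}" using arg_min_if_finite(1)[OF S, of a] by (simp add: best_def)
  show "a (nat (int best)) \<le> a k" if "k \<le> n" for k
    using arg_min_if_finite(2)[OF S, of a] that by (auto simp: best_def not_less)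
  fix p q r s :: nat assume o: "p < q" "r < s" "p \<le> r" "q \<le> s" "s \<le> n"
  let ?x = "\<lambda>k. real k / real n"
  have "convex_on {0..1} f" using f by (simp add: conv_fun_def)
  moreover have "?x k \<in> {0..1}" if "k \<le> n" for k using that n by simp
  ultimately have "(f (?x q) - f (?x p)) / (?x q - ?x p) \<le> (f (?x s) - f (?x r)) / (?x s - ?x r)"
    using o n by (intro convex_on_slopes) (auto simp: divide_strict_right_mono divide_right_mono)
  then have "(f (?x q) - f (?x p)) / ((real q - real p) / real n) \<le> (f (?x s) - f (?x r)) / ((real s - real r) / real n)"
    by (simp add: diff_divide_distrib)
  then have "(f (?x q) - f (?x p)) / (real q - real p) \<le> (f (?x s) - f (?x r)) / (real s - real r)"
    using n by (simp add: mult_le_cancel_right flip: times_divide_eq_left)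
  then show "(a q - a p) * (real s - real r) \<le> (a s - a r) * (real q - real p)"
    using o by (simp add: grid_def divide_le_eq pos_le_divide_eq frac_le_eq field_simps)
qed

lemma min_value_le_best: "min_value f \<le> a best"
proof -
  have "real best / real n \<in> {0..1}" using seq.c n by simp
  then show ?thesis using conv_fun_minimizer(2)[OF f] by (simp add: grid_def)
qed

text \<open>Raising the minimum by the gap changes no grid value, so the data cannot reveal
  it.\<close>

lemma benchmark_ge_gap: "ennreal ((a best - min_value f) / 16) \<le> benchmark n \<sigma> f"
proof (cases "min_value f < a best")
  case True
  have "(\<Sum>k\<in>{0..n}. (max 0 (min_value f + (a best - min_value f) - a k))\<^sup>2) = 0"
    using seq.least by (intro sum.neutral) auto
  then show ?thesis using True n \<sigma> f by (intro benchmark_lower) auto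
qed (simp add: ennreal_neg)

text \<open>The raise is \<open>sd j / 9\<close>: the 13 low blocks contribute
  \<open>13 * 6 / 81\<close> times \<open>\<sigma>\<^sup>2\<close>, and 9 is the least integer that
  keeps this below \<open>\<sigma>\<^sup>2\<close>. Then \<open>144 = 9 * 16\<close>.\<close>

lemma benchmark_ge_steep:
  assumes v: "valid n j i"
    and steep: "\<And>r. r = 1 \<or> r = -1 \<Longrightarrow> valid n j (i + 6 * r) \<Longrightarrow>
      block_mean n a j (i + 6 * r) - block_mean n a j (i + 5 * r) \<ge> sd j / 2"
  shows "ennreal (sd j / 144) \<le> benchmark n \<sigma> f"
proof -
  have "(\<Sum>k\<in>{0..n}. (max 0 (min_value f + sd j / 9 - a k))\<^sup>2) \<le> 13 * of_int (len n j) * (sd j / 9)\<^sup>2"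
    using min_value_le_best mean_sd_nonneg[of n \<sigma> j] by (intro seq.sum_low_points[OF v steep]) auto
  also have "\<dots> = 78 / 81 * \<sigma>\<^sup>2"
    using len_pos[of n j] by (simp add: power_divide mean_sd_sq del: len_pos)
  also have "\<dots> \<le> \<sigma>\<^sup>2" by simp
  finally have "ennreal (sd j / 9 / 16) \<le> benchmark n \<sigma> f"
    using mean_sd_pos[OF \<sigma>] n \<sigma> f by (intro benchmark_lower) auto
  then show ?thesis by simp
qed

definition last_level :: nat where
  "last_level = Max {j \<in> {0..finest n}. ennreal (sd j / 144) \<le> benchmark n \<sigma> f}"

lemma last_level:
  "last_level \<le> finest n" "ennreal (sd last_level / 144) \<le> benchmark n \<sigma> f"
  "\<And>j. last_level < j \<Longrightarrow> j \<le> finest n \<Longrightarrow> \<not> ennreal (sd j / 144) \<le> benchmark n \<sigma> f"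
proof -
  let ?A = "{j \<in> {0..finest n}. ennreal (sd j / 144) \<le> benchmark n \<sigma> f}"
  \<comment> \<open>Level 0 has a single complete block, so steepness holds vacuously there and the
    maximum is over a nonempty set.\<close>
  have "\<not> valid n 0 (1 + 6 * r)" if "r = 1 \<or> r = -1" for r
    using that len_0_bounds(2)[of n] by (auto simp: valid_def)
  then have "0 \<in> ?A" using benchmark_ge_steep[OF valid_0] by auto
  then have "Max ?A \<in> ?A" by (intro Max_in) auto
  then show "last_level \<le> finest n" "ennreal (sd last_level / 144) \<le> benchmark n \<sigma> f"
    by (auto simp: last_level_def)
  show "\<not> ennreal (sd j / 144) \<le> benchmark n \<sigma> f" if "last_level < j" "j \<le> finest n" for j
  proof
    assume "ennreal (sd j / 144) \<le> benchmark n \<sigma> f"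
    then have "j \<le> last_level" using that unfolding last_level_def by (intro Max_ge) auto
    then show False using that by simp
  qed
qed

text \<open>Beyond \<^term>\<open>last_level\<close> two steep sides would give a benchmark of the order of
  \<^term>\<open>sd j\<close>, so at every position one side is flat.\<close>

definition flat :: "nat \<Rightarrow> int \<Rightarrow> int" where
  "flat j i = (if valid n j (i + 6) \<and> block_mean n a j (i + 6) - block_mean n a j (i + 5) < sd j / 2 then 1 else -1)"

lemma flat_side: "flat j i \<in> {1, -1}"
  by (simp add: flat_def)

lemma flat:
  assumes "last_level < j" "j \<le> finest n" "valid n j i"
  shows "valid n j (i + 6 * flat j i)"
    "block_mean n a j (i + 6 * flat j i) - block_mean n a j (i + 5 * flat j i) < sd j / 2"
proof -
  have "\<exists>r. (r = 1 \<or> r = -1) \<and> valid n j (i + 6 * r) \<and>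
      block_mean n a j (i + 6 * r) - block_mean n a j (i + 5 * r) < sd j / 2"
    using benchmark_ge_steep[OF assms(3)] last_level(3)[OF assms(1,2)] by force
  then show "valid n j (i + 6 * flat j i)"
    "block_mean n a j (i + 6 * flat j i) - block_mean n a j (i + 5 * flat j i) < sd j / 2"
    unfolding flat_def by auto
qed

abbreviation "wt \<kappa> j s \<equiv> weight n \<sigma> a flat last_level \<kappa> j s"
abbreviation "err \<kappa> j l s e \<equiv> level_error n \<sigma> a \<kappa> j l s e"

text \<open>Summing over all levels removes the random stopping level: the summand of the level
  actually used has weight at least 1, because the flat side stopped at no earlier level.\<close>

lemma M_split_pointwise:
  "e2ennreal \<bar>M_split n \<sigma> l s e - ereal (min_value f)\<bar> \<le>
    ennreal (a best - min_value f) + (\<Sum>j\<le>finest n. ennreal (wt (loc_index n l) j s * err (loc_index n l) j l s e))"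
proof -
  let ?\<kappa> = "loc_index n l"
  have M: "min_value f \<le> a (nat (int best))" using min_value_le_best by simp
  obtain j where j: "j \<le> finest n"
    and ns: "\<And>k. k < j \<Longrightarrow> \<not> stops n \<sigma> s k (?\<kappa> k) 1 \<and> \<not> stops n \<sigma> s k (?\<kappa> k) (-1)"
    and le': "\<bar>M_split n \<sigma> l s e - ereal (min_value f)\<bar> \<le> ereal (err ?\<kappa> j l s e + (a (nat (int best)) - min_value f))"
    by (rule seq.M_split_error[OF M \<sigma>, where l=l and s=s and e=e]) blast
  have le: "\<bar>M_split n \<sigma> l s e - ereal (min_value f)\<bar> \<le> ereal (err ?\<kappa> j l s e + (a best - min_value f))"
    using le' unfolding nat_int .
  have "3 / 2 * (side_noise n a s k (?\<kappa> k) (flat k (?\<kappa> k)) / sd k) - 9 / 4 \<ge> 0" if k: "k \<in> {last_level<..<j}" for k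
  proof -
    have v: "valid n k (?\<kappa> k)" using k j by (intro valid_loc_index) auto
    have "\<not> stops n \<sigma> s k (?\<kappa> k) (flat k (?\<kappa> k))" using ns[of k] k flat_side[of k "?\<kappa> k"] by auto
    then have "side_noise n a s k (?\<kappa> k) (flat k (?\<kappa> k)) > 3 / 2 * sd k"
      using flat[of k "?\<kappa> k"] k j v unfolding stops_def side_noise_def noise_mean_def by auto
    then have "3 / 2 \<le> side_noise n a s k (?\<kappa> k) (flat k (?\<kappa> k)) / sd k"
      using mean_sd_pos[OF \<sigma>, of n k] by (simp add: pos_le_divide_eq)
    then show ?thesis by simp
  qed
  then have "1 \<le> wt ?\<kappa> j s" unfolding weight_def one_le_exp_iff by (rule sum_nonneg)
  then have "1 * err ?\<kappa> j l s e \<le> wt ?\<kappa> j s * err ?\<kappa> j l s e"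
    by (intro mult_right_mono level_error_nonneg)
  then have "ennreal (err ?\<kappa> j l s e) \<le> ennreal (wt ?\<kappa> j s * err ?\<kappa> j l s e)"
    by (intro ennreal_leI) simp
  also have "\<dots> \<le> (\<Sum>j\<le>finest n. ennreal (wt ?\<kappa> j s * err ?\<kappa> j l s e))"
    using j by (intro member_le_sum[where f="\<lambda>j. ennreal (wt ?\<kappa> j s * err ?\<kappa> j l s e)"]) auto
  finally have up: "ennreal (err ?\<kappa> j l s e) \<le> (\<Sum>j\<le>finest n. ennreal (wt ?\<kappa> j s * err ?\<kappa> j l s e))" .
  have "e2ennreal \<bar>M_split n \<sigma> l s e - ereal (min_value f)\<bar> \<le> e2ennreal (ereal (err ?\<kappa> j l s e + (a best - min_value f)))"
    by (rule e2ennreal_mono[OF le])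
  also have "\<dots> = ennreal (a best - min_value f) + ennreal (err ?\<kappa> j l s e)"
    using min_value_le_best level_error_nonneg by (simp add: add.commute)
  also have "\<dots> \<le> ennreal (a best - min_value f) + (\<Sum>j\<le>finest n. ennreal (wt ?\<kappa> j s * err ?\<kappa> j l s e))"
    using up by (rule add_left_mono)
  finally show ?thesis .
qed

text \<open>Taking the path from a sample \<open>l0\<close> makes its geometry available: the
  stopping directions of different levels are orthogonal, so the variances in the exponent add up.
  Each level contributes at most \<open>exp (9 / 8)\<close> from the variance and
  \<open>exp (- 9 / 4)\<close> from the weight.\<close>

lemma expected_weight:
  assumes [measurable]: "g \<in> borel_measurable (sample_space n)" and j: "j \<le> finest n"
  shows "(\<integral>\<^sup>+\<omega>. g (fst \<omega>) * ennreal (wt (loc_index n l0) j (fst (snd \<omega>))) \<partial>Q) \<le>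
    ennreal ((1 / 2) ^ (j - Suc last_level)) * (\<integral>\<^sup>+\<omega>. g (fst \<omega>) \<partial>Q)"
proof -
  let ?\<kappa> = "loc_index n l0"
  define S where "S = {last_level<..<j}"
  define w where "w k = side_dir n k (?\<kappa> k) (flat k (?\<kappa> k))" for k
  define c where "c k = 3 / 2 / sd k" for k
  define v where "v x = (\<Sum>k\<in>S. c k * w k x)" for x
  define m where "m = j - Suc last_level"
  have S: "finite S" "card S = m" by (simp_all add: S_def m_def)
  have orth: "dot n (w k) (w k') = 0" if "k \<in> S" "k' \<in> S" "k \<noteq> k'" for k k'
  proof -
    have o: "dot n (w k) (w k') = 0" if "k < k'" "k' \<in> S" for k k'
      unfolding w_def using that j flat_side by (intro side_dir_orth) (auto simp: S_def)
    show ?thesis using o[of k k'] o[of k' k] that by (cases "k < k'") (auto simp: dot_commute)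
  qed
  have wt: "wt ?\<kappa> j s = exp (dot n v s - dot n v a) * exp (- 9 / 4) ^ m" for s
  proof -
    have "(\<Sum>k\<in>S. 3 / 2 * (side_noise n a s k (?\<kappa> k) (flat k (?\<kappa> k)) / sd k) - 9 / 4) =
      (\<Sum>k\<in>S. c k * (dot n (w k) s - dot n (w k) a)) + real m * (- 9 / 4)"
      unfolding sum_subtractf side_noise_dot w_def[symmetric] c_def using S by simp
    also have "(\<Sum>k\<in>S. c k * (dot n (w k) s - dot n (w k) a)) = dot n v s - dot n v a"
      unfolding v_def dot_sum_left dot_scale_left by (simp add: right_diff_distrib sum_subtractf)
    finally show ?thesis
      unfolding weight_def S_def[symmetric] by (simp only: exp_add exp_of_nat_mult)
  qed
  have "dot n v v = (\<Sum>k\<in>S. (c k)\<^sup>2 * dot n (w k) (w k))"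
    unfolding v_def by (rule dot_orth_sum[OF S(1)]) (rule orth)
  then have "3 * \<sigma>\<^sup>2 / 2 * dot n v v = (\<Sum>k\<in>S. (c k)\<^sup>2 / 2 * (3 * \<sigma>\<^sup>2 * dot n (w k) (w k)))"
    by (simp add: sum_distrib_left mult_ac)
  also have "\<dots> \<le> (\<Sum>k\<in>S. (c k)\<^sup>2 / 2 * (sd k)\<^sup>2)"
  proof (intro sum_mono mult_left_mono norm_bounds)
    fix k show "dot n (w k) (w k) \<le> 2 / of_int (len n k)"
      unfolding w_def using flat_side[of k "?\<kappa> k"] by (intro side_dir_norm) auto
  qed simp
  also have "\<dots> = (\<Sum>k\<in>S. 9 / 8)"
  proof (intro sum.cong refl)
    fix k have "sd k \<noteq> 0" using mean_sd_pos[OF \<sigma>, of n k] by simp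
    then show "(c k)\<^sup>2 / 2 * (sd k)\<^sup>2 = 9 / 8" by (simp add: c_def power_divide)
  qed
  also have "\<dots> = real m * (9 / 8)" using S by simp
  finally have "exp (3 * \<sigma>\<^sup>2 / 2 * dot n v v) \<le> exp (9 / 8) ^ m"
    by (simp flip: exp_of_nat_mult)
  then have "exp (3 * \<sigma>\<^sup>2 / 2 * dot n v v) * exp (- 9 / 4) ^ m \<le> exp (9 / 8) ^ m * exp (- 9 / 4) ^ m"
    by (intro mult_right_mono) auto
  also have "\<dots> = exp (- (9 / 8)) ^ m" by (simp flip: power_mult_distrib exp_add)
  also have "\<dots> \<le> (1 / 2) ^ m"
  proof (rule power_mono)
    have "2 \<le> exp (9 / 8 :: real)" using exp_ge_add_one_self[of "9 / 8 :: real"] by simp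
    then show "exp (- (9 / 8)) \<le> (1 / 2 :: real)" by (simp add: exp_minus field_simps)
  qed simp
  finally have num: "exp (3 * \<sigma>\<^sup>2 / 2 * dot n v v) * exp (- 9 / 4) ^ m \<le> (1 / 2) ^ m" .
  have "(\<integral>\<^sup>+\<omega>. g (fst \<omega>) * ennreal (wt ?\<kappa> j (fst (snd \<omega>))) \<partial>Q) =
     (\<integral>\<^sup>+\<omega>. ennreal (exp (- 9 / 4) ^ m) * (g (fst \<omega>) * ennreal (exp (dot n v (fst (snd \<omega>)) - dot n v a))) \<partial>Q)"
    unfolding wt by (simp add: ennreal_mult mult_ac)
  also have "\<dots> = ennreal (exp (- 9 / 4) ^ m) * (ennreal (exp (3 * \<sigma>\<^sup>2 / 2 * dot n v v)) * (\<integral>\<^sup>+\<omega>. g (fst \<omega>) \<partial>Q))"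
    by (subst nn_integral_cmult) (simp_all add: exp_s)
  also have "\<dots> = ennreal (exp (3 * \<sigma>\<^sup>2 / 2 * dot n v v) * exp (- 9 / 4) ^ m) * (\<integral>\<^sup>+\<omega>. g (fst \<omega>) \<partial>Q)"
    by (simp add: ennreal_mult mult_ac)
  also have "\<dots> \<le> ennreal ((1 / 2) ^ m) * (\<integral>\<^sup>+\<omega>. g (fst \<omega>) \<partial>Q)"
    by (intro mult_right_mono ennreal_leI num) simp
  finally show ?thesis by (simp add: m_def)
qed

lemma weight_translate:
  assumes j: "j \<le> finest n" and r: "r \<in> {1, -1}"
  shows "wt (loc_index n l0) j (translate n (\<lambda>k. t * side_dir n j (loc_index n l0 j) r k) s) = wt (loc_index n l0) j s"
proof -
  have "side_noise n a (translate n (\<lambda>k. t * side_dir n j (loc_index n l0 j) r k) s) k (loc_index n l0 k) (flat k (loc_index n l0 k)) =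
    side_noise n a s k (loc_index n l0 k) (flat k (loc_index n l0 k))" if "k \<in> {last_level<..<j}" for k
    unfolding side_noise_dot dot_translate dot_scale_right
    using side_dir_orth[of k j n "flat k (loc_index n l0 k)" r l0] that j r flat_side by auto
  then show ?thesis unfolding weight_def by simp
qed

text \<open>The fluctuation depends on \<open>l\<close> only and stays inside the integral. The
  other terms are integrated out by translations that fix path and weight: neither involves
  \<open>e\<close>, and the stopping direction at level \<open>j\<close> is orthogonal to those in
  the weight. The constant is \<open>16 + 5 * 4 + 2 * 4 * 4 = 68\<close>, for the thresholds, the
  five noises of \<open>e\<close> and the two of \<open>s\<close>.\<close>

lemma expected_level_on_path:
  fixes l0 :: "nat \<Rightarrow> real"
  assumes j: "j \<le> finest n"
  defines "\<kappa> \<equiv> loc_index n l0"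
  shows "(\<integral>\<^sup>+\<omega>. on_path n (path n l0) (fst \<omega>) * ennreal (wt \<kappa> j (fst (snd \<omega>)) * err \<kappa> j (fst \<omega>) (fst (snd \<omega>)) (snd (snd \<omega>))) \<partial>Q)
    \<le> ennreal ((1 / 2) ^ (j - Suc last_level)) *
      (\<integral>\<^sup>+\<omega>. on_path n (path n l0) (fst \<omega>) * ennreal (12 * fluctuation n a \<kappa> (fst \<omega>) j + 68 * sd j) \<partial>Q)"
proof -
  let ?l = "\<lambda>\<omega>::sample3. fst \<omega>" and ?s = "\<lambda>\<omega>::sample3. fst (snd \<omega>)" and ?e = "\<lambda>\<omega>::sample3. snd (snd \<omega>)"
  let ?F = "\<lambda>\<omega>. fluctuation n a \<kappa> (?l \<omega>) j"
  define P where "P \<omega> = on_path n (path n l0) (?l \<omega>)" for \<omega>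
  define W where "W \<omega> = ennreal (wt \<kappa> j (?s \<omega>))" for \<omega>
  define q where "q = ennreal ((1 / 2) ^ (j - Suc last_level))"
  have [measurable]: "P \<in> borel_measurable (sample_space3 n)" "W \<in> borel_measurable (sample_space3 n)"
    unfolding P_def W_def by measurable
  have sd: "sd j > 0" by (rule mean_sd_pos[OF \<sigma>])
  have PW: "(\<integral>\<^sup>+\<omega>. P \<omega> * W \<omega> \<partial>Q) \<le> q * (\<integral>\<^sup>+\<omega>. P \<omega> \<partial>Q)"
    unfolding P_def W_def q_def \<kappa>_def by (rule expected_weight[OF _ j]) measurable
  have I1: "(\<integral>\<^sup>+\<omega>. P \<omega> * W \<omega> * ennreal (12 * ?F \<omega> + 16 * sd j) \<partial>Q) \<le> q * (\<integral>\<^sup>+\<omega>. P \<omega> * ennreal (12 * ?F \<omega> + 16 * sd j) \<partial>Q)"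
    using expected_weight[of "\<lambda>l. on_path n (path n l0) l * ennreal (12 * fluctuation n a \<kappa> l j + 16 * sd j)" j l0] j
    unfolding P_def W_def q_def \<kappa>_def by (simp add: mult_ac)
  have I2: "(\<integral>\<^sup>+\<omega>. P \<omega> * W \<omega> * ennreal \<bar>noise_mean n a (?e \<omega>) j i\<bar> \<partial>Q) \<le> ennreal (4 * sd j) * (q * (\<integral>\<^sup>+\<omega>. P \<omega> \<partial>Q))" for i
  proof -
    have "(\<integral>\<^sup>+\<omega>. P \<omega> * W \<omega> * ennreal \<bar>noise_mean n a (?e \<omega>) j i\<bar> \<partial>Q) \<le> ennreal (4 * sd j) * (\<integral>\<^sup>+\<omega>. P \<omega> * W \<omega> \<partial>Q)"
      unfolding P_def W_def noise_mean_dot by (rule abs_e) (auto intro: sd block_dir_norm_sd)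
    also have "\<dots> \<le> ennreal (4 * sd j) * (q * (\<integral>\<^sup>+\<omega>. P \<omega> \<partial>Q))" by (intro mult_left_mono PW) simp
    finally show ?thesis .
  qed
  have I3: "(\<integral>\<^sup>+\<omega>. P \<omega> * W \<omega> * ennreal \<bar>side_noise n a (?s \<omega>) j (\<kappa> j) r\<bar> \<partial>Q) \<le> ennreal (4 * sd j) * (q * (\<integral>\<^sup>+\<omega>. P \<omega> \<partial>Q))"
    if r: "r \<in> {1, -1}" for r
  proof -
    have "(\<integral>\<^sup>+\<omega>. P \<omega> * W \<omega> * ennreal \<bar>side_noise n a (?s \<omega>) j (\<kappa> j) r\<bar> \<partial>Q) \<le> ennreal (4 * sd j) * (\<integral>\<^sup>+\<omega>. P \<omega> * W \<omega> \<partial>Q)"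
      unfolding P_def W_def side_noise_dot
    proof (rule abs_s)
      show "3 * \<sigma>\<^sup>2 * dot n (side_dir n j (\<kappa> j) r) (side_dir n j (\<kappa> j) r) \<le> (sd j)\<^sup>2"
        using r by (intro norm_bounds side_dir_norm) auto
      show "ennreal (wt \<kappa> j (translate n (\<lambda>k. t * side_dir n j (\<kappa> j) r k) s)) = ennreal (wt \<kappa> j s)" for t s
        unfolding \<kappa>_def using weight_translate[OF j r] by simp
    qed (use sd in auto)
    also have "\<dots> \<le> ennreal (4 * sd j) * (q * (\<integral>\<^sup>+\<omega>. P \<omega> \<partial>Q))" by (intro mult_left_mono PW) simp
    finally show ?thesis .
  qed
  have split: "P \<omega> * ennreal (wt \<kappa> j (?s \<omega>) * err \<kappa> j (?l \<omega>) (?s \<omega>) (?e \<omega>)) =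
     P \<omega> * W \<omega> * ennreal (12 * ?F \<omega> + 16 * sd j)
     + (\<Sum>p\<in>{-2..2}. P \<omega> * W \<omega> * ennreal \<bar>noise_mean n a (?e \<omega>) j (\<kappa> j + p)\<bar>)
     + (\<Sum>r\<in>{1, -1}. ennreal 4 * (P \<omega> * W \<omega> * ennreal \<bar>side_noise n a (?s \<omega>) j (\<kappa> j) r\<bar>))" for \<omega>
  proof -
    have "err \<kappa> j (?l \<omega>) (?s \<omega>) (?e \<omega>) = (12 * ?F \<omega> + 16 * sd j) + (\<Sum>p\<in>{-2..2}. \<bar>noise_mean n a (?e \<omega>) j (\<kappa> j + p)\<bar>)
      + (\<Sum>r\<in>{1, -1}. 4 * \<bar>side_noise n a (?s \<omega>) j (\<kappa> j) r\<bar>)"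
      unfolding level_error_def by simp
    moreover have "ennreal (x + y + z) = ennreal x + ennreal y + ennreal z" if "0 \<le> x" "0 \<le> y" "0 \<le> z" for x y z
      using that by simp
    ultimately have "ennreal (err \<kappa> j (?l \<omega>) (?s \<omega>) (?e \<omega>)) = ennreal (12 * ?F \<omega> + 16 * sd j)
      + ennreal (\<Sum>p\<in>{-2..2}. \<bar>noise_mean n a (?e \<omega>) j (\<kappa> j + p)\<bar>)
      + ennreal (\<Sum>r\<in>{1, -1}. 4 * \<bar>side_noise n a (?s \<omega>) j (\<kappa> j) r\<bar>)"
      using fluctuation_nonneg[of n a \<kappa> "?l \<omega>" j] sd by (simp add: sum_nonneg del: sum.insert)
    also have "ennreal (\<Sum>p\<in>{-2..2}. \<bar>noise_mean n a (?e \<omega>) j (\<kappa> j + p)\<bar>) = (\<Sum>p\<in>{-2..2}. ennreal \<bar>noise_mean n a (?e \<omega>) j (\<kappa> j + p)\<bar>)"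
      by (rule sum_ennreal[symmetric]) simp
    also have "ennreal (\<Sum>r\<in>{1, -1}. 4 * \<bar>side_noise n a (?s \<omega>) j (\<kappa> j) r\<bar>) = (\<Sum>r\<in>{1, -1}. ennreal (4 * \<bar>side_noise n a (?s \<omega>) j (\<kappa> j) r\<bar>))"
      by (rule sum_ennreal[symmetric]) simp
    also have "\<dots> = (\<Sum>r\<in>{1, -1}. ennreal 4 * ennreal \<bar>side_noise n a (?s \<omega>) j (\<kappa> j) r\<bar>)"
      by (intro sum.cong refl ennreal_mult) auto
    finally have e: "ennreal (err \<kappa> j (?l \<omega>) (?s \<omega>) (?e \<omega>)) = ennreal (12 * ?F \<omega> + 16 * sd j)
      + (\<Sum>p\<in>{-2..2}. ennreal \<bar>noise_mean n a (?e \<omega>) j (\<kappa> j + p)\<bar>)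
      + (\<Sum>r\<in>{1, -1}. ennreal 4 * ennreal \<bar>side_noise n a (?s \<omega>) j (\<kappa> j) r\<bar>)" .
    have "ennreal (wt \<kappa> j (?s \<omega>) * err \<kappa> j (?l \<omega>) (?s \<omega>) (?e \<omega>)) = W \<omega> * ennreal (err \<kappa> j (?l \<omega>) (?s \<omega>) (?e \<omega>))"
      unfolding W_def by (rule ennreal_mult[OF less_imp_le[OF weight_pos] level_error_nonneg])
    then have "P \<omega> * ennreal (wt \<kappa> j (?s \<omega>) * err \<kappa> j (?l \<omega>) (?s \<omega>) (?e \<omega>)) = P \<omega> * W \<omega> * ennreal (12 * ?F \<omega> + 16 * sd j)
      + (\<Sum>p\<in>{-2..2}. P \<omega> * W \<omega> * ennreal \<bar>noise_mean n a (?e \<omega>) j (\<kappa> j + p)\<bar>)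
      + (\<Sum>r\<in>{1, -1}. P \<omega> * W \<omega> * (ennreal 4 * ennreal \<bar>side_noise n a (?s \<omega>) j (\<kappa> j) r\<bar>))"
      unfolding e by (simp only: distrib_left sum_distrib_left mult.assoc)
    moreover have "(\<Sum>r\<in>{1, -1}. P \<omega> * W \<omega> * (ennreal 4 * ennreal \<bar>side_noise n a (?s \<omega>) j (\<kappa> j) r\<bar>))
      = (\<Sum>r\<in>{1, -1}. ennreal 4 * (P \<omega> * W \<omega> * ennreal \<bar>side_noise n a (?s \<omega>) j (\<kappa> j) r\<bar>))"
      by (intro sum.cong refl) (simp only: mult_ac)
    ultimately show ?thesis by simp
  qed
  have "(\<integral>\<^sup>+\<omega>. P \<omega> * ennreal (wt \<kappa> j (?s \<omega>) * err \<kappa> j (?l \<omega>) (?s \<omega>) (?e \<omega>)) \<partial>Q) =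
     (\<integral>\<^sup>+\<omega>. P \<omega> * W \<omega> * ennreal (12 * ?F \<omega> + 16 * sd j) \<partial>Q)
     + (\<Sum>p\<in>{-2..2}. \<integral>\<^sup>+\<omega>. P \<omega> * W \<omega> * ennreal \<bar>noise_mean n a (?e \<omega>) j (\<kappa> j + p)\<bar> \<partial>Q)
     + (\<Sum>r\<in>{1, -1}. ennreal 4 * (\<integral>\<^sup>+\<omega>. P \<omega> * W \<omega> * ennreal \<bar>side_noise n a (?s \<omega>) j (\<kappa> j) r\<bar> \<partial>Q))"
    unfolding split by (simp add: nn_integral_add nn_integral_sum nn_integral_cmult del: sum.insert sum_ennreal)
  also have "\<dots> \<le> q * (\<integral>\<^sup>+\<omega>. P \<omega> * ennreal (12 * ?F \<omega> + 16 * sd j) \<partial>Q)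
     + (\<Sum>p\<in>{-2..2::int}. ennreal (4 * sd j) * (q * (\<integral>\<^sup>+\<omega>. P \<omega> \<partial>Q)))
     + (\<Sum>r\<in>{1, -1::int}. ennreal 4 * (ennreal (4 * sd j) * (q * (\<integral>\<^sup>+\<omega>. P \<omega> \<partial>Q))))"
    by (intro add_mono sum_mono mult_left_mono I1 I2 I3) auto
  also have "\<dots> = q * ((\<integral>\<^sup>+\<omega>. P \<omega> * ennreal (12 * ?F \<omega> + 16 * sd j) \<partial>Q) + (\<integral>\<^sup>+\<omega>. P \<omega> * ennreal (52 * sd j) \<partial>Q))"
  proof -
    define B where "B = (\<integral>\<^sup>+\<omega>. P \<omega> \<partial>Q)"
    define x where "x = ennreal (4 * sd j) * (q * B)"
    have "ennreal (52 * sd j) = ennreal (5 * (4 * sd j)) + ennreal (8 * (4 * sd j))"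
      using sd by (subst ennreal_plus[symmetric]) auto
    also have "\<dots> = ennreal 5 * ennreal (4 * sd j) + ennreal 8 * ennreal (4 * sd j)"
      using sd by (subst (1 2) ennreal_mult) auto
    finally have "q * (B * ennreal (52 * sd j)) = ennreal 5 * x + ennreal 8 * x"
      by (simp only: x_def distrib_left mult_ac)
    moreover have "(\<Sum>p\<in>{-2..2::int}. x) = ennreal 5 * x" by simp
    moreover have "(\<Sum>r\<in>{1, -1::int}. ennreal 4 * x) = ennreal 8 * x"
      by (simp flip: distrib_right)
    moreover have "(\<integral>\<^sup>+\<omega>. P \<omega> * ennreal (52 * sd j) \<partial>Q) = B * ennreal (52 * sd j)"
      unfolding B_def by (rule nn_integral_multc) measurable
    ultimately show ?thesis unfolding B_def[symmetric] x_def[symmetric] by (simp only: distrib_left add.assoc)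
  qed
  also have "(\<integral>\<^sup>+\<omega>. P \<omega> * ennreal (12 * ?F \<omega> + 16 * sd j) \<partial>Q) + (\<integral>\<^sup>+\<omega>. P \<omega> * ennreal (52 * sd j) \<partial>Q)
     = (\<integral>\<^sup>+\<omega>. P \<omega> * ennreal (12 * ?F \<omega> + 16 * sd j) + P \<omega> * ennreal (52 * sd j) \<partial>Q)"
    by (rule nn_integral_add[symmetric]) measurable
  also have "\<dots> = (\<integral>\<^sup>+\<omega>. P \<omega> * ennreal (12 * ?F \<omega> + 68 * sd j) \<partial>Q)"
  proof (intro nn_integral_cong)
    fix \<omega>
    have "ennreal (12 * ?F \<omega> + 68 * sd j) = ennreal (12 * ?F \<omega> + 16 * sd j) + ennreal (52 * sd j)"
      using sd fluctuation_nonneg[of n a \<kappa> "?l \<omega>" j] by (subst ennreal_plus[symmetric]) auto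
    then show "P \<omega> * ennreal (12 * ?F \<omega> + 16 * sd j) + P \<omega> * ennreal (52 * sd j) = P \<omega> * ennreal (12 * ?F \<omega> + 68 * sd j)"
      by (simp only: distrib_left)
  qed
  finally show ?thesis by (simp add: P_def q_def)
qed

text \<open>The bound on the expected fluctuation concerns the random path, so it is used only after
  the paths have been summed up again. The constant is \<open>12 * 48 + 68\<close>.\<close>

lemma expected_level:
  assumes j: "j \<le> finest n"
  shows "(\<integral>\<^sup>+\<omega>. ennreal (wt (loc_index n (fst \<omega>)) j (fst (snd \<omega>)) * err (loc_index n (fst \<omega>)) j (fst \<omega>) (fst (snd \<omega>)) (snd (snd \<omega>))) \<partial>Q)
    \<le> ennreal (644 * ((1 / 2) ^ (j - Suc last_level) * sd j))" (is "?I \<le> _")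
  and "(\<lambda>\<omega>. ennreal (wt (loc_index n (fst \<omega>)) j (fst (snd \<omega>)) * err (loc_index n (fst \<omega>)) j (fst \<omega>) (fst (snd \<omega>)) (snd (snd \<omega>))))
    \<in> borel_measurable (sample_space3 n)"
proof -
  interpret P: prob_space Q by (rule prob_space_samples)
  define q where "q = ennreal ((1 / 2) ^ (j - Suc last_level))"
  define T where "T \<kappa> \<omega> = ennreal (wt \<kappa> j (fst (snd \<omega>)) * err \<kappa> j (fst \<omega>) (fst (snd \<omega>)) (snd (snd \<omega>)))" for \<kappa> and \<omega> :: sample3
  have [measurable]: "T \<kappa> \<in> borel_measurable (sample_space3 n)" for \<kappa>
    unfolding T_def level_error_def by measurable
  have path: "path n l k = loc_index n l k" if "k \<le> j" for l k
    using that j by (simp add: path_def)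
  have T_path: "T (path n l) = T (loc_index n l)" for l
    using weight_cong[of j "path n l" "loc_index n l"] level_error_cong[of j "path n l" "loc_index n l"] path
    by (simp add: T_def fun_eq_iff)
  have F_path: "fluctuation n a (path n l) l' j = fluctuation n a (loc_index n l) l' j" for l l'
    using path by (intro fluctuation_cong) auto
  have dec: "T (loc_index n (fst \<omega>)) \<omega> = (\<Sum>\<kappa>\<in>paths n. on_path n \<kappa> (fst \<omega>) * T \<kappa> \<omega>)" for \<omega>
    using sum_on_path[of n "fst \<omega>" "\<lambda>\<kappa>. T \<kappa> \<omega>"] by (simp add: T_path)
  show "(\<lambda>\<omega>. ennreal (wt (loc_index n (fst \<omega>)) j (fst (snd \<omega>)) * err (loc_index n (fst \<omega>)) j (fst \<omega>) (fst (snd \<omega>)) (snd (snd \<omega>))))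
    \<in> borel_measurable (sample_space3 n)"
    unfolding T_def[symmetric] dec by measurable
  have "?I = (\<Sum>\<kappa>\<in>paths n. \<integral>\<^sup>+\<omega>. on_path n \<kappa> (fst \<omega>) * T \<kappa> \<omega> \<partial>Q)"
    unfolding T_def[symmetric] dec by (rule nn_integral_sum) measurable
  also have "\<dots> \<le> (\<Sum>\<kappa>\<in>paths n. q * (\<integral>\<^sup>+\<omega>. on_path n \<kappa> (fst \<omega>) * ennreal (12 * fluctuation n a \<kappa> (fst \<omega>) j + 68 * sd j) \<partial>Q))"
  proof (rule sum_mono)
    fix \<kappa> assume "\<kappa> \<in> paths n"
    then obtain l0 where "\<kappa> = path n l0" by (auto simp: paths_def)
    then show "(\<integral>\<^sup>+\<omega>. on_path n \<kappa> (fst \<omega>) * T \<kappa> \<omega> \<partial>Q) \<le> q * (\<integral>\<^sup>+\<omega>. on_path n \<kappa> (fst \<omega>) * ennreal (12 * fluctuation n a \<kappa> (fst \<omega>) j + 68 * sd j) \<partial>Q)"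
      using expected_level_on_path[OF j, of l0] by (simp add: T_path F_path T_def[symmetric] q_def)
  qed
  also have "\<dots> = q * (\<integral>\<^sup>+\<omega>. (\<Sum>\<kappa>\<in>paths n. on_path n \<kappa> (fst \<omega>) * ennreal (12 * fluctuation n a \<kappa> (fst \<omega>) j + 68 * sd j)) \<partial>Q)"
    unfolding sum_distrib_left[symmetric] by (subst nn_integral_sum) auto
  also have "\<dots> = q * (\<integral>\<^sup>+\<omega>. ennreal (12 * fluctuation n a (loc_index n (fst \<omega>)) (fst \<omega>) j + 68 * sd j) \<partial>Q)"
    using sum_on_path[where T="\<lambda>\<kappa>. ennreal (12 * fluctuation n a \<kappa> _ j + 68 * sd j)"] by (simp add: F_path)
  also have "\<dots> \<le> q * ennreal (644 * sd j)"
  proof (rule mult_left_mono)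
    have [measurable]: "(\<lambda>\<omega>::sample3. fluctuation n a (loc_index n (fst \<omega>)) (fst \<omega>) j) \<in> borel_measurable (sample_space3 n)"
      unfolding fluctuation_def by measurable
    have "(\<integral>\<^sup>+\<omega>. ennreal (12 * fluctuation n a (loc_index n (fst \<omega>)) (fst \<omega>) j + 68 * sd j) \<partial>Q) =
      ennreal 12 * (\<integral>\<^sup>+\<omega>. ennreal (fluctuation n a (loc_index n (fst \<omega>)) (fst \<omega>) j) \<partial>Q) + ennreal (68 * sd j)"
      using mean_sd_nonneg[of n \<sigma> j]
      by (simp add: ennreal_plus ennreal_mult fluctuation_nonneg nn_integral_add nn_integral_cmult P.emeasure_space_1)
    also have "\<dots> \<le> ennreal 12 * ennreal (48 * sd j) + ennreal (68 * sd j)"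
      by (intro add_right_mono mult_left_mono expected_fluctuation j) simp
    also have "\<dots> = ennreal (644 * sd j)"
      using mean_sd_nonneg[of n \<sigma> j] by (subst ennreal_mult[symmetric], simp, simp, subst ennreal_plus[symmetric]) auto
    finally show "(\<integral>\<^sup>+\<omega>. ennreal (12 * fluctuation n a (loc_index n (fst \<omega>)) (fst \<omega>) j + 68 * sd j) \<partial>Q) \<le> ennreal (644 * sd j)" .
  qed simp
  also have "\<dots> = ennreal (644 * ((1 / 2) ^ (j - Suc last_level) * sd j))"
    unfolding q_def using mean_sd_nonneg[of n \<sigma> j] by (subst ennreal_mult[symmetric]) (auto simp: mult_ac)
  finally show "?I \<le> ennreal (644 * ((1 / 2) ^ (j - Suc last_level) * sd j))" .
qed

text \<open>The levels cost \<open>644 * 10 * 144 = 927360\<close> and the gap costs 16; the sum is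
  rounded up.\<close>

lemma M_hat_risk_bound: "M_hat_risk n \<sigma> f \<le> ennreal 1000000 * benchmark n \<sigma> f"
proof -
  interpret P: prob_space Q by (rule prob_space_samples)
  define E where "E j \<omega> = ennreal (wt (loc_index n (fst \<omega>)) j (fst (snd \<omega>)) * err (loc_index n (fst \<omega>)) j (fst \<omega>) (fst (snd \<omega>)) (snd (snd \<omega>)))"
    for j and \<omega> :: sample3
  have E: "E j \<in> borel_measurable (sample_space3 n)" if "j \<le> finest n" for j
    unfolding E_def[abs_def] by (rule expected_level(2)[OF that])
  then have E': "E j \<in> borel_measurable Q" if "j \<le> finest n" for j
    using that by (simp add: measurable_cong_sets[OF sets_samples refl])
  have "M_hat_risk n \<sigma> f \<le> (\<integral>\<^sup>+\<omega>. ennreal (a best - min_value f) + (\<Sum>j\<le>finest n. E j \<omega>) \<partial>Q)"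
    using M_split_pointwise by (intro M_hat_risk_le borel_measurable_add borel_measurable_sum E) (auto simp: E_def)
  also have "\<dots> = ennreal (a best - min_value f) + (\<Sum>j\<le>finest n. \<integral>\<^sup>+\<omega>. E j \<omega> \<partial>Q)"
  proof (subst nn_integral_add)
    show "(\<lambda>\<omega>. \<Sum>j\<le>finest n. E j \<omega>) \<in> borel_measurable Q" by (intro borel_measurable_sum E') auto
    have "(\<integral>\<^sup>+\<omega>. (\<Sum>j\<le>finest n. E j \<omega>) \<partial>Q) = (\<Sum>j\<le>finest n. \<integral>\<^sup>+\<omega>. E j \<omega> \<partial>Q)"
      by (intro nn_integral_sum E') auto
    then show "(\<integral>\<^sup>+\<omega>. ennreal (a best - min_value f) \<partial>Q) + (\<integral>\<^sup>+\<omega>. (\<Sum>j\<le>finest n. E j \<omega>) \<partial>Q)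
      = ennreal (a best - min_value f) + (\<Sum>j\<le>finest n. \<integral>\<^sup>+\<omega>. E j \<omega> \<partial>Q)"
      by (simp add: P.emeasure_space_1)
  qed simp
  also have "\<dots> \<le> ennreal (a best - min_value f) + ennreal (927360 * (sd last_level / 144))"
  proof (rule add_left_mono)
    have "(\<Sum>j\<le>finest n. \<integral>\<^sup>+\<omega>. E j \<omega> \<partial>Q) \<le> (\<Sum>j\<le>finest n. ennreal (644 * ((1 / 2) ^ (j - Suc last_level) * sd j)))"
      unfolding E_def by (intro sum_mono expected_level(1)) auto
    also have "\<dots> = ennreal (\<Sum>j\<le>finest n. 644 * ((1 / 2) ^ (j - Suc last_level) * sd j))"
      by (rule sum_ennreal) (simp add: mean_sd_nonneg)
    also have "\<dots> \<le> ennreal (927360 * (sd last_level / 144))"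
      using weighted_sum_mean_sd[OF last_level(1) \<sigma>]
      by (intro ennreal_leI) (simp add: sum_distrib_left[symmetric])
    finally show "(\<Sum>j\<le>finest n. \<integral>\<^sup>+\<omega>. E j \<omega> \<partial>Q) \<le> ennreal (927360 * (sd last_level / 144))" .
  qed
  also have "\<dots> = ennreal 16 * ennreal ((a best - min_value f) / 16) + ennreal 927360 * ennreal (sd last_level / 144)"
    using min_value_le_best mean_sd_nonneg[of n \<sigma> last_level] by (subst (1 2) ennreal_mult[symmetric]) auto
  also have "\<dots> \<le> ennreal 16 * benchmark n \<sigma> f + ennreal 927360 * benchmark n \<sigma> f"
    by (intro add_mono mult_left_mono benchmark_ge_gap last_level(2)) auto
  also have "\<dots> = ennreal 927376 * benchmark n \<sigma> f"
    by (simp flip: distrib_right)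
  also have "\<dots> \<le> ennreal 1000000 * benchmark n \<sigma> f"
    by (intro mult_right_mono ennreal_leI) auto
  finally show ?thesis .
qed

end

theorem theorem4p3:
  shows "\<exists>C\<^sub>3::real. C\<^sub>3 > 0 \<and>
    (\<forall>n::nat. \<forall>\<sigma>::real. n \<ge> 1 \<longrightarrow> \<sigma> > 0 \<longrightarrow>
      (\<forall>f\<in>conv_fun. M_hat_risk n \<sigma> f \<le> ennreal C\<^sub>3 * benchmark n \<sigma> f))"
proof (intro exI[of _ 1000000] conjI allI impI ballI)
  fix n :: nat and \<sigma> :: real and f assume "n \<ge> 1" "\<sigma> > 0" "f \<in> conv_fun"
  then interpret regression n \<sigma> f by unfold_locales
  show "M_hat_risk n \<sigma> f \<le> ennreal 1000000 * benchmark n \<sigma> f" by (rule M_hat_risk_bound)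
qed simp

end
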